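(* Let $\gamma$ be a nondegenerate positive definite mutation loop, with total partition $q$-series $\mathcal Z_\gamma(q)$, Neumann--Zagier matrix $A_+$, cluster transformation $\mu_\gamma$, and Jacobian matrix $J_\gamma(y)$ of $\mu_\gamma$. Let $\eta$ be the unique positive real solution of $\mu_\gamma(y)=y$ and let $a=\sum_{t=1}^{T}L(z_+(\eta;t))$. Then, for $\varepsilon$ tending to $0$ along the positive real axis, $$\lim_{\varepsilon\to 0}\mathcal Z_\gamma\bigl(e^{-\varepsilon}\bigr)\,e^{-\frac{a}{\varepsilon}}=\sqrt{\frac{\det A_+}{\det\bigl(I-J_\gamma(\eta)\bigr)}} .$$
   Context: **Mutation loops.** Quivers are finite directed multigraphs on $\mathbf I=\{1,\dots,n\}$ without 1-loops and 2-cycles; $Q_{ij}$ is the number of arrows from $i$ to $j$. The mutation $\mu_k$ transforms $Q$ as follows: (i) for each path $i\to k\to j$ add an arrow $i\to j$; (ii) reverse all arrows incident to $k$; (iii) remove all 2-cycles. A permutation $\nu$ of $\mathbf I$ acts by $\nu(Q)_{ij}=Q_{\nu^{-1}(i)\nu^{-1}(j)}$. A mutation loop is a triple $\gamma=(Q,m,\nu)$, $m=(m_1,\dots,m_T)$ a sequence of vertices, $\nu$ a permutation of $\mathbf I$, such that with $Q(0)=Q$, $Q(t)=\mu_{m_t}(Q(t-1))$ one has $\nu(Q(T))=Q(0)$. **Cluster transformation.** A $Y$-seed is a pair $(Q,Y)$ with $Y=(Y_1,\dots,Y_n)$ subtraction-free rational functions over $\mathbb Q$ in $y_1,\dots,y_n$.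 Put $\mu_k(Q,Y)=(\mu_k(Q),\widetilde Y)$ with $\widetilde Y_k=Y_k^{-1}$, and for $i\neq k$: $\widetilde Y_i=Y_i(Y_k^{-1}+1)^{-Q_{ki}}$ if $Q_{ik}=0$, $\widetilde Y_i=Y_i(Y_k+1)^{Q_{ik}}$ if $Q_{ki}=0$. Starting from $Y(0)=(y_1,\dots,y_n)$, let $(Q(t),Y(t))=\mu_{m_t}(Q(t-1),Y(t-1))$. The cluster transformation is $\mu_\gamma(y)=\nu(Y(T))$, where $\nu(Y)_i=Y_{\nu^{-1}(i)}$. With $\mu_i$ the $i$-th component of $\mu_\gamma$, $J_\gamma(y)=(\partial\mu_i/\partial y_j(y))_{i,j}$. Put $z_+(y;t)=\dfrac{Y_{m_t}(t-1)}{1+Y_{m_t}(t-1)}$ for $t=1,\dots,T$. **Neumann--Zagier matrices.** Let $\Delta=\{1,\dots,T\}$. On $\{(i,t):1\le i\le n,\ 0\le t\le T\}$ let $\sim$ be the equivalence relation generated by $(i,t-1)\sim(i,t)$ if $i\ne m_t$ ($1\le t\le T$), and $(\nu(i),T)\sim(i,0)$ for all $i$. Let $E$ be the set of equivalence classes. For $e\in E$, $t\in\Delta$ let $N_0^{et}$ be the number of elements of $\{(m_t,t-1),(m_t,t)\}$ lying in $e$, let $N_+^{et}=\sum_{i:(i,t-1)\in e}Q_{m_t,i}(t-1)$ and $N_-^{et}=\sum_{i:(i,t-1)\in e}Q_{i,m_t}(t-1)$. Define the $E\times\Delta$ matrices $A_\pm=N_0-N_\pm$. (It is known that $A_+A_-^{\mathsf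 T}=A_-A_+^{\mathsf T}$.) $\gamma$ is nondegenerate if $A_+$ is non-singular, and a nondegenerate $\gamma$ is positive definite if the (symmetric) matrix $A_+^{-1}A_-$ is positive definite. For such $\gamma$, $\mu_\gamma(y)=y$ has exactly one solution $\eta\in(\mathbb R_{>0})^n$. **Partition $q$-series.** Let $Z_\gamma=\{(u,v):u\in\mathbb Z^\Delta,\ v\in\mathbb Q^\Delta,\ A_-u=A_+v\}$, $B_\gamma=\{(A_+^{\mathsf T}w,A_-^{\mathsf T}w):w\in\mathbb Z^E\}\subset Z_\gamma$, $H_\gamma=Z_\gamma/B_\gamma$. For $\sigma\in H_\gamma$ (a coset) let $\sigma_{\ge0}=\{(u,v)\in\sigma: u_i\ge 0\ \forall i\}$, and $$\mathcal Z_\gamma^\sigma(q)=\sum_{(u,v)\in\sigma_{\ge0}}\frac{q^{\frac12u\cdot v}}{(q)_{u_1}\cdots(q)_{u_T}},\qquad (q)_n=\prod_{k=1}^n(1-q^k),\qquad \mathcal Z_\gamma(q)=\sum_{\sigma\in H_\gamma}\mathcal Z_\gamma^\sigma(q).$$ **Rogers dilogarithm.** $L(x)=-\frac12\int_0^x\left\{\frac{\log(1-y)}{y}+\frac{\log y}{1-y}\right\}dy$ for $0\le x\le1$.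
   Formalization: The gluing (ν(i),T)~(i,0) is corrected to (i,T)~(ν(i),0), as ν(Q(T))=Q(0) forces; the literal one can break A₊A₋ᵀ=A₋A₊ᵀ and leave H_γ undefined. In det A₊, row s is the class of (m_s,s−1), which fixes the sign. *)

theory Defs
  imports
    "HOL-Analysis.Infinite_Sum"
    "HOL-Analysis.Henstock_Kurzweil_Integration"
    "HOL-Analysis.Derivative"
    "HOL-Combinatorics.Permutations"
    "Jordan_Normal_Form.Determinant"
    "Jordan_Normal_Form.Gauss_Jordan_Elimination"
begin

text \<open>
  Vertices are numbered from 0, i.e. the vertex set is \<open>{..<n}\<close>, and the mutation steps are
  numbered from 0, i.e. \<open>\<Delta> = {..<T}\<close>.  Step \<open>t\<close> mutates at \<open>m ! t\<close> and leads from time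
  \<open>t\<close> to time \<open>Suc t\<close>.  So data attached to the 1-based step \<open>t\<close> and read off
  at time \<open>t - 1\<close> appear below at time \<open>t\<close>.
\<close>

section \<open>Quivers and mutation loops\<close>

text \<open>\<open>Q i j\<close> is the number of arrows from \<open>i\<close> to \<open>j\<close>.\<close>

type_synonym quiver = "nat \<Rightarrow> nat \<Rightarrow> nat"

definition is_quiver :: "nat \<Rightarrow> quiver \<Rightarrow> bool" where
  "is_quiver n Q \<longleftrightarrow> (\<forall>i<n. Q i i = 0) \<and> (\<forall>i<n. \<forall>j<n. Q i j = 0 \<or> Q j i = 0)"

definition add_paths :: "nat \<Rightarrow> quiver \<Rightarrow> quiver" where
  "add_paths k Q = (\<lambda>i j. Q i j + Q i k * Q k j)"

definition reverse_at :: "nat \<Rightarrow> quiver \<Rightarrow> quiver" where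
  "reverse_at k Q = (\<lambda>i j. if i = k \<or> j = k then Q j i else Q i j)"

text \<open>The subtraction is the truncated one on \<^typ>\<open>nat\<close>: 2-cycles cancel in pairs of arrows.\<close>

definition cancel_2_cycles :: "quiver \<Rightarrow> quiver" where
  "cancel_2_cycles Q = (\<lambda>i j. Q i j - Q j i)"

definition mut_quiver :: "nat \<Rightarrow> quiver \<Rightarrow> quiver" where
  "mut_quiver k Q = cancel_2_cycles (reverse_at k (add_paths k Q))"

record loop_data =
  nverts :: nat
  quiv :: quiver
  mseq :: "nat list"
  perm :: "nat \<Rightarrow> nat"

abbreviation nsteps :: "loop_data \<Rightarrow> nat" where
  "nsteps \<gamma> \<equiv> length (mseq \<gamma>)"

primrec quiver_at :: "loop_data \<Rightarrow> nat \<Rightarrow> quiver" where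
  "quiver_at \<gamma> 0 = quiv \<gamma>"
| "quiver_at \<gamma> (Suc t) = mut_quiver (mseq \<gamma> ! t) (quiver_at \<gamma> t)"

definition perm_quiver :: "(nat \<Rightarrow> nat) \<Rightarrow> quiver \<Rightarrow> quiver" where
  "perm_quiver \<nu> Q = (\<lambda>i j. Q (inv_into UNIV \<nu> i) (inv_into UNIV \<nu> j))"

definition mutation_loop :: "loop_data \<Rightarrow> bool" where
  "mutation_loop \<gamma> \<longleftrightarrow>
     nverts \<gamma> \<ge> 1 \<and>
     is_quiver (nverts \<gamma>) (quiv \<gamma>) \<and>
     set (mseq \<gamma>) \<subseteq> {..<nverts \<gamma>} \<and>
     perm \<gamma> permutes {..<nverts \<gamma>} \<and>
     (\<forall>i<nverts \<gamma>. \<forall>j<nverts \<gamma>.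
        perm_quiver (perm \<gamma>) (quiver_at \<gamma> (nsteps \<gamma>)) i j = quiv \<gamma> i j)"

section \<open>The cluster transformation\<close>

text \<open>
  The subtraction-free rational functions \<open>Y\<^sub>i\<close> are represented by their values: \<open>Y_at \<gamma> y t i\<close>
  is \<open>Y\<^sub>i(t)\<close> evaluated at the point \<open>y\<close>.  It has the intended meaning for \<open>y\<close> with
  positive entries, where all denominators are positive.
\<close>

definition mut_Y :: "nat \<Rightarrow> quiver \<Rightarrow> (nat \<Rightarrow> real) \<Rightarrow> nat \<Rightarrow> real" where
  "mut_Y k Q Y = (\<lambda>i.
     if i = k then inverse (Y k)
     else if Q i k = 0 then Y i * (inverse (Y k) + 1) powi (- int (Q k i))
     else Y i * (Y k + 1) ^ Q i k)"

primrec Y_at :: "loop_data \<Rightarrow> (nat \<Rightarrow> real) \<Rightarrow> nat \<Rightarrow> nat \<Rightarrow> real" where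
  "Y_at \<gamma> y 0 = y"
| "Y_at \<gamma> y (Suc t) = mut_Y (mseq \<gamma> ! t) (quiver_at \<gamma> t) (Y_at \<gamma> y t)"

definition cluster_trans :: "loop_data \<Rightarrow> (nat \<Rightarrow> real) \<Rightarrow> nat \<Rightarrow> real" where
  "cluster_trans \<gamma> y = (\<lambda>i. Y_at \<gamma> y (nsteps \<gamma>) (inv_into UNIV (perm \<gamma>) i))"

definition jacobian :: "loop_data \<Rightarrow> (nat \<Rightarrow> real) \<Rightarrow> real mat" where
  "jacobian \<gamma> y = mat (nverts \<gamma>) (nverts \<gamma>)
     (\<lambda>(i, j). deriv (\<lambda>x. cluster_trans \<gamma> (y(j := x)) i) (y j))"

definition positive_fixed_point :: "loop_data \<Rightarrow> (nat \<Rightarrow> real) \<Rightarrow> bool" where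
  "positive_fixed_point \<gamma> \<eta> \<longleftrightarrow>
     (\<forall>i<nverts \<gamma>. \<eta> i > 0) \<and> (\<forall>i<nverts \<gamma>. cluster_trans \<gamma> \<eta> i = \<eta> i)"

definition z_plus :: "loop_data \<Rightarrow> (nat \<Rightarrow> real) \<Rightarrow> nat \<Rightarrow> real" where
  "z_plus \<gamma> y t = Y_at \<gamma> y t (mseq \<gamma> ! t) / (1 + Y_at \<gamma> y t (mseq \<gamma> ! t))"

section \<open>Neumann--Zagier matrices\<close>

definition nodes :: "loop_data \<Rightarrow> (nat \<times> nat) set" where
  "nodes \<gamma> = {(i, t). i < nverts \<gamma> \<and> t \<le> nsteps \<gamma>}"

text \<open>
  Because \<open>\<nu>(Q)\<^sub>i\<^sub>j = Q (\<nu>\<^sup>-\<^sup>1 i) (\<nu>\<^sup>-\<^sup>1 j)\<close> and \<open>\<nu>(Q(T)) = Q(0)\<close>, the vertex \<open>i\<close> at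
  the final time is the vertex \<open>\<nu> i\<close> at the initial time, so \<open>(i, T)\<close> is glued to
  \<open>(\<nu> i, 0)\<close>.  Gluing \<open>(\<nu> i, T)\<close> to \<open>(i, 0)\<close> would go with the opposite convention for
  the action of \<open>\<nu>\<close>; combined with the present action it can break the symmetry of
  \<open>A\<^sub>+ A\<^sub>-\<^sup>T\<close> when \<open>\<nu>\<close> is not an involution, e.g. for the arrows \<open>0 \<rightarrow> 1\<close>, \<open>3 \<rightarrow> 2\<close>,
  \<open>m = [1,3,2]\<close> and \<open>\<nu>\<close> sending 0, 1, 2, 3 to 2, 3, 1, 0.
\<close>

inductive adj :: "loop_data \<Rightarrow> nat \<times> nat \<Rightarrow> nat \<times> nat \<Rightarrow> bool" for \<gamma> where
  step: "i < nverts \<gamma> \<Longrightarrow> t < nsteps \<gamma> \<Longrightarrow> i \<noteq> mseq \<gamma> ! t \<Longrightarrow> adj \<gamma> (i, t) (i, Suc t)"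
| glue: "i < nverts \<gamma> \<Longrightarrow> adj \<gamma> (i, nsteps \<gamma>) (perm \<gamma> i, 0)"

definition class_rel :: "loop_data \<Rightarrow> ((nat \<times> nat) \<times> (nat \<times> nat)) set" where
  "class_rel \<gamma> = {(p, p'). p \<in> nodes \<gamma> \<and> p' \<in> nodes \<gamma> \<and> equivclp (adj \<gamma>) p p'}"

definition E_classes :: "loop_data \<Rightarrow> (nat \<times> nat) set set" where
  "E_classes \<gamma> = nodes \<gamma> // class_rel \<gamma>"

definition N_zero :: "loop_data \<Rightarrow> (nat \<times> nat) set \<Rightarrow> nat \<Rightarrow> nat" where
  "N_zero \<gamma> e t = card ({(mseq \<gamma> ! t, t), (mseq \<gamma> ! t, Suc t)} \<inter> e)"

definition N_plus :: "loop_data \<Rightarrow> (nat \<times> nat) set \<Rightarrow> nat \<Rightarrow> nat" where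
  "N_plus \<gamma> e t = (\<Sum>i | i < nverts \<gamma> \<and> (i, t) \<in> e. quiver_at \<gamma> t (mseq \<gamma> ! t) i)"

definition N_minus :: "loop_data \<Rightarrow> (nat \<times> nat) set \<Rightarrow> nat \<Rightarrow> nat" where
  "N_minus \<gamma> e t = (\<Sum>i | i < nverts \<gamma> \<and> (i, t) \<in> e. quiver_at \<gamma> t i (mseq \<gamma> ! t))"

definition A_plus :: "loop_data \<Rightarrow> (nat \<times> nat) set \<Rightarrow> nat \<Rightarrow> int" where
  "A_plus \<gamma> e t = int (N_zero \<gamma> e t) - int (N_plus \<gamma> e t)"

definition A_minus :: "loop_data \<Rightarrow> (nat \<times> nat) set \<Rightarrow> nat \<Rightarrow> int" where
  "A_minus \<gamma> e t = int (N_zero \<gamma> e t) - int (N_minus \<gamma> e t)"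

text \<open>
  A determinant of an \<open>E \<times> \<Delta>\<close> matrix needs an identification of \<open>E\<close> with \<open>\<Delta>\<close>.  We let
  \<open>s \<in> \<Delta>\<close> correspond to the class that ends at step \<open>s\<close>, i.e. the class of \<open>(m ! s, s)\<close>.
  This map is injective, and it is onto \<open>E\<close> iff \<open>E\<close> and \<open>\<Delta>\<close> have the same number of elements.
  The sign of \<open>det A\<^sub>+\<close> depends on the choice; this one makes
  \<open>det (I - J(\<eta>)) = det (A\<^sub>+ Z\<^sub>- + A\<^sub>- Z\<^sub>+)\<close> hold at a fixed point \<open>\<eta>\<close>, where
  \<open>Z\<^sub>+ = diag(z\<^sub>+)\<close> and \<open>Z\<^sub>- = I - Z\<^sub>+\<close>.
\<close>

definition end_class :: "loop_data \<Rightarrow> nat \<Rightarrow> (nat \<times> nat) set" where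
  "end_class \<gamma> s = class_rel \<gamma> `` {(mseq \<gamma> ! s, s)}"

definition A_plus_mat :: "loop_data \<Rightarrow> real mat" where
  "A_plus_mat \<gamma> = mat (nsteps \<gamma>) (nsteps \<gamma>) (\<lambda>(s, t). real_of_int (A_plus \<gamma> (end_class \<gamma> s) t))"

definition A_minus_mat :: "loop_data \<Rightarrow> real mat" where
  "A_minus_mat \<gamma> = mat (nsteps \<gamma>) (nsteps \<gamma>) (\<lambda>(s, t). real_of_int (A_minus \<gamma> (end_class \<gamma> s) t))"

text \<open>The cardinality condition says that the \<open>E \<times> \<Delta>\<close> matrix \<open>A\<^sub>+\<close> is square.\<close>

definition nondegenerate :: "loop_data \<Rightarrow> bool" where
  "nondegenerate \<gamma> \<longleftrightarrow> card (E_classes \<gamma>) = nsteps \<gamma> \<and> invertible_mat (A_plus_mat \<gamma>)"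

text \<open>
  The matrix \<open>A\<^sub>+\<^sup>-\<^sup>1 A\<^sub>-\<close> is always symmetric, so symmetry is not required in the definition of
  positive definiteness.
\<close>

definition positive_definite :: "loop_data \<Rightarrow> bool" where
  "positive_definite \<gamma> \<longleftrightarrow> nondegenerate \<gamma> \<and>
     (\<forall>x \<in> carrier_vec (nsteps \<gamma>). x \<noteq> 0\<^sub>v (nsteps \<gamma>) \<longrightarrow>
        x \<bullet> ((the (mat_inverse (A_plus_mat \<gamma>)) * A_minus_mat \<gamma>) *\<^sub>v x) > 0)"

section \<open>Partition \<open>q\<close>-series\<close>

definition Z_group :: "loop_data \<Rightarrow> (int vec \<times> rat vec) set" where
  "Z_group \<gamma> = {(u, v). u \<in> carrier_vec (nsteps \<gamma>) \<and> v \<in> carrier_vec (nsteps \<gamma>) \<and>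
     (\<forall>e \<in> E_classes \<gamma>. (\<Sum>t<nsteps \<gamma>. rat_of_int (A_minus \<gamma> e t) * rat_of_int (u $ t)) =
                    (\<Sum>t<nsteps \<gamma>. rat_of_int (A_plus \<gamma> e t) * v $ t))}"

definition B_group :: "loop_data \<Rightarrow> (int vec \<times> rat vec) set" where
  "B_group \<gamma> = range (\<lambda>w :: (nat \<times> nat) set \<Rightarrow> int.
     (vec (nsteps \<gamma>) (\<lambda>t. \<Sum>e\<in>E_classes \<gamma>. A_plus \<gamma> e t * w e),
      vec (nsteps \<gamma>) (\<lambda>t. rat_of_int (\<Sum>e\<in>E_classes \<gamma>. A_minus \<gamma> e t * w e))))"

definition H_group :: "loop_data \<Rightarrow> (int vec \<times> rat vec) set set" where
  "H_group \<gamma> = (\<lambda>(u, v). (\<lambda>(b, c). (u + b, v + c)) ` B_group \<gamma>) ` Z_group \<gamma>"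

definition nonneg_part :: "(int vec \<times> rat vec) set \<Rightarrow> (int vec \<times> rat vec) set" where
  "nonneg_part \<sigma> = {(u, v) \<in> \<sigma>. \<forall>t<dim_vec u. u $ t \<ge> 0}"

definition qfact :: "real \<Rightarrow> nat \<Rightarrow> real" where
  "qfact q n = (\<Prod>k=1..n. 1 - q ^ k)"

text \<open>The series are regarded as functions of a real number \<open>q\<close> with \<open>0 < q < 1\<close>.\<close>

definition partition_series :: "loop_data \<Rightarrow> (int vec \<times> rat vec) set \<Rightarrow> real \<Rightarrow> real" where
  "partition_series \<gamma> \<sigma> q = (\<Sum>\<^sub>\<infinity>(u, v)\<in>nonneg_part \<sigma>.
     q powr of_rat (1/2 * (map_vec rat_of_int u \<bullet> v)) / (\<Prod>t<nsteps \<gamma>. qfact q (nat (u $ t))))"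

text \<open>\<open>H\<^sub>\<gamma>\<close> is finite if \<open>\<gamma>\<close> is nondegenerate; the sum over it is then a finite sum.\<close>

definition total_partition_series :: "loop_data \<Rightarrow> real \<Rightarrow> real" where
  "total_partition_series \<gamma> q = (\<Sum>\<^sub>\<infinity>\<sigma>\<in>H_group \<gamma>. partition_series \<gamma> \<sigma> q)"

section \<open>The Rogers dilogarithm\<close>

definition rogers_L :: "real \<Rightarrow> real" where
  "rogers_L x = - (1/2) * integral {0..x} (\<lambda>y. ln (1 - y) / y + ln y / (1 - y))"

end

theory Submission
  imports Defs "HOL-Probability.Probability" "HOL-Real_Asymp.Real_Asymp"
begin

text \<open>
  Put \<open>Q = A\<^sub>+\<^sup>-\<^sup>1 A\<^sub>-\<close>. Every \<open>u \<in> \<int>\<^sup>\<Delta>\<close> extends to a unique element of \<open>Z\<^sub>\<gamma>\<close>, so the total partition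
  series is the Nahm sum \<open>\<Sum>\<^sub>u q\<^bsup>uQu/2\<^esup> / (q)\<^sub>u\<close>. The symmetry of \<open>A\<^sub>+ A\<^sub>-\<^sup>T\<close> and the equations
  \<open>A\<^sub>+ log z\<^sub>+ = A\<^sub>- log z\<^sub>-\<close> at \<open>\<eta>\<close> (with \<open>z\<^sub>- = 1 - z\<^sub>+\<close>) both follow by telescoping along the loop: for
  functions \<open>X, X'\<close> on the nodes that are constant on the classes, consider the time dependence of
  \<open>\<Sum>\<^sub>i\<^sub>j (Q\<^sub>i\<^sub>j - Q\<^sub>j\<^sub>i) X\<^sub>i X'\<^sub>j\<close> and of \<open>\<Sum>\<^sub>i X\<^sub>i log Y\<^sub>i\<close>. The determinant of \<open>I - J\<close> is compared with that of
  \<open>A\<^sub>+ Z\<^sub>- + A\<^sub>- Z\<^sub>+\<close> by eliminating the variables of one block matrix in two orders.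

  For the asymptotics let \<open>z = z\<^sub>+(\<eta>)\<close> and let \<open>N\<^sub>j\<close> be independent with \<open>P(N\<^sub>j = n)\<close> proportional to
  \<open>z\<^sub>j\<^sup>n / (q)\<^sub>n\<close>. With \<open>G\<^sub>j = \<surd>\<epsilon> (N\<^sub>j + log (1 - z\<^sub>j) / \<epsilon>)\<close> the linear terms in the exponent cancel because of
  the equations above, and the Nahm sum becomes an explicit factor times the expectation of
  \<open>exp (- GQG / 2)\<close>. From \<open>\<Sum>\<^sub>n w\<^sup>n / (q)\<^sub>n = exp (\<Sum>\<^sub>m w\<^sup>m / (m (1 - q\<^sup>m)))\<close> one reads off that the factor contributes
  \<open>exp (a / \<epsilon>) \<Prod>\<^sub>j (1 - z\<^sub>j)\<^bsup>-1/2\<^esup>\<close> and that each \<open>G\<^sub>j\<close> is asymptotically normal with variance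
  \<open>D\<^sub>j = z\<^sub>j / (1 - z\<^sub>j)\<close>. Writing \<open>exp (- GQG / 2)\<close> as the Fourier transform of a Gaussian with covariance \<open>Q\<close>
  reduces the limit of the expectation to dominated convergence and a Gaussian integral, with value
  \<open>det (I + Q D)\<^bsup>-1/2\<^esup>\<close>.
\<close>

hide_const (open) Cartesian_Euclidean_Space.jacobian

section \<open>Strands\<close>

locale mloop =
  fixes \<gamma> :: loop_data
  assumes loop: "mutation_loop \<gamma>"
begin

abbreviation "n \<equiv> nverts \<gamma>"
abbreviation "T \<equiv> nsteps \<gamma>"
abbreviation "k t \<equiv> mseq \<gamma> ! t"
abbreviation "\<nu> \<equiv> perm \<gamma>"
abbreviation "q t \<equiv> quiver_at \<gamma> t"

section \<open>Quivers along the loop and their exchange matrices\<close>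

lemma perm: "\<nu> permutes {..<n}"
  using loop by (simp add: mutation_loop_def)

lemma perm_lt [simp]: "\<nu> i < n \<longleftrightarrow> i < n"
  using permutes_in_image[OF perm, of i] by simp

lemma inv_perm_lt [simp]: "inv_into UNIV \<nu> i < n \<longleftrightarrow> i < n"
  using permutes_in_image[OF permutes_inv[OF perm], of i] by simp

lemma inv_perm_perm [simp]: "inv_into UNIV \<nu> (\<nu> i) = i" "\<nu> (inv_into UNIV \<nu> i) = i"
  using permutes_inverses[OF perm] by auto

lemma k_lt: "t < T \<Longrightarrow> k t < n"
  using loop nth_mem[of t "mseq \<gamma>"] unfolding mutation_loop_def by blast

lemma is_quiver_at: "t \<le> T \<Longrightarrow> is_quiver n (q t)"
proof (induction t)
  case 0
  then show ?case using loop by (simp add: mutation_loop_def)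
next
  case (Suc t)
  show ?case
    by (auto simp: is_quiver_def mut_quiver_def cancel_2_cycles_def)
qed

lemma q_self: "t \<le> T \<Longrightarrow> i < n \<Longrightarrow> q t i i = 0"
  and q_no_2_cycle: "t \<le> T \<Longrightarrow> i < n \<Longrightarrow> j < n \<Longrightarrow> q t i j = 0 \<or> q t j i = 0"
  using is_quiver_at by (auto simp: is_quiver_def)

lemma q_final: "i < n \<Longrightarrow> j < n \<Longrightarrow> q T i j = q 0 (\<nu> i) (\<nu> j)"
proof -
  assume "i < n" "j < n"
  then have "perm_quiver \<nu> (q T) (\<nu> i) (\<nu> j) = q 0 (\<nu> i) (\<nu> j)"
    using loop unfolding mutation_loop_def by simp
  then show ?thesis by (simp add: perm_quiver_def)
qed

text \<open>The skew-symmetric exchange matrix at time \<open>t\<close>. In signed form a pair of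
  opposite arrows contributes 0, so the truncated subtraction in \<open>cancel_2_cycles\<close>
  disappears.\<close>

definition b :: "nat \<Rightarrow> nat \<Rightarrow> nat \<Rightarrow> int" where
  "b t i j = int (q t i j) - int (q t j i)"

text \<open>Removing 2-cycles leaves the difference of the two arrow counts unchanged. So only the
  reversal at \<open>k t\<close> and the antisymmetrised count of added paths are visible, and since
  \<open>k t\<close> has no loop, no path is added at \<open>k t\<close> itself.\<close>

lemma b_Suc:
  assumes t: "t < T" and ij: "i < n" "j < n"
  shows "b (Suc t) i j = (if i = k t \<or> j = k t then - b t i j
    else b t i j + int (q t i (k t)) * int (q t (k t) j) - int (q t j (k t)) * int (q t (k t) i))"
proof -
  have cancel: "int (x - y) - int (y - x) = int x - int y" for x y :: nat by simp
  have "q t (k t) (k t) = 0" using q_self t k_lt by simp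
  then show ?thesis
    by (auto simp: b_def mut_quiver_def cancel_2_cycles_def cancel reverse_at_def add_paths_def)
qed

section \<open>Functions constant on the classes, and their symplectic pairing\<close>

definition class_fun :: "(nat \<Rightarrow> nat \<Rightarrow> 'a) \<Rightarrow> bool" where
  "class_fun X \<longleftrightarrow> (\<forall>i t. i < n \<longrightarrow> t < T \<longrightarrow> i \<noteq> k t \<longrightarrow> X i (Suc t) = X i t) \<and>
     (\<forall>i<n. X i T = X (\<nu> i) 0)"

lemma class_fun_step: "class_fun X \<Longrightarrow> i < n \<Longrightarrow> t < T \<Longrightarrow> i \<noteq> k t \<Longrightarrow> X i (Suc t) = X i t"
  and class_fun_glue: "class_fun X \<Longrightarrow> i < n \<Longrightarrow> X i T = X (\<nu> i) 0"
  by (auto simp: class_fun_def)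

text \<open>Column \<open>t\<close> of the Neumann-Zagier matrix paired with an arbitrary node
  function \<open>X\<close>. For the indicator of a class \<open>e\<close> this is the entry
  \<open>A_plus \<gamma> e t\<close>; the general form keeps the telescoping arguments free of
  classes.\<close>

definition Ap :: "(nat \<Rightarrow> nat \<Rightarrow> int) \<Rightarrow> nat \<Rightarrow> int" where
  "Ap X t = X (k t) t + X (k t) (Suc t) - (\<Sum>i<n. int (q t (k t) i) * X i t)"

definition Am :: "(nat \<Rightarrow> nat \<Rightarrow> int) \<Rightarrow> nat \<Rightarrow> int" where
  "Am X t = X (k t) t + X (k t) (Suc t) - (\<Sum>i<n. int (q t i (k t)) * X i t)"

text \<open>A class function changes during step \<open>t\<close> only at the vertex
  \<open>k t\<close>, and the exchange matrix changes only in the row and column of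
  \<open>k t\<close> and by paths through \<open>k t\<close>. The resulting difference of the two
  bilinear forms factors through the sums over outgoing and incoming arrows at
  \<open>k t\<close>.\<close>

lemma symplectic_step:
  assumes X: "class_fun X" and Y: "class_fun Y" and t: "t < T"
  shows "(\<Sum>i<n. \<Sum>j<n. b t i j * X i t * Y j t) - (\<Sum>i<n. \<Sum>j<n. b (Suc t) i j * X i (Suc t) * Y j (Suc t))
     = Ap X t * Am Y t - Am X t * Ap Y t"
proof -
  define K where "K = k t"
  have K: "K < n" using k_lt[OF t] by (simp add: K_def)
  define I where "I = {..<n} - {K}"
  have fI: "finite I" by (simp add: I_def)
  have ins: "{..<n} = insert K I" using K by (auto simp: I_def)
  have KI: "K \<notin> I" by (simp add: I_def)
  have qKK: "q t K K = 0" using q_self t K by simp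
  have bKK: "b t' K K = 0" for t' by (simp add: b_def)
  define x where "x i = X i t" for i
  define y where "y i = Y i t" for i
  define qi where "qi i j = int (q t i j)" for i j
  have X': "X i (Suc t) = x i" "Y i (Suc t) = y i" if "i \<in> I" for i
    using class_fun_step[OF X _ t] class_fun_step[OF Y _ t] that by (auto simp: I_def x_def y_def K_def)
  define xk yk where "xk = X K (Suc t)" and "yk = Y K (Suc t)"
  define px mx py my where "px = (\<Sum>i\<in>I. qi K i * x i)" and "mx = (\<Sum>i\<in>I. qi i K * x i)"
    and "py = (\<Sum>i\<in>I. qi K i * y i)" and "my = (\<Sum>i\<in>I. qi i K * y i)"
  define S where "S = (\<Sum>i\<in>I. \<Sum>j\<in>I. (qi i j - qi j i) * x i * y j)"
  \<comment> \<open>Isolating the mutated vertex \<open>K\<close>: diagonal entry, row, column, and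
    the block away from \<open>K\<close>. In that block the mutation adds only the rank-two
    expression \<open>mx * py - px * my\<close>.\<close>
  have split: "(\<Sum>i<n. \<Sum>j<n. f i j) = f K K + (\<Sum>j\<in>I. f K j) + (\<Sum>i\<in>I. f i K) + (\<Sum>i\<in>I. \<Sum>j\<in>I. f i j)"
    for f :: "nat \<Rightarrow> nat \<Rightarrow> int"
    unfolding ins using fI KI by (simp add: sum.distrib)
  have A: "(\<Sum>i<n. \<Sum>j<n. b t i j * X i t * Y j t) = x K * (py - my) + (mx - px) * y K + S"
    unfolding split bKK
    by (simp add: b_def S_def px_def mx_def py_def my_def x_def y_def qi_def sum_subtractf sum_distrib_left
        sum_distrib_right algebra_simps)
  have B0: "b (Suc t) K j = - (qi K j - qi j K)" "b (Suc t) j K = - (qi j K - qi K j)" if "j \<in> I" for j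
    using b_Suc[OF t, of K j] b_Suc[OF t, of j K] that K by (auto simp: K_def[symmetric] I_def b_def qi_def)
  have B1: "b (Suc t) i j = qi i j - qi j i + qi i K * qi K j - qi j K * qi K i" if "i \<in> I" "j \<in> I" for i j
    using b_Suc[OF t, of i j] that K by (auto simp: K_def[symmetric] I_def b_def qi_def)
  have "(\<Sum>i<n. \<Sum>j<n. b (Suc t) i j * X i (Suc t) * Y j (Suc t)) =
      (\<Sum>j\<in>I. - (qi K j - qi j K) * xk * y j) + (\<Sum>i\<in>I. - (qi i K - qi K i) * x i * yk) +
      (\<Sum>i\<in>I. \<Sum>j\<in>I. (qi i j - qi j i + qi i K * qi K j - qi j K * qi K i) * x i * y j)"
    unfolding split bKK by (simp add: B0 B1 X' xk_def yk_def cong: sum.cong)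
  also have "(\<Sum>i\<in>I. \<Sum>j\<in>I. (qi i j - qi j i + qi i K * qi K j - qi j K * qi K i) * x i * y j) = S + mx * py - px * my"
    unfolding S_def px_def mx_def py_def my_def sum_product
    by (simp add: sum.distrib[symmetric] sum_subtractf[symmetric] algebra_simps)
  also have "(\<Sum>j\<in>I. - (qi K j - qi j K) * xk * y j) = - xk * (py - my)"
    by (simp add: py_def my_def sum_subtractf[symmetric] sum_distrib_left sum_negf[symmetric] algebra_simps)
  also have "(\<Sum>i\<in>I. - (qi i K - qi K i) * x i * yk) = - yk * (mx - px)"
    by (simp add: px_def mx_def sum_subtractf[symmetric] sum_distrib_left sum_negf[symmetric] algebra_simps)
  finally have B: "(\<Sum>i<n. \<Sum>j<n. b (Suc t) i j * X i (Suc t) * Y j (Suc t)) =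
      - xk * (py - my) - yk * (mx - px) + S + mx * py - px * my" by simp
  have C: "Ap X t = x K + xk - px" "Am X t = x K + xk - mx" "Ap Y t = y K + yk - py" "Am Y t = y K + yk - my"
    unfolding Ap_def Am_def K_def[symmetric] ins using fI KI
    by (simp_all add: qKK px_def mx_def py_def my_def x_def y_def xk_def yk_def qi_def)
  show ?thesis unfolding A B C by (simp add: algebra_simps)
qed

text \<open>The differences in \<open>symplectic_step\<close> telescope over one period, and the
  bilinear form at time \<open>T\<close> agrees with that at time 0 because quiver and class
  functions are glued by the same permutation.\<close>

lemma symplectic:
  assumes X: "class_fun X" and Y: "class_fun Y"
  shows "(\<Sum>t<T. Ap X t * Am Y t) = (\<Sum>t<T. Am X t * Ap Y t)"
proof -
  define B where "B t = (\<Sum>i<n. \<Sum>j<n. b t i j * X i t * Y j t)" for t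
  have "(\<Sum>t<T. Ap X t * Am Y t - Am X t * Ap Y t) = (\<Sum>t<T. B t - B (Suc t))"
    using symplectic_step[OF X Y] by (intro sum.cong refl) (simp add: B_def)
  also have "\<dots> = B 0 - B T" by (rule sum_lessThan_telescope')
  \<comment> \<open>Gluing expresses everything at time \<open>T\<close> by initial data at
    \<open>\<nu> i\<close> and \<open>\<nu> j\<close>; two reindexings along \<open>\<nu>\<close>,
    one per summation variable, then give \<open>B 0\<close>.\<close>
  also have "B T = (\<Sum>i<n. \<Sum>j<n. b 0 (\<nu> i) (\<nu> j) * X (\<nu> i) 0 * Y (\<nu> j) 0)"
    unfolding B_def by (intro sum.cong refl) (auto simp: b_def q_final class_fun_glue[OF X] class_fun_glue[OF Y])
  also have "\<dots> = (\<Sum>i<n. \<Sum>j<n. b 0 (\<nu> i) j * X (\<nu> i) 0 * Y j 0)"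
    by (intro sum.cong refl sum.reindex_bij_betw[OF permutes_imp_bij[OF perm]])
  also have "\<dots> = B 0"
    unfolding B_def
    using sum.reindex_bij_betw[OF permutes_imp_bij[OF perm], of "\<lambda>i. \<Sum>j<n. b 0 i j * X i 0 * Y j 0"] by simp
  finally show ?thesis by (simp add: sum_subtractf)
qed

section \<open>The classes of nodes and the entries of the Neumann-Zagier matrices\<close>

lemma equiv_class_rel: "equiv (nodes \<gamma>) (class_rel \<gamma>)"
  unfolding class_rel_def
  by (intro equivI refl_onI symI transI)
     (auto intro: equivclp_sym equivclp_trans simp: equivclp_refl)

lemma finite_nodes: "finite (nodes \<gamma>)"
proof -
  have "nodes \<gamma> \<subseteq> {..<n} \<times> {..T}" by (auto simp: nodes_def)
  then show ?thesis by (rule finite_subset) auto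
qed

lemma finite_E: "finite (E_classes \<gamma>)"
  unfolding E_classes_def using finite_nodes finite_quotient[of "nodes \<gamma>"] equiv_class_rel equiv_type by blast

lemma adj_class_rel: "adj \<gamma> p p' \<Longrightarrow> (p, p') \<in> class_rel \<gamma>"
proof -
  assume a: "adj \<gamma> p p'"
  then have "p \<in> nodes \<gamma>" "p' \<in> nodes \<gamma>" by (auto elim!: adj.cases simp: nodes_def)
  with a show ?thesis by (auto simp: class_rel_def)
qed

lemma class_mem_iff:
  "e \<in> E_classes \<gamma> \<Longrightarrow> (p, p') \<in> class_rel \<gamma> \<Longrightarrow> p \<in> e \<longleftrightarrow> p' \<in> e"
  unfolding E_classes_def using in_quotient_imp_closed[OF equiv_class_rel] equiv_class_rel
  by (metis equivE symD)

text \<open>The two clauses of \<open>class_fun\<close> mirror the two generators of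
  \<open>adj\<close>. This makes the telescoping identities applicable to the rows of the
  Neumann-Zagier matrices.\<close>

lemma class_fun_class: "e \<in> E_classes \<gamma> \<Longrightarrow> class_fun (\<lambda>i t. of_bool ((i, t) \<in> e))"
  unfolding class_fun_def
  using class_mem_iff[OF _ adj_class_rel[OF adj.step]] class_mem_iff[OF _ adj_class_rel[OF adj.glue]]
  by simp

lemma card_pair_inter: "a \<noteq> c \<Longrightarrow> card ({a, c} \<inter> e) = of_bool (a \<in> e) + of_bool (c \<in> e)"
  by (cases "a \<in> e"; cases "c \<in> e") (auto simp: Int_insert_left)

text \<open>The two nodes counted by \<open>N_zero\<close> differ in their time, so the cardinality
  is a sum of two indicators; the filtered sum in \<open>N_plus\<close> becomes a sum weighted by
  the indicator.\<close>

lemma A_plus_eq: "A_plus \<gamma> e t = Ap (\<lambda>i t. of_bool ((i, t) \<in> e)) t"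
  unfolding A_plus_def Ap_def N_zero_def N_plus_def
  by (simp add: card_pair_inter sum.If_cases of_bool_def lessThan_def Collect_conj_eq
      flip: sum.inter_filter) (simp add: sum.inter_filter[symmetric] Int_def if_distrib cong: if_cong)

lemma A_minus_eq: "A_minus \<gamma> e t = Am (\<lambda>i t. of_bool ((i, t) \<in> e)) t"
  unfolding A_minus_def Am_def N_zero_def N_minus_def
  by (simp add: card_pair_inter sum.If_cases of_bool_def lessThan_def Collect_conj_eq
      flip: sum.inter_filter) (simp add: sum.inter_filter[symmetric] Int_def if_distrib cong: if_cong)

lemma A_symplectic:
  assumes "e \<in> E_classes \<gamma>" "e' \<in> E_classes \<gamma>"
  shows "(\<Sum>t<T. A_plus \<gamma> e t * A_minus \<gamma> e' t) = (\<Sum>t<T. A_minus \<gamma> e t * A_plus \<gamma> e' t)"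
  unfolding A_plus_eq A_minus_eq by (intro symplectic class_fun_class assms)

text \<open>\<open>adj\<close> is the graph of a partial function, so two nodes in the same class have a common
  successor; the nodes \<open>(k t, t)\<close> have no successor.\<close>

lemma adj_fun: "adj \<gamma> p p' \<Longrightarrow> adj \<gamma> p p'' \<Longrightarrow> p' = p''"
  by (auto elim!: adj.cases)

lemma adj_join:
  assumes "equivclp (adj \<gamma>) p p'"
  shows "\<exists>r. (adj \<gamma>)\<^sup>*\<^sup>* p r \<and> (adj \<gamma>)\<^sup>*\<^sup>* p' r"
  using assms
proof (induction rule: equivclp_induct)
  case base
  then show ?case by blast
next
  case (step y z)
  then obtain r where r: "(adj \<gamma>)\<^sup>*\<^sup>* p r" "(adj \<gamma>)\<^sup>*\<^sup>* y r" by blast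
  show ?case
  proof (cases "adj \<gamma> z y")
    case True
    then show ?thesis using r by (meson converse_rtranclp_into_rtranclp)
  next
    case False
    then have yz: "adj \<gamma> y z" using step by blast
    \<comment> \<open>If \<open>y\<close> is already the meeting point, then \<open>z\<close> is a
      later one. Otherwise the path from \<open>y\<close> must begin with the unique successor
      \<open>z\<close>, so the old meeting point still works.\<close>
    from r(2) show ?thesis
    proof (cases rule: converse_rtranclpE)
      case base
      then show ?thesis using r yz by (meson rtranclp.rtrancl_into_rtrancl rtranclp.rtrancl_refl)
    next
      case (step y')
      then show ?thesis using adj_fun[OF yz] r by blast
    qed
  qed
qed

lemma adj_end: "t < T \<Longrightarrow> \<not> adj \<gamma> (k t, t) p"
  by (auto elim!: adj.cases)

lemma end_node: "t < T \<Longrightarrow> (k t, t) \<in> nodes \<gamma>"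
  using k_lt by (auto simp: nodes_def)

lemma end_class_in: "t < T \<Longrightarrow> end_class \<gamma> t \<in> E_classes \<gamma>"
  unfolding end_class_def E_classes_def using end_node by (auto intro: quotientI)

text \<open>A common successor of two nodes without successors has to equal both of them. Hence
  \<open>end_class\<close> is injective, and it enumerates all classes as soon as the cardinalities
  agree.\<close>

lemma end_in_end_class: "s < T \<Longrightarrow> t < T \<Longrightarrow> (k t, t) \<in> end_class \<gamma> s \<longleftrightarrow> s = t"
proof
  assume *: "s < T" "t < T" "(k t, t) \<in> end_class \<gamma> s"
  then have "equivclp (adj \<gamma>) (k s, s) (k t, t)" by (auto simp: end_class_def class_rel_def)
  then obtain r where r: "(adj \<gamma>)\<^sup>*\<^sup>* (k s, s) r" "(adj \<gamma>)\<^sup>*\<^sup>* (k t, t) r" using adj_join by blast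
  have "r = (k s, s)" "r = (k t, t)" using r * adj_end by (metis converse_rtranclpE)+
  then show "s = t" by simp
next
  assume "s < T" "t < T" "s = t"
  then show "(k t, t) \<in> end_class \<gamma> s"
    unfolding end_class_def using equiv_class_rel end_node by (auto dest: equiv_class_self)
qed

lemma inj_end_class: "inj_on (end_class \<gamma>) {..<T}"
  by (intro inj_onI) (metis end_in_end_class lessThan_iff)

lemma end_class_image:
  assumes "card (E_classes \<gamma>) = T"
  shows "end_class \<gamma> ` {..<T} = E_classes \<gamma>"
  by (intro card_subset_eq finite_E) (use end_class_in assms in \<open>auto simp: card_image[OF inj_end_class]\<close>)

end

section \<open>The Jacobian at the fixed point\<close>

text \<open>In each Leibniz product the factors \<open>d i\<close> and \<open>d (p i)\<close> run
  over the same values and cancel. This permits passing from ordinary to logarithmic derivatives in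
  the Jacobian.\<close>

lemma det_conj_diag:
  fixes d :: "nat \<Rightarrow> 'a :: field"
  assumes M: "M \<in> carrier_mat n n" and d: "\<And>i. i < n \<Longrightarrow> d i \<noteq> 0"
  shows "Determinant.det (Matrix.mat n n (\<lambda>(i, j). d i * M $$ (i, j) / d j)) = Determinant.det M"
proof -
  have "(\<Prod>i = 0..<n. d i * M $$ (i, p i) / d (p i)) = (\<Prod>i = 0..<n. M $$ (i, p i))"
    if "p permutes {0..<n}" for p
  proof -
    have "(\<Prod>i = 0..<n. d (p i)) = (\<Prod>i = 0..<n. d i)"
      using prod.reindex_bij_betw[OF permutes_imp_bij[OF that], of d] .
    moreover have "(\<Prod>i = 0..<n. d i) \<noteq> 0" using d by simp
    ultimately show ?thesis by (simp add: prod.distrib prod_dividef)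
  qed
  moreover have "p i < n" if "p permutes {0..<n}" "i < n" for p i
    using permutes_in_image[OF that(1), of i] that(2) by simp
  ultimately show ?thesis
    using M by (subst (1 2) det_def') (auto intro!: sum.cong)
qed

text \<open>The power rule in terms of the logarithmic derivative \<open>D\<close>; in this form the
  exponent 0 fits without a shifted exponent.\<close>

lemma DERIV_power_log:
  fixes h :: "real \<Rightarrow> real"
  assumes "(h has_real_derivative h x * D) (at x)"
  shows "((\<lambda>x. h x ^ m) has_real_derivative h x ^ m * (real m * D)) (at x)"
  using DERIV_power[OF assms, of m] by (cases m) (auto simp: algebra_simps)

text \<open>Both sides are the determinant of the block matrix with rows \<open>1 - N, - R\<close> and \<open>- K, 1 - L\<close>.\<close>

lemma det_feedback:
  fixes N R K L X C :: "'a :: idom mat"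
  assumes N: "N \<in> carrier_mat n n" and R: "R \<in> carrier_mat n m" and K: "K \<in> carrier_mat m n"
    and L: "L \<in> carrier_mat m m" and X: "X \<in> carrier_mat m n" and C: "C \<in> carrier_mat m n"
    and XK: "X = K + L * X" and CK: "C = K + C * N"
  shows "Determinant.det (1\<^sub>m n - (N + R * X)) * Determinant.det (1\<^sub>m m - L) =
    Determinant.det (1\<^sub>m n - N) * Determinant.det (1\<^sub>m m - (L + C * R))"
proof -
  let ?M = "four_block_mat (1\<^sub>m n - N) (- R) (- K) (1\<^sub>m m - L)"
  \<comment> \<open>Both multipliers are unipotent. On the right, \<open>?P\<close> clears the lower
    left block of \<open>?M\<close> because \<open>X = K + L * X\<close>; on the left,
    \<open>?S\<close> clears it because \<open>C = K + C * N\<close>.\<close>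
  let ?P = "four_block_mat (1\<^sub>m n) (0\<^sub>m n m) X (1\<^sub>m m)"
  let ?S = "four_block_mat (1\<^sub>m n) (0\<^sub>m n m) C (1\<^sub>m m)"
  have cM: "?M \<in> carrier_mat (n + m) (n + m)" and cP: "?P \<in> carrier_mat (n + m) (n + m)"
    and cS: "?S \<in> carrier_mat (n + m) (n + m)"
    using N R K L X C by auto
  have dP: "Determinant.det ?P = 1" and dS: "Determinant.det ?S = 1"
    using det_four_block_mat_upper_right_zero[of "1\<^sub>m n" n "0\<^sub>m n m" m _ "1\<^sub>m m"] X C by simp_all
  have "(K + L * X) - K = L * X" "(K + C * N) - K = C * N"
    using K L X C N by (auto intro!: eq_matI)
  then have LX: "L * X = X - K" and CN: "C * N = C - K"
    using XK CK by simp_all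
  have "?M * ?P = four_block_mat (1\<^sub>m n - (N + R * X)) (- R) (0\<^sub>m m n) (1\<^sub>m m - L)"
  proof -
    have a: "(1\<^sub>m n - N) * 1\<^sub>m n + - R * X = 1\<^sub>m n - (N + R * X)"
      using N R X by (intro eq_matI) auto
    have b: "(1\<^sub>m n - N) * 0\<^sub>m n m + - R * 1\<^sub>m m = - R" using N R by auto
    have c: "- K * 1\<^sub>m n + (1\<^sub>m m - L) * X = 0\<^sub>m m n"
      using K L X by (subst minus_mult_distrib_mat[of _ m m]) (auto simp: LX)
    have d: "- K * 0\<^sub>m n m + (1\<^sub>m m - L) * 1\<^sub>m m = 1\<^sub>m m - L" using K L by auto
    have "?M * ?P = four_block_mat ((1\<^sub>m n - N) * 1\<^sub>m n + - R * X) ((1\<^sub>m n - N) * 0\<^sub>m n m + - R * 1\<^sub>m m)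
        (- K * 1\<^sub>m n + (1\<^sub>m m - L) * X) (- K * 0\<^sub>m n m + (1\<^sub>m m - L) * 1\<^sub>m m)"
      by (rule mult_four_block_mat) (use N R K L X in auto)
    then show ?thesis unfolding a b c d .
  qed
  moreover have "?S * ?M = four_block_mat (1\<^sub>m n - N) (- R) (0\<^sub>m m n) (1\<^sub>m m - (L + C * R))"
  proof -
    have a: "1\<^sub>m n * (1\<^sub>m n - N) + 0\<^sub>m n m * - K = 1\<^sub>m n - N" using N K by auto
    have b: "1\<^sub>m n * - R + 0\<^sub>m n m * (1\<^sub>m m - L) = - R" using L R by auto
    have c: "C * (1\<^sub>m n - N) + 1\<^sub>m m * - K = 0\<^sub>m m n"
      using K C N by (subst mult_minus_distrib_mat[of _ m n]) (auto simp: CN)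
    have d: "C * - R + 1\<^sub>m m * (1\<^sub>m m - L) = 1\<^sub>m m - (L + C * R)"
      using C R L by (intro eq_matI) auto
    have "?S * ?M = four_block_mat (1\<^sub>m n * (1\<^sub>m n - N) + 0\<^sub>m n m * - K) (1\<^sub>m n * - R + 0\<^sub>m n m * (1\<^sub>m m - L))
        (C * (1\<^sub>m n - N) + 1\<^sub>m m * - K) (C * - R + 1\<^sub>m m * (1\<^sub>m m - L))"
      by (rule mult_four_block_mat) (use N R K L C in auto)
    then show ?thesis unfolding a b c d .
  qed
  ultimately have "Determinant.det (four_block_mat (1\<^sub>m n - (N + R * X)) (- R) (0\<^sub>m m n) (1\<^sub>m m - L)) =
      Determinant.det (four_block_mat (1\<^sub>m n - N) (- R) (0\<^sub>m m n) (1\<^sub>m m - (L + C * R)))"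
    using det_mult[OF cM cP] det_mult[OF cS cM] dP dS by simp
  moreover have "Determinant.det (four_block_mat (1\<^sub>m n - (N + R * X)) (- R) (0\<^sub>m m n) (1\<^sub>m m - L)) =
      Determinant.det (1\<^sub>m n - (N + R * X)) * Determinant.det (1\<^sub>m m - L)"
    by (rule det_four_block_mat_lower_left_zero) (use N R X L in auto)
  moreover have "Determinant.det (four_block_mat (1\<^sub>m n - N) (- R) (0\<^sub>m m n) (1\<^sub>m m - (L + C * R))) =
      Determinant.det (1\<^sub>m n - N) * Determinant.det (1\<^sub>m m - (L + C * R))"
    by (rule det_four_block_mat_lower_left_zero) (use N R C L in auto)
  ultimately show ?thesis by simp
qed

locale fixed_mloop = mloop +
  fixes \<eta> :: "nat \<Rightarrow> real"
  assumes fixed: "positive_fixed_point \<gamma> \<eta>"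
begin

section \<open>Nahm's equations from the logarithms of the cluster variables\<close>

abbreviation "Y t i \<equiv> Y_at \<gamma> \<eta> t i"
abbreviation "zp t \<equiv> z_plus \<gamma> \<eta> t"
abbreviation "zm t \<equiv> 1 - z_plus \<gamma> \<eta> t"

lemma Y_pos: "t \<le> T \<Longrightarrow> i < n \<Longrightarrow> Y t i > 0"
proof (induction t arbitrary: i)
  case 0
  then show ?case using fixed by (simp add: positive_fixed_point_def)
next
  case (Suc t)
  have "Y t (k t) > 0" using Suc k_lt by simp
  then show ?case using Suc by (simp add: mut_Y_def add_pos_pos)
qed

lemma Y_k_pos: "t < T \<Longrightarrow> Y t (k t) > 0"
  using Y_pos k_lt by simp

lemma Y_final: "i < n \<Longrightarrow> Y T i = \<eta> (\<nu> i)"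
proof -
  assume "i < n"
  then have "cluster_trans \<gamma> \<eta> (\<nu> i) = \<eta> (\<nu> i)" using fixed by (simp add: positive_fixed_point_def)
  then show ?thesis by (simp add: cluster_trans_def)
qed

lemma zp_pos: "t < T \<Longrightarrow> zp t > 0" and zp_less_1: "t < T \<Longrightarrow> zp t < 1"
  using Y_k_pos[of t] by (simp_all add: z_plus_def)

lemma zm_eq: "t < T \<Longrightarrow> zm t = 1 / (1 + Y t (k t))"
  using Y_k_pos[of t] by (simp add: z_plus_def field_simps)

text \<open>The two factors of the mutation rule are powers of \<open>zp\<close> and
  \<open>zm\<close>: the inverse of \<open>1 / Y + 1\<close> is \<open>zp\<close>, and
  \<open>Y + 1\<close> is the inverse of \<open>zm\<close>, where \<open>Y\<close> is the variable
  at \<open>k t\<close>.\<close>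

lemma mut_factor:
  assumes t: "t < T" and i: "i < n" "i \<noteq> k t"
  shows "Y (Suc t) i = (if q t i (k t) = 0 then Y t i * zp t ^ q t (k t) i else Y t i / zm t ^ q t i (k t))"
proof -
  have "Y t (k t) > 0" using Y_k_pos t .
  moreover from this have "inverse (Y t (k t)) + 1 = inverse (zp t)"
    by (simp add: z_plus_def field_simps)
  ultimately show ?thesis using i
    by (simp add: mut_Y_def zm_eq[OF t] power_int_minus power_inverse power_one_over field_simps)
qed

text \<open>At most one of the two arrow numbers is nonzero, so a single formula covers both
  branches of the mutation rule.\<close>

lemma ln_Y_Suc:
  assumes t: "t < T" and i: "i < n" "i \<noteq> k t"
  shows "ln (Y (Suc t) i) = ln (Y t i) + real (q t (k t) i) * ln (zp t) - real (q t i (k t)) * ln (zm t)"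
proof -
  have "Y t i > 0" "zp t > 0" "zm t > 0" using Y_pos[of t i] zp_pos[OF t] zp_less_1[OF t] t i by auto
  moreover have "q t i (k t) = 0 \<or> q t (k t) i = 0"
    using q_no_2_cycle[of t i "k t"] t i k_lt by simp
  ultimately show ?thesis
    by (auto simp: mut_factor[OF assms] ln_mult ln_div ln_realpow simp del: Y_at.simps)
qed

text \<open>The logarithmic analogue of \<open>symplectic_step\<close>. Away from \<open>k t\<close>
  the change is read off from \<open>ln_Y_Suc\<close>; at \<open>k t\<close> the logarithm
  \<open>ln (zp t) - ln (zm t)\<close> changes its sign, which produces the term counted by
  \<open>N_zero\<close>.\<close>

lemma nahm_step:
  assumes X: "class_fun X" and t: "t < T"
  shows "(\<Sum>i<n. of_int (X i (Suc t)) * ln (Y (Suc t) i)) - (\<Sum>i<n. of_int (X i t) * ln (Y t i))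
    = of_int (Am X t) * ln (zm t) - of_int (Ap X t) * ln (zp t)"
proof -
  define K where "K = k t"
  have K: "K < n" using k_lt[OF t] by (simp add: K_def)
  define I where "I = {..<n} - {K}"
  have fI: "finite I" by (simp add: I_def)
  have ins: "{..<n} = insert K I" using K by (auto simp: I_def)
  have KI: "K \<notin> I" by (simp add: I_def)
  have qKK: "q t K K = 0" using q_self t K by simp
  have lnY: "ln (Y t K) = ln (zp t) - ln (zm t)"
    using Y_k_pos[OF t] zm_eq[OF t] by (simp add: K_def z_plus_def ln_div)
  have lnYS: "ln (Y (Suc t) K) = - ln (Y t K)"
    using Y_k_pos[OF t] by (simp add: K_def mut_Y_def ln_inverse)
  have "(\<Sum>i\<in>I. of_int (X i (Suc t)) * ln (Y (Suc t) i)) = (\<Sum>i\<in>I. of_int (X i t) * ln (Y t i)) +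
      (\<Sum>i\<in>I. real (q t K i) * of_int (X i t)) * ln (zp t) - (\<Sum>i\<in>I. real (q t i K) * of_int (X i t)) * ln (zm t)"
    unfolding sum_distrib_right sum.distrib[symmetric] sum_subtractf[symmetric]
  proof (intro sum.cong refl)
    fix i assume "i \<in> I"
    then have i: "i < n" "i \<noteq> k t" by (auto simp: I_def K_def)
    then show "of_int (X i (Suc t)) * ln (Y (Suc t) i) = of_int (X i t) * ln (Y t i) +
        real (q t K i) * of_int (X i t) * ln (zp t) - real (q t i K) * of_int (X i t) * ln (zm t)"
      unfolding ln_Y_Suc[OF t i] class_fun_step[OF X i(1) t i(2)] K_def by (simp add: algebra_simps)
  qed
  then show ?thesis
    unfolding Ap_def Am_def K_def[symmetric] ins
    using fI KI by (simp add: qKK lnY lnYS algebra_simps del: Y_at.simps)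
qed

text \<open>Telescoping over one period; the boundary terms agree because \<open>\<eta>\<close> is
  fixed by the cluster transformation. Applied to indicators of classes this gives Nahm's
  equations.\<close>

lemma nahm:
  assumes X: "class_fun X"
  shows "(\<Sum>t<T. of_int (Ap X t) * ln (zp t)) = (\<Sum>t<T. of_int (Am X t) * ln (zm t))"
proof -
  define S where "S t = (\<Sum>i<n. of_int (X i t) * ln (Y t i))" for t
  have "(\<Sum>t<T. of_int (Am X t) * ln (zm t) - of_int (Ap X t) * ln (zp t)) = (\<Sum>t<T. S (Suc t) - S t)"
    using nahm_step[OF X] by (intro sum.cong refl) (simp add: S_def del: Y_at.simps)
  also have "\<dots> = S T - S 0" by (rule sum_lessThan_telescope)
  also have "S T = (\<Sum>i<n. of_int (X (\<nu> i) 0) * ln (\<eta> (\<nu> i)))"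
    unfolding S_def by (intro sum.cong refl) (simp add: Y_final class_fun_glue[OF X])
  also have "\<dots> = S 0"
    unfolding S_def using sum.reindex_bij_betw[OF permutes_imp_bij[OF perm], of "\<lambda>i. of_int (X i 0) * ln (\<eta> i)"] by simp
  finally show ?thesis by (simp add: sum_subtractf)
qed

text \<open>The logarithmic derivative of \<open>Y (Suc t) i\<close> with respect to
  \<open>Y t (k t)\<close> for \<open>i \<noteq> k t\<close>: with respect to \<open>ln Y\<close>,
  \<open>ln zp\<close> has derivative \<open>zm\<close> and \<open>- ln zm\<close> has derivative
  \<open>zp\<close>.\<close>

definition c :: "nat \<Rightarrow> nat \<Rightarrow> real" where
  "c t i = real (q t (k t) i) * zm t + real (q t i (k t)) * zp t"

text \<open>\<open>U t i j\<close> is the logarithmic derivative of \<open>Y\<^sub>i(t)\<close> with respect to \<open>log y\<^sub>j\<close> at \<open>\<eta>\<close>.\<close>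

primrec U :: "nat \<Rightarrow> nat \<Rightarrow> nat \<Rightarrow> real" where
  "U 0 i j = of_bool (i = j)"
| "U (Suc t) i j = (if i = k t then - U t i j else U t i j + c t i * U t (k t) j)"

lemma Y_deriv:
  assumes j: "j < n"
  shows "t \<le> T \<Longrightarrow> i < n \<Longrightarrow>
    ((\<lambda>x. Y_at \<gamma> (\<eta>(j := x)) t i) has_real_derivative Y t i * U t i j / \<eta> j) (at (\<eta> j))"
proof (induction t arbitrary: i)
  case 0
  have "\<eta> j > 0" using Y_pos[of 0 j] j by simp
  then show ?case by (cases "i = j") (auto intro!: derivative_eq_intros)
next
  case (Suc t)
  have t: "t < T" using Suc by simp
  define K where "K = k t"
  have K: "K < n" using k_lt[OF t] by (simp add: K_def)
  define f where "f x = Y_at \<gamma> (\<eta>(j := x)) t K" for x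
  define g where "g x = Y_at \<gamma> (\<eta>(j := x)) t i" for x
  have fe: "f (\<eta> j) = Y t K" and ge: "g (\<eta> j) = Y t i" by (simp_all add: f_def g_def)
  have fpos: "Y t K > 0" and gpos: "Y t i > 0" using Y_pos t K Suc by auto
  have df: "(f has_real_derivative Y t K * U t K j / \<eta> j) (at (\<eta> j))"
    unfolding f_def[abs_def] by (rule Suc.IH) (use t K in auto)
  have dg: "(g has_real_derivative Y t i * U t i j / \<eta> j) (at (\<eta> j))"
    unfolding g_def[abs_def] by (rule Suc.IH) (use t Suc.prems in auto)
  have eq: "Y_at \<gamma> (\<eta>(j := x)) (Suc t) i =
     (if i = K then inverse (f x) else if q t i K = 0 then g x * inverse ((inverse (f x) + 1) ^ q t K i)
      else g x * (f x + 1) ^ q t i K)" for x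
    by (simp add: mut_Y_def f_def g_def K_def power_int_minus)
  have YS: "Y (Suc t) i = (if i = K then inverse (Y t K) else
      if q t i K = 0 then Y t i * inverse ((inverse (Y t K) + 1) ^ q t K i)
      else Y t i * (Y t K + 1) ^ q t i K)"
    using eq[of "\<eta> j"] by (simp add: fe ge)
  have zK: "zm t = 1 / (1 + Y t K)" "zp t = Y t K / (1 + Y t K)"
    using zm_eq[OF t] by (simp_all add: K_def z_plus_def)
  \<comment> \<open>There are no 2-cycles, so whenever \<open>q t i K\<close> is nonzero the second
    summand of \<open>c t i\<close>, which carries \<open>zp t\<close>, is the only one
    left.\<close>
  consider "i = K" | "i \<noteq> K" "q t i K = 0" | "i \<noteq> K" "q t i K \<noteq> 0" "q t K i = 0"
    using q_no_2_cycle[of t i K] t K Suc by auto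
  then show ?case
  proof cases
    case 1
    then show ?thesis unfolding eq YS using fpos
      by (auto intro!: derivative_eq_intros df simp: fe K_def[symmetric] power2_eq_square)
  next
    case 2
    have *: "Y t K + 1 \<noteq> 0" "1 + Y t K \<noteq> 0" "inverse (Y t K) + 1 \<noteq> 0" using fpos by (simp_all add: add_pos_pos pos_add_strict less_imp_neq[symmetric])
    define a where "a = inverse (Y t K) + 1"
    have a0: "a \<noteq> 0" using * by (simp add: a_def)
    have za: "zm t = inverse (Y t K) / a" using fpos by (simp add: zK a_def field_simps)
    \<comment> \<open>This function is \<open>f / (1 + f)\<close>, whose logarithmic derivative is
      \<open>1 / (1 + f)\<close> times that of \<open>f\<close>; at the base point
      \<open>1 / (1 + f)\<close> is \<open>zm t\<close>.\<close>
    have "((\<lambda>x. inverse (inverse (f x) + 1)) has_real_derivative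
        inverse (inverse (f (\<eta> j)) + 1) * (zm t * (U t K j / \<eta> j))) (at (\<eta> j))"
      using fpos a0
      by (auto intro!: derivative_eq_intros df simp: fe a_def[symmetric] za power2_eq_square) (simp add: field_simps)
    from DERIV_power_log[OF this] have dp: "((\<lambda>x. inverse ((inverse (f x) + 1) ^ m)) has_real_derivative
        inverse (a ^ m) * (real m * (zm t * (U t K j / \<eta> j)))) (at (\<eta> j))" for m
      by (simp add: fe a_def power_inverse)
    show ?thesis unfolding eq YS using 2 DERIV_mult[OF dg dp[of "q t K i"]]
      by (simp add: fe ge a_def c_def K_def[symmetric] algebra_simps add_divide_distrib diff_divide_distrib)
  next
    case 3
    define a where "a = Y t K + 1"
    have a0: "a \<noteq> 0" using fpos by (simp add: a_def)
    have za: "zp t = Y t K / a" using fpos by (simp add: zK a_def field_simps)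
    have "((\<lambda>x. f x + 1) has_real_derivative (f (\<eta> j) + 1) * (zp t * (U t K j / \<eta> j))) (at (\<eta> j))"
      using a0 by (auto intro!: derivative_eq_intros df simp: fe a_def[symmetric] za)
    from DERIV_power_log[OF this] have dp: "((\<lambda>x. (f x + 1) ^ m) has_real_derivative
        a ^ m * (real m * (zp t * (U t K j / \<eta> j)))) (at (\<eta> j))" for m
      by (simp add: fe a_def)
    show ?thesis unfolding eq YS using 3 DERIV_mult[OF dg dp[of "q t i K"]]
      by (simp add: fe ge a_def c_def K_def[symmetric] algebra_simps add_divide_distrib diff_divide_distrib)
  qed
qed

text \<open>At a fixed point the value of component \<open>i\<close> is \<open>\<eta> i\<close>
  itself, so the Jacobian is a diagonal conjugate of the matrix of logarithmic derivatives.\<close>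

lemma jacobian_entry:
  assumes "i < n" "j < n"
  shows "jacobian \<gamma> \<eta> $$ (i, j) = \<eta> i * U T (inv_into UNIV \<nu> i) j / \<eta> j"
  using DERIV_imp_deriv[OF Y_deriv[of j T "inv_into UNIV \<nu> i"]] assms Y_final[of "inv_into UNIV \<nu> i"]
  by (simp add: Defs.jacobian_def cluster_trans_def)

section \<open>Unrolling the logarithmic derivatives along strands\<close>

definition idle :: "nat \<Rightarrow> nat \<Rightarrow> nat \<Rightarrow> bool" where
  "idle i s t \<longleftrightarrow> (\<forall>s'. s \<le> s' \<longrightarrow> s' < t \<longrightarrow> k s' \<noteq> i)"

lemma idle_refl [simp]: "idle i t t" by (simp add: idle_def)

lemma idle_Suc: "s \<le> t \<Longrightarrow> idle i s (Suc t) \<longleftrightarrow> idle i s t \<and> k t \<noteq> i"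
  by (auto simp: idle_def less_Suc_eq)

text \<open>The weight with which step \<open>t\<close> passes the derivative of the mutated
  variable on to vertex \<open>i\<close>. A mutation of \<open>i\<close> itself counts as discarding
  the old value and injecting its negative.\<close>

definition r :: "nat \<Rightarrow> nat \<Rightarrow> real" where
  "r t i = (if i = k t then - 1 else c t i)"

text \<open>Since a mutation of \<open>i\<close> resets its value, a contribution injected at step
  \<open>s\<close> survives up to time \<open>t\<close> exactly if \<open>i\<close> is idle after
  \<open>s\<close>. The initial value survives only if \<open>i\<close> has been idle
  throughout.\<close>

lemma U_expand:
  "U t i j = of_bool (i = j \<and> idle i 0 t) + (\<Sum>s<t. of_bool (idle i (Suc s) t) * r s i * U s (k s) j)"
proof (induction t)
  case (Suc t)
  have "(\<Sum>s<t. of_bool (idle i (Suc s) (Suc t)) * r s i * U s (k s) j) =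
      of_bool (k t \<noteq> i) * (\<Sum>s<t. of_bool (idle i (Suc s) t) * r s i * U s (k s) j)"
    unfolding sum_distrib_left by (intro sum.cong refl) (auto simp: idle_Suc)
  then show ?case using Suc by (auto simp: idle_Suc r_def)
qed simp

lemma class_fun_idle:
  "class_fun X \<Longrightarrow> i < n \<Longrightarrow> s \<le> t \<Longrightarrow> t \<le> T \<Longrightarrow> idle i s t \<Longrightarrow> X i t = X i s"
proof (induction t)
  case (Suc t)
  show ?case
  proof (cases "s = Suc t")
    case False
    then show ?thesis using Suc class_fun_step[OF Suc(2,3), of t] by (auto simp: idle_Suc)
  qed simp
qed simp

lemma not_idle_first:
  assumes "\<not> idle i s t"
  obtains u where "s \<le> u" "u < t" "k u = i" "idle i s u"
proof -
  from assms obtain u0 where u0: "s \<le> u0" "u0 < t" "k u0 = i" by (auto simp: idle_def)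
  define u where "u = (LEAST u. s \<le> u \<and> k u = i)"
  have "s \<le> u \<and> k u = i" unfolding u_def by (rule LeastI[of _ u0]) (use u0 in auto)
  moreover have "u \<le> u0" unfolding u_def by (rule Least_le) (use u0 in auto)
  moreover have "idle i s u" unfolding idle_def u_def using not_less_Least by blast
  ultimately show ?thesis using u0 that by auto
qed

text \<open>A strand is a class seen as a path of nodes that moves forward in time.\<close>

lemma strand_indicator:
  assumes X: "class_fun X" and X1: "\<And>t. t < T \<Longrightarrow> X (k t) t = (of_bool (t = e) :: real)"
    and i: "i < n" and s: "s \<le> T" and e: "e < T"
  shows "X i s = of_bool (i = k e \<and> s \<le> e \<and> idle i s e) + of_bool (idle i s T) * X (\<nu> i) 0"
proof (cases "idle i s T")
  case True
  then have "\<not> (i = k e \<and> s \<le> e \<and> idle i s e)" using e by (auto simp: idle_def)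
  with True show ?thesis using class_fun_idle[OF X i s _ True] class_fun_glue[OF X i] by simp
next
  case False
  \<comment> \<open>The strand through \<open>(i, s)\<close> stops at the first later mutation
    \<open>u\<close> of \<open>i\<close>, so it belongs to the class in question iff
    \<open>u = e\<close>.\<close>
  then obtain u where u: "s \<le> u" "u < T" "k u = i" "idle i s u" by (rule not_idle_first)
  have "X i s = X i u" using class_fun_idle[OF X i u(1) _ u(4)] u by simp
  also have "\<dots> = of_bool (u = e)" using X1 u by auto
  also have "u = e \<longleftrightarrow> i = k e \<and> s \<le> e \<and> idle i s e"
    using u unfolding idle_def by (metis linorder_neqE_nat)
  finally show ?thesis using False by simp
qed


text \<open>The linearised loop as a feedback system whose states are initial vertices and mutation
  steps. \<open>NN\<close> carries initial vertices to initial vertices of the next period,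
  \<open>KK\<close> initial vertices to steps, \<open>LL\<close> steps to later steps, and
  \<open>RR\<close> steps to initial vertices of the next period. \<open>XX\<close> collects the
  derivatives of the mutated variables, \<open>CC\<close> records which strand each initial vertex
  belongs to, \<open>JJ\<close> is the Jacobian in logarithmic coordinates, and \<open>WW\<close> is
  \<open>A_+ Z_- + A_- Z_+\<close>.\<close>

definition "NN = Matrix.mat n n (\<lambda>(i, j). of_bool (i = \<nu> j \<and> idle j 0 T) :: real)"
definition "RR = Matrix.mat n T (\<lambda>(i, s). of_bool (idle (inv_into UNIV \<nu> i) (Suc s) T) * r s (inv_into UNIV \<nu> i))"
definition "KK = Matrix.mat T n (\<lambda>(t, i). of_bool (k t = i \<and> idle i 0 t) :: real)"
definition "LL = Matrix.mat T T (\<lambda>(t, s). if s < t then of_bool (idle (k t) (Suc s) t) * r s (k t) else 0)"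
definition "XX = Matrix.mat T n (\<lambda>(t, j). U t (k t) j)"
definition "CC = Matrix.mat T n (\<lambda>(s, j). of_bool ((j, 0) \<in> end_class \<gamma> s) :: real)"
definition "JJ = Matrix.mat n n (\<lambda>(i, j). U T (inv_into UNIV \<nu> i) j)"
definition "WW = Matrix.mat T T (\<lambda>(s, t). of_int (A_plus \<gamma> (end_class \<gamma> s) t) * zm t + of_int (A_minus \<gamma> (end_class \<gamma> s) t) * zp t)"

lemmas mat_defs = NN_def RR_def KK_def LL_def XX_def CC_def JJ_def WW_def

lemma carriers [simp]:
  "NN \<in> carrier_mat n n" "RR \<in> carrier_mat n T" "KK \<in> carrier_mat T n" "LL \<in> carrier_mat T T"
  "XX \<in> carrier_mat T n" "CC \<in> carrier_mat T n" "JJ \<in> carrier_mat n n" "WW \<in> carrier_mat T T"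
  by (simp_all add: mat_defs)

lemma mat_mult_entry:
  fixes f g :: "nat \<times> nat \<Rightarrow> 'a :: semiring_0"
  shows "i < a \<Longrightarrow> j < d \<Longrightarrow> (Matrix.mat a m f * Matrix.mat m d g) $$ (i, j) = (\<Sum>l<m. f (i, l) * g (l, j))"
  by (simp add: scalar_prod_def lessThan_atLeast0)

text \<open>The expansion \<open>U_expand\<close> at the final time, with vertices renamed by the
  gluing.\<close>

lemma JJ_eq: "JJ = NN + RR * XX"
proof (rule eq_matI)
  fix i j assume "i < dim_row (NN + RR * XX)" "j < dim_col (NN + RR * XX)"
  then have ij: "i < n" "j < n" by (auto simp: mat_defs)
  have "inv_into UNIV \<nu> i = j \<longleftrightarrow> i = \<nu> j" by (metis inv_perm_perm)
  then show "JJ $$ (i, j) = (NN + RR * XX) $$ (i, j)"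
    using ij by (subst index_add_mat) (auto simp: mat_defs mat_mult_entry U_expand[of T] simp del: index_mult_mat(1) sum_of_bool_eq sum_mult_of_bool_eq sum_of_bool_mult_eq)
qed (auto simp: mat_defs)

text \<open>The expansion \<open>U_expand\<close> at the vertex about to be mutated: its derivative
  depends on the initial variables and on the variables mutated at earlier steps.\<close>

lemma XX_eq: "XX = KK + LL * XX"
proof (rule eq_matI)
  fix t j assume "t < dim_row (KK + LL * XX)" "j < dim_col (KK + LL * XX)"
  then have tj: "t < T" "j < n" by (auto simp: mat_defs)
  \<comment> \<open>\<open>LL\<close> is strictly lower triangular, so the matrix product only sees
    the steps before \<open>t\<close>.\<close>
  have "(\<Sum>s<T. (if s < t then of_bool (idle (k t) (Suc s) t) * r s (k t) else 0) * U s (k s) j) =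
     (\<Sum>s<t. of_bool (idle (k t) (Suc s) t) * r s (k t) * U s (k s) j)"
    using tj by (intro sum.mono_neutral_cong_right) auto
  then show "XX $$ (t, j) = (KK + LL * XX) $$ (t, j)"
    using tj by (subst index_add_mat) (auto simp: mat_defs mat_mult_entry U_expand[of t] simp del: index_mult_mat(1) sum_of_bool_eq sum_mult_of_bool_eq sum_of_bool_mult_eq)
qed (auto simp: mat_defs)

lemma strand_end_class:
  assumes "i < n" "s \<le> T" "e < T"
  shows "of_bool ((i, s) \<in> end_class \<gamma> e) = (of_bool (i = k e \<and> s \<le> e \<and> idle i s e) +
     of_bool (idle i s T) * of_bool ((\<nu> i, 0) \<in> end_class \<gamma> e) :: real)"
  using assms end_in_end_class[OF \<open>e < T\<close>]
  by (intro strand_indicator[where X = "\<lambda>i t. of_bool ((i, t) \<in> end_class \<gamma> e)"] class_fun_class end_class_in) auto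

text \<open>The strand through \<open>(j, 0)\<close> either ends at the first mutation of
  \<open>j\<close>, which is recorded in \<open>KK\<close>, or runs through the whole period and
  continues at \<open>(\<nu> j, 0)\<close>.\<close>

lemma CC_eq: "CC = KK + CC * NN"
proof (rule eq_matI)
  fix s j assume "s < dim_row (KK + CC * NN)" "j < dim_col (KK + CC * NN)"
  then have sj: "s < T" "j < n" by (auto simp: mat_defs)
  have "(\<Sum>l<n. of_bool ((l, 0) \<in> end_class \<gamma> s) * (of_bool (l = \<nu> j \<and> idle j 0 T) :: real)) =
     (\<Sum>l<n. if l = \<nu> j then of_bool (idle j 0 T) * of_bool ((\<nu> j, 0) \<in> end_class \<gamma> s) else 0)"
    by (intro sum.cong) auto
  then show "CC $$ (s, j) = (KK + CC * NN) $$ (s, j)"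
    using sj strand_end_class[of j 0 s]
    by (subst index_add_mat) (auto simp: mat_defs mat_mult_entry simp del: index_mult_mat(1) sum_of_bool_eq sum_mult_of_bool_eq sum_of_bool_mult_eq)
qed (auto simp: mat_defs)

text \<open>Column \<open>t\<close> records how step \<open>t\<close> meets each strand. The node
  \<open>(k t, t)\<close> gives the identity matrix; all other contributions sit at time
  \<open>Suc t\<close> with weights \<open>r t\<close>. From there a strand ends within the same
  period (\<open>LL\<close>) or passes through the gluing (\<open>CC * RR\<close>).\<close>

lemma WW_eq: "WW = 1\<^sub>m T - (LL + CC * RR)"
proof (rule eq_matI)
  fix s t assume "s < dim_row (1\<^sub>m T - (LL + CC * RR))" "t < dim_col (1\<^sub>m T - (LL + CC * RR))"
  then have st: "s < T" "t < T" by (auto simp: mat_defs)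
  let ?X = "\<lambda>i t. of_bool ((i, t) \<in> end_class \<gamma> s) :: real"
  have X: "class_fun ?X" using st by (intro class_fun_class end_class_in)
  define I where "I = {..<n} - {k t}"
  have ins: "{..<n} = insert (k t) I" using k_lt[OF st(2)] by (auto simp: I_def)
  have fI: "finite I" "k t \<notin> I" by (auto simp: I_def)
  have ck: "c t (k t) = 0" using st q_self k_lt by (simp add: c_def)
  \<comment> \<open>Both Neumann-Zagier matrices contain \<open>N_zero\<close>, and its total weight
    \<open>zm t + zp t\<close> is 1; the arrow counts combine to \<open>c t\<close>.\<close>
  have "WW $$ (s, t) = (?X (k t) t + ?X (k t) (Suc t)) * (zm t + zp t) - (\<Sum>i<n. c t i * ?X i t)"
    using st unfolding WW_def
    by (simp add: A_plus_eq A_minus_eq Ap_def Am_def c_def sum.distrib sum_subtractf sum_distrib_left sum_distrib_right algebra_simps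
        del: sum_of_bool_eq sum_mult_of_bool_eq sum_of_bool_mult_eq)
  also have "\<dots> = of_bool (s = t) - (- ?X (k t) (Suc t) + (\<Sum>i<n. c t i * ?X i t))"
    using st by (simp add: end_in_end_class)
  \<comment> \<open>The new node at \<open>k t\<close> has weight \<open>- 1\<close>, in accordance
    with \<open>r\<close>; at the other vertices the strand does not change during step
    \<open>t\<close>.\<close>
  also have "- ?X (k t) (Suc t) + (\<Sum>i<n. c t i * ?X i t) = (\<Sum>i<n. r t i * ?X i (Suc t))"
  proof -
    have "(\<Sum>i\<in>I. r t i * ?X i (Suc t)) = (\<Sum>i\<in>I. c t i * ?X i t)"
      using class_fun_step[OF X _ st(2)] by (intro sum.cong refl) (simp add: r_def I_def)
    then show ?thesis
      unfolding ins using fI by (simp add: ck r_def del: sum_of_bool_eq sum_mult_of_bool_eq sum_of_bool_mult_eq)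
  qed
  also have "\<dots> = (\<Sum>i<n. r t i * of_bool (i = k s \<and> Suc t \<le> s \<and> idle i (Suc t) s)) +
      (\<Sum>i<n. r t i * (of_bool (idle i (Suc t) T) * ?X (\<nu> i) 0))"
    unfolding sum.distrib[symmetric]
    using st by (intro sum.cong refl) (simp add: strand_end_class[of _ "Suc t" s] distrib_left)
  also have "(\<Sum>i<n. r t i * of_bool (i = k s \<and> Suc t \<le> s \<and> idle i (Suc t) s)) =
      (\<Sum>i<n. if i = k s then r t (k s) * of_bool (Suc t \<le> s \<and> idle (k s) (Suc t) s) else 0)"
    by (intro sum.cong) auto
  also have "\<dots> = LL $$ (s, t)"
    using st k_lt by (simp add: LL_def Suc_le_eq)
  also have "(\<Sum>i<n. r t i * (of_bool (idle i (Suc t) T) * ?X (\<nu> i) 0)) = (CC * RR) $$ (s, t)"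
    using st sum.reindex_bij_betw[OF permutes_imp_bij[OF perm],
      of "\<lambda>i. ?X i 0 * (of_bool (idle (inv_into UNIV \<nu> i) (Suc t) T) * r t (inv_into UNIV \<nu> i))"]
    by (simp add: CC_def RR_def mat_mult_entry mult_ac del: index_mult_mat(1) sum_of_bool_eq sum_mult_of_bool_eq sum_of_bool_mult_eq)
  finally show "WW $$ (s, t) = (1\<^sub>m T - (LL + CC * RR)) $$ (s, t)"
    using st by (simp add: LL_def CC_def RR_def del: index_mult_mat(1) sum_of_bool_eq sum_mult_of_bool_eq sum_of_bool_mult_eq)
qed (auto simp: mat_defs)

section \<open>The feedback determinants equal to one, and the Jacobian determinant\<close>

lemma det_LL: "Determinant.det (1\<^sub>m T - LL) = 1"
proof -
  have "diag_mat (1\<^sub>m T - LL) = replicate T 1"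
    by (rule nth_equalityI) (auto simp: diag_mat_def LL_def)
  then show ?thesis
    by (subst det_lower_triangular[of T]) (auto simp: LL_def)
qed

text \<open>Moving along \<open>adj\<close> in either direction keeps the vertex inside the
  invariant set \<open>S\<close>. When the cardinalities agree, the class of \<open>(i, 0)\<close>
  contains some end node \<open>(k s, s)\<close>, whose vertex is then in \<open>S\<close>.\<close>

lemma invariant_set_mutated:
  assumes card: "card (E_classes \<gamma>) = T" and i: "i < n" "i \<in> S"
    and inv: "\<And>i. \<nu> i \<in> S \<longleftrightarrow> i \<in> S"
  shows "\<exists>s<T. k s \<in> S"
proof -
  have node: "(i, 0) \<in> nodes \<gamma>" using i by (simp add: nodes_def)
  then have "class_rel \<gamma> `` {(i, 0)} \<in> E_classes \<gamma>" by (auto simp: E_classes_def intro: quotientI)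
  then obtain s where s: "s < T" "class_rel \<gamma> `` {(i, 0)} = end_class \<gamma> s"
    using end_class_image[OF card] by auto
  have "(i, 0) \<in> end_class \<gamma> s"
    using s(2) equiv_class_self[OF equiv_class_rel node] by simp
  then have "equivclp (adj \<gamma>) (k s, s) (i, 0)" by (simp add: end_class_def class_rel_def)
  moreover have "fst y \<in> S \<longleftrightarrow> fst z \<in> S" if "adj \<gamma> y z" for y z
    using that by cases (auto simp: inv)
  ultimately have "fst (i, 0::nat) \<in> S \<longleftrightarrow> fst (k s, s) \<in> S"
    by (induction rule: equivclp_induct) auto
  then show ?thesis using s(1) i by auto
qed

text \<open>In the Leibniz expansion only the identity contributes: the support of any other contributing
  permutation would be a \<open>\<nu>\<close>-invariant set of vertices that are never mutated.\<close>

lemma det_NN: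
  assumes card: "card (E_classes \<gamma>) = T"
  shows "Determinant.det (1\<^sub>m n - NN) = 1"
proof -
  have id: "p = id" if p: "p permutes {0..<n}" and nz: "(\<Prod>i = 0..<n. (1\<^sub>m n - NN) $$ (i, p i)) \<noteq> 0" for p
  proof (rule ccontr)
    assume "p \<noteq> id"
    define S where "S = {i. p i \<noteq> i}"
    have S_lt: "i < n" if "i \<in> S" for i
      using permutes_not_in[OF p, of i] that by (cases "i < n") (auto simp: S_def)
    have pS: "p i \<in> S \<longleftrightarrow> i \<in> S" for i
      using permutes_inj[OF p] by (auto simp: S_def inj_eq)
    \<comment> \<open>Off the diagonal a nonzero entry of \<open>1 - NN\<close> has to come from
      \<open>NN\<close>.\<close>
    have *: "i = \<nu> (p i) \<and> idle (p i) 0 T" if "i \<in> S" for i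
    proof -
      have "(1\<^sub>m n - NN) $$ (i, p i) \<noteq> 0" using nz S_lt[OF that] by simp
      then show ?thesis using that S_lt[OF that] S_lt[of "p i"] pS[of i]
        by (auto simp: NN_def S_def split: if_splits)
    qed
    have surj: "\<exists>i'\<in>S. i = p i'" if "i \<in> S" for i
      using that pS permutes_surj[OF p] by (metis surjD)
    have "\<nu> i \<in> S \<longleftrightarrow> i \<in> S" for i
    proof
      assume "i \<in> S" then show "\<nu> i \<in> S" using surj * by metis
    next
      assume "\<nu> i \<in> S"
      then show "i \<in> S" using * pS inv_perm_perm by metis
    qed
    moreover obtain i where "i \<in> S" using \<open>p \<noteq> id\<close> by (auto simp: S_def fun_eq_iff)
    ultimately obtain s where "s < T" "k s \<in> S"
      using invariant_set_mutated[OF card S_lt] by blast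
    \<comment> \<open>As an element of \<open>S\<close> the vertex \<open>k s\<close> has the form
      \<open>p i'\<close> with \<open>i'\<close> in \<open>S\<close>, so it is idle for the whole
      period, although it is mutated at step \<open>s\<close>.\<close>
    moreover from this have "idle (k s) 0 T" using surj * by metis
    ultimately show False by (auto simp: idle_def)
  qed
  have "Determinant.det (1\<^sub>m n - NN) =
      (\<Sum>p\<in>{p. p permutes {0..<n}}. signof p * (\<Prod>i = 0..<n. (1\<^sub>m n - NN) $$ (i, p i)))"
    by (rule det_def') (rule minus_carrier_mat[OF carriers(1)])
  also have "\<dots> = (\<Sum>p\<in>{id}. signof p * (\<Prod>i = 0..<n. (1\<^sub>m n - NN) $$ (i, p i)))"
    using id by (intro sum.mono_neutral_right) (auto simp: permutes_id finite_permutations)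
  also have "\<dots> = (\<Prod>i = 0..<n. 1 - NN $$ (i, i))" by (simp add: NN_def)
  also have "\<dots> = 1"
  proof (intro prod.neutral ballI)
    fix i assume i: "i \<in> {0..<n}"
    \<comment> \<open>A nonzero diagonal entry of \<open>NN\<close> would give an invariant
      singleton whose vertex is never mutated.\<close>
    have False if "i = \<nu> i" "idle i 0 T"
    proof -
      have "\<nu> j \<in> {i} \<longleftrightarrow> j \<in> {i}" for j using that(1) inv_perm_perm by (metis singleton_iff)
      then show False using invariant_set_mutated[OF card, of i "{i}"] that(2) i by (auto simp: idle_def)
    qed
    then show "1 - NN $$ (i, i) = 1" using i by (auto simp: NN_def)
  qed
  finally show ?thesis .
qed

text \<open>Conjugation by the diagonal matrix of the \<open>\<eta> i\<close> reduces to
  \<open>1 - JJ\<close>. Of the four determinants in \<open>det_feedback\<close>, those of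
  \<open>1 - LL\<close> and \<open>1 - NN\<close> are 1.\<close>

lemma det_jacobian:
  assumes card: "card (E_classes \<gamma>) = T"
  shows "Determinant.det (1\<^sub>m n - jacobian \<gamma> \<eta>) = Determinant.det WW"
proof -
  have \<eta>: "\<eta> i > 0" if "i < n" for i using Y_pos[of 0 i] that by simp
  have "1\<^sub>m n - jacobian \<gamma> \<eta> = Matrix.mat n n (\<lambda>(i, j). \<eta> i * (1\<^sub>m n - JJ) $$ (i, j) / \<eta> j)"
    by (rule eq_matI) (use \<eta> in \<open>auto simp: jacobian_entry JJ_def Defs.jacobian_def[of \<gamma> \<eta>, THEN arg_cong[of _ _ dim_row]]
      Defs.jacobian_def[of \<gamma> \<eta>, THEN arg_cong[of _ _ dim_col]] diff_divide_distrib right_diff_distrib less_imp_neq[symmetric]\<close>)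
  then have "Determinant.det (1\<^sub>m n - jacobian \<gamma> \<eta>) = Determinant.det (1\<^sub>m n - JJ)"
    using \<eta> by (simp only:) (subst det_conj_diag[OF minus_carrier_mat[OF carriers(7)]], auto simp: less_imp_neq[symmetric])
  also have "\<dots> = Determinant.det WW"
    using det_feedback[of NN n RR T KK LL XX CC] XX_eq CC_eq
    by (simp add: JJ_eq WW_eq det_LL det_NN[OF card] del: index_mult_mat)
  finally show ?thesis .
qed

end

section \<open>The \<open>q\<close>-exponential function\<close>

lemma qfact_pos: "0 < q \<Longrightarrow> q < 1 \<Longrightarrow> qfact q n > 0"
  unfolding qfact_def by (intro prod_pos) (auto simp: power_less_one_iff)

lemma qfact_0 [simp]: "qfact q 0 = 1" and qfact_Suc: "qfact q (Suc n) = qfact q n * (1 - q ^ Suc n)"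
  by (simp_all add: qfact_def)

text \<open>Ratio test: the norms of consecutive quotients are
  \<open>norm w / (1 - q ^ Suc n)\<close> and tend to \<open>norm w\<close>, hence are eventually
  below any \<open>c\<close> between \<open>norm w\<close> and 1.\<close>

lemma summable_q_exp:
  fixes w :: complex
  assumes q: "0 < q" "q < 1" and w: "norm w < 1"
  shows "summable (\<lambda>n. norm (w ^ n / of_real (qfact q n)))"
proof -
  obtain c where c: "norm w < c" "c < 1" using w dense by blast
  have c0: "c > 0" using c norm_ge_zero[of w] by linarith
  have "(\<lambda>n. 1 - q ^ Suc n) \<longlonglongrightarrow> 1 - 0" using q by (intro tendsto_intros LIMSEQ_Suc LIMSEQ_power_zero) auto
  then have "eventually (\<lambda>n. 1 - q ^ Suc n > norm w / c) sequentially"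
    by (rule order_tendstoD) (use c c0 in \<open>simp add: divide_less_eq\<close>)
  then obtain N where N: "\<And>n. n \<ge> N \<Longrightarrow> 1 - q ^ Suc n > norm w / c" by (auto simp: eventually_sequentially)
  show ?thesis
  proof (rule summable_ratio_test[OF c(2), of N])
    fix n assume "n \<ge> N"
    then have N': "1 - q ^ Suc n > norm w / c" using N by blast
    have pos: "qfact q n > 0" "1 - q ^ Suc n > 0" using q qfact_pos[of q n] by (auto simp: power_less_one_iff simp del: power_Suc)
    have "norm w \<le> c * (1 - q ^ Suc n)" using N' c0 by (simp add: divide_less_eq mult.commute less_imp_le del: power_Suc)
    then have "norm w / (1 - q ^ Suc n) \<le> c" using pos(2) by (simp add: pos_divide_le_eq del: power_Suc)
    have "norm (norm (w ^ Suc n / of_real (qfact q (Suc n)))) =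
        norm (w ^ n / of_real (qfact q n)) * (norm w / (1 - q ^ Suc n))"
      using pos unfolding qfact_Suc by (simp add: norm_mult norm_divide norm_power del: of_real_mult of_real_diff of_real_power power_Suc)
        (simp add: abs_mult)
    also have "\<dots> \<le> norm (w ^ n / of_real (qfact q n)) * c"
      by (intro mult_left_mono) (fact, simp)
    finally show "norm (norm (w ^ Suc n / of_real (qfact q (Suc n)))) \<le> c * norm (norm (w ^ n / of_real (qfact q n)))"
      by (simp add: mult.commute)
  qed
qed

text \<open>The logarithm of the \<open>q\<close>-exponential function. The term for \<open>n = 0\<close> is \<open>1 / 0 = 0\<close>.\<close>

definition q_log :: "real \<Rightarrow> 'a \<Rightarrow> 'a :: {real_normed_field, banach}" where
  "q_log q w = (\<Sum>n. w ^ n / (of_nat n * of_real (1 - q ^ n)))"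

text \<open>For positive \<open>n\<close> the denominator \<open>n (1 - q ^ n)\<close> is at least
  \<open>1 - q\<close>, so a geometric series dominates.\<close>

lemma summable_q_log:
  fixes w :: "'a :: {real_normed_field, banach}"
  assumes q: "0 < q" "q < 1" and w: "norm w < 1"
  shows "summable (\<lambda>n. norm (w ^ n / (of_nat n * of_real (1 - q ^ n))))"
proof (rule summable_comparison_test)
  show "summable (\<lambda>n. norm w ^ n * (1 / (1 - q)))"
    using w by (intro summable_mult2 summable_geometric) simp
  have "norm (w ^ n / (of_nat n * of_real (1 - q ^ n))) \<le> norm w ^ n * (1 / (1 - q))" for n
  proof (cases "n = 0")
    case False
    have "q ^ n \<le> q ^ 1" using q False by (intro power_decreasing) auto
    then have "1 - q \<le> 1 * (1 - q ^ n)" by simp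
    also have "\<dots> \<le> real n * (1 - q ^ n)" using False q by (intro mult_right_mono) (auto simp: power_le_one)
    finally have *: "1 - q \<le> real n * (1 - q ^ n)" .
    have "norm (w ^ n / (of_nat n * of_real (1 - q ^ n))) = norm w ^ n * (1 / (real n * (1 - q ^ n)))"
      using q by (simp add: norm_divide norm_mult norm_power power_le_one del: of_real_diff of_real_power)
    also have "\<dots> \<le> norm w ^ n * (1 / (1 - q))"
      using * q by (intro mult_left_mono divide_left_mono) (auto simp: mult_pos_pos)
    finally show ?thesis .
  qed (use q in auto)
  then show "\<exists>N. \<forall>n\<ge>N. norm (norm (w ^ n / (of_nat n * of_real (1 - q ^ n)))) \<le> norm w ^ n * (1 / (1 - q))"
    by auto
qed

text \<open>Both sides satisfy \<open>f (q w) = (1 - w) f w\<close> and are continuous at \<open>0\<close>.\<close>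

lemma q_exp_sums:
  fixes w :: complex
  assumes q: "0 < q" "q < 1" and w: "norm w < 1"
  shows "(\<lambda>n. w ^ n / of_real (qfact q n)) sums exp (q_log q w)"
proof -
  define f where "f w = (\<Sum>n. 1 / of_real (qfact q n) * w ^ n)" for w :: complex
  define g where "g w = (\<Sum>n. 1 / (of_nat n * of_real (1 - q ^ n)) * w ^ n)" for w :: complex
  have sf: "summable (\<lambda>n. 1 / of_real (qfact q n) * w ^ n)" if "norm w < 1" for w :: complex
    using summable_norm_cancel[OF summable_q_exp[OF q that]] by simp
  have sg: "summable (\<lambda>n. 1 / (of_nat n * of_real (1 - q ^ n)) * w ^ n)" if "norm w < 1" for w :: complex
    using summable_norm_cancel[OF summable_q_log[OF q that]] by simp
  \<comment> \<open>Any nonzero point of the unit disc serves to obtain continuity of both power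
    series at 0.\<close>
  have half: "norm (1/2 :: complex) < 1" by simp
  have cont: "isCont (\<lambda>w. f w * exp (- g w)) 0"
    unfolding f_def g_def
    by (intro continuous_intros isCont_powser[OF sf[OF half]] isCont_powser[OF sg[OF half]]) auto
  have f0: "f 0 = 1" and g0: "g 0 = 0"
    using powser_zero[of "\<lambda>n. 1 / complex_of_real (qfact q n)"]
      powser_zero[of "\<lambda>n. 1 / (complex_of_nat n * complex_of_real (1 - q ^ n))"] by (simp_all add: f_def g_def)
  have step: "f (of_real q * w) * exp (- g (of_real q * w)) = f w * exp (- g w)" if w: "norm w < 1" for w
  proof -
    have "q * norm w \<le> 1 * norm w" using q by (intro mult_right_mono) auto
    then have qw: "norm (of_real q * w) < 1" using q w by (simp add: norm_mult)
    define F where "F n = 1 / of_real (qfact q n) * w ^ n - 1 / of_real (qfact q n) * (of_real q * w) ^ n" for n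
    have "F sums (f w - f (of_real q * w))"
      unfolding f_def F_def[abs_def] by (intro sums_diff summable_sums sf w qw)
    \<comment> \<open>The constant term \<open>F 0\<close> vanishes; after the shift the factor
      \<open>1 - q ^ Suc n\<close> cancels the last factor of
      \<open>qfact q (Suc n)\<close>.\<close>
    then have "F sums (f w - f (of_real q * w) + F 0)" by (simp add: F_def)
    then have "(\<lambda>n. F (Suc n)) sums (f w - f (of_real q * w))"
      by (rule iffD2[OF sums_Suc_iff])
    then have "(\<lambda>n. 1 / of_real (qfact q (Suc n)) * w ^ Suc n - 1 / of_real (qfact q (Suc n)) * (of_real q * w) ^ Suc n) sums (f w - f (of_real q * w))"
      by (simp only: F_def)
    also have "(\<lambda>n. 1 / of_real (qfact q (Suc n)) * w ^ Suc n - 1 / of_real (qfact q (Suc n)) * (of_real q * w) ^ Suc n)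
       = (\<lambda>n. w * (1 / of_real (qfact q n) * w ^ n))"
    proof
      fix n
      have *: "qfact q n \<noteq> 0" "1 - q ^ Suc n \<noteq> 0" using q qfact_pos[of q n] power_less_one_iff[of q "Suc n"] by auto
      have "1 / of_real (qfact q (Suc n)) * w ^ Suc n - 1 / of_real (qfact q (Suc n)) * (of_real q * w) ^ Suc n =
          w ^ Suc n * of_real ((1 - q ^ Suc n) / qfact q (Suc n))"
        by (simp add: power_mult_distrib field_simps diff_divide_distrib)
      also have "(1 - q ^ Suc n) / qfact q (Suc n) = 1 / qfact q n"
        using * unfolding qfact_Suc by (simp del: power_Suc)
      finally show "1 / of_real (qfact q (Suc n)) * w ^ Suc n - 1 / of_real (qfact q (Suc n)) * (of_real q * w) ^ Suc n =
         w * (1 / of_real (qfact q n) * w ^ n)" by simp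
    qed
    finally have "f w - f (of_real q * w) = w * f w"
      using sums_unique2 sums_mult[OF summable_sums[OF sf[OF w]], of w] unfolding f_def by blast
    then have fq: "f (of_real q * w) = (1 - w) * f w" by (simp add: algebra_simps)
    \<comment> \<open>Here \<open>1 - q ^ n\<close> cancels and the series of
      \<open>- Ln (1 - w)\<close> remains.\<close>
    have "(\<lambda>n. 1 / (of_nat n * of_real (1 - q ^ n)) * w ^ n - 1 / (of_nat n * of_real (1 - q ^ n)) * (of_real q * w) ^ n) sums
        (g w - g (of_real q * w))"
      unfolding g_def by (intro sums_diff summable_sums sg w qw)
    also have "(\<lambda>n. 1 / (of_nat n * of_real (1 - q ^ n)) * w ^ n - 1 / (of_nat n * of_real (1 - q ^ n)) * (of_real q * w) ^ n) =
       (\<lambda>n. w ^ n / of_nat n)"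
    proof
      fix n
      show "1 / (of_nat n * of_real (1 - q ^ n)) * w ^ n - 1 / (of_nat n * of_real (1 - q ^ n)) * (of_real q * w) ^ n = w ^ n / of_nat n"
      proof (cases "n = 0")
        case False
        then have "1 - q ^ n \<noteq> 0" using q power_less_one_iff[of q n] by auto
        then have "1 - complex_of_real q ^ n \<noteq> 0" by (metis of_real_1 of_real_diff of_real_eq_0_iff of_real_power)
        moreover have "1 / d * x - 1 / d * (Q * x) = x * (1 - Q) / d" for d x Q :: complex
          by (simp add: algebra_simps diff_divide_distrib)
        ultimately show ?thesis using False by (simp add: power_mult_distrib)
      qed simp
    qed
    finally have "(\<lambda>n. w ^ n / of_nat n) sums (g w - g (of_real q * w))" .
    moreover have "(\<lambda>n. w ^ n / of_nat n) sums (- Ln (1 - w))"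
      using sums_minus[OF Ln_series'[of "- w"]] w by simp
    ultimately have "g w - g (of_real q * w) = - Ln (1 - w)" by (rule sums_unique2)
    then have "g (of_real q * w) = g w + Ln (1 - w)" by (simp add: algebra_simps)
    moreover have "1 - w \<noteq> 0" using w by auto
    ultimately have "exp (- g (of_real q * w)) = exp (- g w) / (1 - w)"
      by (simp add: exp_diff exp_Ln)
    then show ?thesis using \<open>1 - w \<noteq> 0\<close> by (simp add: fq)
  qed
  have iter: "f (of_real (q ^ j) * w) * exp (- g (of_real (q ^ j) * w)) = f w * exp (- g w)" for j
  proof (induction j)
    case (Suc j)
    have "norm (of_real (q ^ j) * w) < 1"
    proof -
      have "norm (of_real (q ^ j) * w) = q ^ j * norm w" using q by (simp add: norm_mult norm_power)
      also have "\<dots> \<le> 1 * norm w" using q by (intro mult_right_mono power_le_one) auto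
      finally show ?thesis using w by simp
    qed
    from step[OF this] show ?case using Suc by (simp add: mult.assoc)
  qed simp
  \<comment> \<open>The product \<open>f w * exp (- g w)\<close> is invariant under
    \<open>w \<mapsto> q w\<close>, so letting the orbit of \<open>w\<close> tend to 0 identifies it
    with its value 1 at 0.\<close>
  have "(\<lambda>j. of_real (q ^ j) * w) \<longlonglongrightarrow> of_real 0 * w"
    using q by (intro tendsto_intros LIMSEQ_power_zero) auto
  then have "(\<lambda>j. of_real (q ^ j) * w) \<longlonglongrightarrow> 0" by simp
  from isCont_tendsto_compose[OF cont this] have "(\<lambda>j. f w * exp (- g w)) \<longlonglongrightarrow> f 0 * exp (- g 0)"
    unfolding iter .
  then have "f w * exp (- g w) = 1" by (simp add: f0 g0 LIMSEQ_const_iff)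
  then have "f w = exp (g w)" by (simp add: exp_minus field_simps)
  moreover have "g w = q_log q w" unfolding g_def q_log_def by simp
  ultimately show ?thesis using summable_sums[OF sf[OF w]] unfolding f_def by simp
qed

lemma q_exp_sums_real:
  assumes q: "0 < q" "q < 1" and z: "0 < z" "z < (1::real)"
  shows "(\<lambda>n. z ^ n / qfact q n) sums exp (q_log q z)"
proof -
  have "norm (complex_of_real z) < 1" using z by simp
  from q_exp_sums[OF q this] have "(\<lambda>n. complex_of_real (z ^ n / qfact q n)) sums exp (q_log q (complex_of_real z))"
    by simp
  moreover have "q_log q (complex_of_real z) = of_real (q_log q z)"
    unfolding q_log_def
    using suminf_of_real[OF summable_norm_cancel[OF summable_q_log[OF q, of z]], where 'a = complex] z by simp
  ultimately have "(\<lambda>n. complex_of_real (z ^ n / qfact q n)) sums of_real (exp (q_log q z))"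
    by (simp add: exp_of_real)
  then show ?thesis by (simp only: sums_of_real_iff)
qed

section \<open>Asymptotics of the \<open>q\<close>-exponential\<close>

text \<open>The Euler dilogarithm. Its term for \<open>n = 0\<close> is 0 by division by
  zero.\<close>

definition dilog :: "real \<Rightarrow> real" where
  "dilog z = (\<Sum>n. z ^ n / real n ^ 2)"

text \<open>Removing the pole \<open>1 / x\<close> leaves a remainder between 0 and 1. This is what
  dominates the series in the limits below.\<close>

lemma bose_bounds:
  assumes "(x::real) > 0"
  shows "0 \<le> 1 / (1 - exp (- x)) - 1 / x" "1 / (1 - exp (- x)) - 1 / x \<le> 1"
proof -
  have "1 - exp (- x) > 0" using assms by simp
  moreover have "1 - exp (- x) \<le> x" using exp_ge_add_one_self[of "- x"] by simp
  ultimately show "0 \<le> 1 / (1 - exp (- x)) - 1 / x" using assms by (simp add: field_simps)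
  have "1 + x \<le> exp x" using exp_ge_add_one_self[of x] by simp
  then show "1 / (1 - exp (- x)) - 1 / x \<le> 1"
    using assms by (simp add: exp_minus field_simps)
qed

lemma bose_limit: "c > 0 \<Longrightarrow> ((\<lambda>\<epsilon>. 1 / (1 - exp (- (c * \<epsilon>))) - 1 / (c * \<epsilon>)) \<longlongrightarrow> 1 / 2) (at_right (0::real))"
  by real_asymp (simp add: field_simps)

lemma geometric_log_sums:
  assumes "0 < z" "z < (1::real)"
  shows "(\<lambda>n. z ^ n / real n) sums (- ln (1 - z))"
  using sums_minus[OF ln_series'[of "- z"]] assms by simp

lemma summable_dilog:
  assumes "0 \<le> z" "z < (1::real)"
  shows "summable (\<lambda>n. z ^ n / real n ^ 2)"
proof (rule summable_comparison_test[OF _ summable_geometric[of z]])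
  have "norm (z ^ n / real n ^ 2) \<le> z ^ n" if "n \<ge> 1" for n
  proof -
    have "1 \<le> real n ^ 2" using that by (simp add: one_le_power)
    then have "z ^ n * 1 \<le> z ^ n * real n ^ 2" using assms by (intro mult_left_mono) auto
    then show ?thesis using that assms by (simp add: divide_le_eq)
  qed
  then show "\<exists>N. \<forall>n\<ge>N. norm (z ^ n / real n ^ 2) \<le> z ^ n" by blast
qed (use assms in simp)

text \<open>Subtracting \<open>dilog z / \<epsilon>\<close> removes the pole from each term. What
  remains is \<open>z ^ n / n\<close> times a factor bounded by 1 with limit 1/2, so Tannery's
  theorem applies.\<close>

lemma q_log_asymp:
  assumes z: "0 < z" "z < 1"
  shows "((\<lambda>\<epsilon>. q_log (exp (- \<epsilon>)) z - dilog z / \<epsilon>) \<longlongrightarrow> - ln (1 - z) / 2) (at_right 0)"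
proof -
  define a where "a n \<epsilon> = z ^ n / real n * (1 / (1 - exp (- (real n * \<epsilon>))) - 1 / (real n * \<epsilon>))" for n \<epsilon>
  have lim: "((\<lambda>\<epsilon>. a n \<epsilon>) \<longlongrightarrow> z ^ n / real n * (1 / 2)) (at_right 0)" for n
  proof (cases "n = 0")
    case False
    then show ?thesis unfolding a_def by (intro tendsto_mult tendsto_const bose_limit) simp
  qed (simp add: a_def)
  have bd: "norm (a n \<epsilon>) \<le> z ^ n / real n" if "\<epsilon> > 0" for n \<epsilon>
  proof (cases "n = 0")
    case False
    then have "\<bar>1 / (1 - exp (- (real n * \<epsilon>))) - 1 / (real n * \<epsilon>)\<bar> \<le> 1"
      using bose_bounds[of "real n * \<epsilon>"] that by simp
    then have "z ^ n / real n * \<bar>1 / (1 - exp (- (real n * \<epsilon>))) - 1 / (real n * \<epsilon>)\<bar> \<le> z ^ n / real n * 1"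
      using z by (intro mult_left_mono) auto
    then show ?thesis using z by (simp add: a_def abs_mult)
  qed (simp add: a_def)
  have "eventually (\<lambda>\<epsilon>::real. \<epsilon> > 0) (at_right 0)" by (simp add: eventually_at_right_less)
  then have ev: "eventually (\<lambda>(n, \<epsilon>). norm (a n \<epsilon>) \<le> z ^ n / real n) (at_top \<times>\<^sub>F at_right 0)"
    using bd unfolding eventually_prod_filter by (intro exI[of _ "\<lambda>_. True"] exI[of _ "\<lambda>\<epsilon>. \<epsilon> > 0"]) auto
  from tannerys_theorem[OF lim ev sums_summable[OF geometric_log_sums[OF z]]]
  have "((\<lambda>\<epsilon>. \<Sum>n. a n \<epsilon>) \<longlongrightarrow> (\<Sum>n. z ^ n / real n * (1 / 2))) (at_right 0)" by simp
  also have "(\<Sum>n. z ^ n / real n * (1 / 2)) = - ln (1 - z) / 2"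
    using sums_unique[OF sums_mult2[OF geometric_log_sums[OF z], of "1/2"]] by simp
  finally show ?thesis
  proof (rule Lim_transform_eventually)
    show "\<forall>\<^sub>F \<epsilon> in at_right 0. (\<Sum>n. a n \<epsilon>) = q_log (exp (- \<epsilon>)) z - dilog z / \<epsilon>"
      using \<open>eventually (\<lambda>\<epsilon>::real. \<epsilon> > 0) (at_right 0)\<close>
    proof eventually_elim
      case (elim \<epsilon>)
      have "(\<lambda>n. z ^ n / (of_nat n * of_real (1 - exp (- \<epsilon>) ^ n)) - z ^ n / real n ^ 2 / \<epsilon>) sums
          (q_log (exp (- \<epsilon>)) z - dilog z / \<epsilon>)"
        unfolding q_log_def dilog_def
        using z elim
        by (intro sums_diff sums_divide summable_sums summable_dilog summable_norm_cancel[OF summable_q_log]) auto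
      also have "(\<lambda>n. z ^ n / (of_nat n * of_real (1 - exp (- \<epsilon>) ^ n)) - z ^ n / real n ^ 2 / \<epsilon>) = (\<lambda>n. a n \<epsilon>)"
        by (rule ext) (simp add: a_def exp_of_nat_mult[symmetric] power2_eq_square right_diff_distrib)
      finally have "(\<Sum>n. a n \<epsilon>) = q_log (exp (- \<epsilon>)) z - dilog z / \<epsilon>"
        by (rule sums_unique[symmetric])
      then show ?case .
    qed
  qed
qed

text \<open>The left side is the logarithm of the characteristic function of the rescaled Euler
  distribution, with the centring included as the term containing \<open>ln (1 - z)\<close>.
  Expanding \<open>iexp\<close> termwise to second order, the linear part cancels against the
  centring and the quadratic part gives the variance \<open>z / (1 - z)\<close>.\<close>

lemma q_log_char_asymp:
  assumes z: "0 < z" "z < 1"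
  shows "((\<lambda>\<epsilon>. q_log (exp (- \<epsilon>)) (of_real z * iexp (s * sqrt \<epsilon>)) - of_real (q_log (exp (- \<epsilon>)) z)
      + \<i> * of_real (s * sqrt \<epsilon> * ln (1 - z) / \<epsilon>)) \<longlongrightarrow> of_real (- s\<^sup>2 / 2 * (z / (1 - z)))) (at_right 0)"
proof -
  define B where "B n \<epsilon> = 1 / (1 - exp (- (real n * \<epsilon>)))" for n \<epsilon>
  define a where "a n \<epsilon> = of_real (z ^ n / real n) *
    ((iexp (real n * (s * sqrt \<epsilon>)) - 1) * of_real (B n \<epsilon>) - \<i> * of_real (s * sqrt \<epsilon> / \<epsilon>))" for n \<epsilon>
  have Bpos: "B n \<epsilon> > 0" "B n \<epsilon> \<le> 1 + 1 / (real n * \<epsilon>)" if "\<epsilon> > 0" "n > 0" for n \<epsilon>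
    using bose_bounds[of "real n * \<epsilon>"] that by (auto simp: B_def)
  \<comment> \<open>The term subtracted in \<open>a\<close> is the linear Taylor term of
    \<open>iexp\<close> times the pole \<open>1 / (n \<epsilon>)\<close> of
    \<open>B\<close>.\<close>
  have a_eq: "a n \<epsilon> = of_real (z ^ n / real n) *
    ((iexp (real n * (s * sqrt \<epsilon>)) - 1 - \<i> * of_real (real n * (s * sqrt \<epsilon>))) * of_real (B n \<epsilon>) +
      \<i> * of_real (real n * (s * sqrt \<epsilon>) * (B n \<epsilon> - 1 / (real n * \<epsilon>))))" if "n > 0" "\<epsilon> > 0" for n \<epsilon>
    unfolding a_def using that by (simp add: field_simps)
  have approx1: "norm (iexp x - 1 - \<i> * of_real x) \<le> x\<^sup>2 / 2" for x
    using iexp_approx1[of x 1] by (simp add: diff_diff_eq numeral_2_eq_2)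
  have approx2: "norm (iexp x - 1 - \<i> * of_real x + of_real (x\<^sup>2 / 2)) \<le> \<bar>x\<bar> ^ 3 / 6" for x
    using iexp_approx1[of x 2] by (simp add: diff_diff_eq numeral_2_eq_2 numeral_3_eq_3 power_mult_distrib fact_numeral algebra_simps)
  have pos: "eventually (\<lambda>\<epsilon>::real. \<epsilon> > 0) (at_right 0)" by (simp add: eventually_at_right_less)
  have lim: "((\<lambda>\<epsilon>. a n \<epsilon>) \<longlongrightarrow> of_real (z ^ n * (- s\<^sup>2 / 2)) * of_bool (n > 0)) (at_right 0)" for n
  proof (cases "n = 0")
    case False
    then have n: "real n > 0" by simp
    \<comment> \<open>The cubic Taylor remainder is of order \<open>\<epsilon>\<close> to the power
      3/2, while \<open>B\<close> grows only like \<open>1 / \<epsilon>\<close>.\<close>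
    have l1: "((\<lambda>\<epsilon>. (iexp (real n * (s * sqrt \<epsilon>)) - 1 - \<i> * of_real (real n * (s * sqrt \<epsilon>)) +
        of_real ((real n * (s * sqrt \<epsilon>))\<^sup>2 / 2)) * of_real (B n \<epsilon>)) \<longlongrightarrow> 0) (at_right 0)"
    proof (rule Lim_null_comparison)
      show "\<forall>\<^sub>F \<epsilon> in at_right 0. norm ((iexp (real n * (s * sqrt \<epsilon>)) - 1 - \<i> * of_real (real n * (s * sqrt \<epsilon>)) +
        of_real ((real n * (s * sqrt \<epsilon>))\<^sup>2 / 2)) * of_real (B n \<epsilon>)) \<le> (real n * \<bar>s\<bar>) ^ 3 / 6 * (sqrt \<epsilon> ^ 3 * B n \<epsilon>)"
        using pos
      proof eventually_elim
        case (elim \<epsilon>)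
        have "norm (iexp (real n * (s * sqrt \<epsilon>)) - 1 - \<i> * of_real (real n * (s * sqrt \<epsilon>)) +
          of_real ((real n * (s * sqrt \<epsilon>))\<^sup>2 / 2)) * B n \<epsilon> \<le> \<bar>real n * (s * sqrt \<epsilon>)\<bar> ^ 3 / 6 * B n \<epsilon>"
          using Bpos[OF elim] False by (intro mult_right_mono approx2) (auto simp: less_imp_le)
        then show ?case
          using Bpos(1)[OF elim, of n] False elim
          by (simp add: norm_mult abs_mult power_mult_distrib mult_ac del: of_real_power of_real_mult of_real_divide)
      qed
      have "((\<lambda>\<epsilon>. sqrt \<epsilon> ^ 3 * B n \<epsilon>) \<longlongrightarrow> 0) (at_right 0)"
        unfolding B_def using n by real_asymp
      then show "((\<lambda>\<epsilon>. (real n * \<bar>s\<bar>) ^ 3 / 6 * (sqrt \<epsilon> ^ 3 * B n \<epsilon>)) \<longlongrightarrow> 0) (at_right 0)"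
        by (intro tendsto_mult_right_zero)
    qed
    \<comment> \<open>The quadratic Taylor term times the pole of \<open>B\<close> is the only
      contribution that survives in the limit.\<close>
    have "((\<lambda>\<epsilon>. \<epsilon> * B n \<epsilon>) \<longlongrightarrow> 1 / real n) (at_right 0)"
      unfolding B_def using n by real_asymp (simp add: field_simps)
    then have "((\<lambda>\<epsilon>. (real n * s)\<^sup>2 / 2 * (\<epsilon> * B n \<epsilon>)) \<longlongrightarrow> (real n * s)\<^sup>2 / 2 * (1 / real n)) (at_right 0)"
      by (intro tendsto_intros)
    then have l2: "((\<lambda>\<epsilon>. complex_of_real ((real n * s)\<^sup>2 / 2 * (\<epsilon> * B n \<epsilon>))) \<longlongrightarrow> of_real ((real n * s)\<^sup>2 / 2 * (1 / real n))) (at_right 0)"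
      by (intro tendsto_of_real)
    have "((\<lambda>\<epsilon>. sqrt \<epsilon> * (B n \<epsilon> - 1 / (real n * \<epsilon>))) \<longlongrightarrow> 0) (at_right 0)"
      unfolding B_def using n by real_asymp
    then have "((\<lambda>\<epsilon>. real n * s * (sqrt \<epsilon> * (B n \<epsilon> - 1 / (real n * \<epsilon>)))) \<longlongrightarrow> 0) (at_right 0)"
      by (intro tendsto_mult_right_zero)
    then have l3: "((\<lambda>\<epsilon>. complex_of_real (real n * s * (sqrt \<epsilon> * (B n \<epsilon> - 1 / (real n * \<epsilon>))))) \<longlongrightarrow> of_real 0) (at_right 0)"
      by (intro tendsto_of_real)
    have "((\<lambda>\<epsilon>. of_real (z ^ n / real n) * ((iexp (real n * (s * sqrt \<epsilon>)) - 1 - \<i> * of_real (real n * (s * sqrt \<epsilon>)) +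
        of_real ((real n * (s * sqrt \<epsilon>))\<^sup>2 / 2)) * of_real (B n \<epsilon>) - complex_of_real ((real n * s)\<^sup>2 / 2 * (\<epsilon> * B n \<epsilon>))
       + \<i> * complex_of_real (real n * s * (sqrt \<epsilon> * (B n \<epsilon> - 1 / (real n * \<epsilon>))))))
      \<longlongrightarrow> of_real (z ^ n / real n) * (0 - of_real ((real n * s)\<^sup>2 / 2 * (1 / real n)) + \<i> * of_real 0)) (at_right 0)"
      by (intro tendsto_intros l1 l2 l3)
    also have "of_real (z ^ n / real n) * (0 - of_real ((real n * s)\<^sup>2 / 2 * (1 / real n)) + \<i> * of_real 0) =
       complex_of_real (z ^ n * (- s\<^sup>2 / 2)) * of_bool (n > 0)"
      using n by (simp add: power2_eq_square field_simps)
    finally show ?thesis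
    proof (rule Lim_transform_eventually)
      show "\<forall>\<^sub>F \<epsilon> in at_right 0. of_real (z ^ n / real n) * ((iexp (real n * (s * sqrt \<epsilon>)) - 1 - \<i> * of_real (real n * (s * sqrt \<epsilon>)) +
        of_real ((real n * (s * sqrt \<epsilon>))\<^sup>2 / 2)) * of_real (B n \<epsilon>) - complex_of_real ((real n * s)\<^sup>2 / 2 * (\<epsilon> * B n \<epsilon>))
       + \<i> * complex_of_real (real n * s * (sqrt \<epsilon> * (B n \<epsilon> - 1 / (real n * \<epsilon>))))) = a n \<epsilon>"
        using pos
      proof eventually_elim
        case (elim \<epsilon>)
        have "complex_of_real ((real n * (s * sqrt \<epsilon>))\<^sup>2 / 2) = of_real ((real n * s)\<^sup>2 / 2 * \<epsilon>)"
          using elim by (simp add: power_mult_distrib flip: of_real_power)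
        then show ?case
          unfolding a_eq[OF _ elim, of n, simplified n, simplified]
          using False elim by (subst a_eq) (simp_all add: algebra_simps)
      qed
    qed
  qed (simp add: a_def)
  \<comment> \<open>Dominating sequence for \<open>\<epsilon>\<close> below 1: the second-order
    Taylor bound contributes \<open>s\<^sup>2 n\<^sup>2\<close>, the bounded remainder of
    \<open>B\<close> contributes \<open>n \<bar>s\<bar>\<close>, and the coefficient divides both by
    \<open>n\<close>.\<close>
  define M where "M n = z ^ n * (s\<^sup>2 * real n + \<bar>s\<bar>)" for n
  have bd: "norm (a n \<epsilon>) \<le> M n" if "\<epsilon> > 0" "\<epsilon> < 1" for n \<epsilon>
  proof (cases "n = 0")
    case False
    then have n: "n > 0" "real n \<ge> 1" by simp_all
    let ?x = "real n * (s * sqrt \<epsilon>)"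
    have "norm ((iexp ?x - 1 - \<i> * of_real ?x) * of_real (B n \<epsilon>)) = norm (iexp ?x - 1 - \<i> * of_real ?x) * B n \<epsilon>"
      using Bpos[OF that(1) n(1)] by (simp add: norm_mult del: of_real_mult)
    also have "\<dots> \<le> ?x\<^sup>2 / 2 * (1 + 1 / (real n * \<epsilon>))"
      using Bpos[OF that(1) n(1)] by (intro mult_mono approx1) auto
    also have "\<dots> = s\<^sup>2 * (real n ^ 2 * \<epsilon> + real n) / 2"
      using that n by (simp add: power_mult_distrib power2_eq_square field_simps)
    also have "\<dots> \<le> s\<^sup>2 * real n ^ 2"
    proof -
      have "real n ^ 2 * \<epsilon> \<le> real n ^ 2 * 1" using that by (intro mult_left_mono) auto
      moreover have "real n * 1 \<le> real n * real n" using n by (intro mult_left_mono) auto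
      ultimately have "(real n ^ 2 * \<epsilon> + real n) / 2 \<le> real n ^ 2" by (simp add: power2_eq_square)
      then have "s\<^sup>2 * ((real n ^ 2 * \<epsilon> + real n) / 2) \<le> s\<^sup>2 * real n ^ 2" by (rule mult_left_mono) simp
      then show ?thesis by simp
    qed
    finally have b1: "norm ((iexp ?x - 1 - \<i> * of_real ?x) * of_real (B n \<epsilon>)) \<le> s\<^sup>2 * real n ^ 2" .
    have "norm (\<i> * complex_of_real (?x * (B n \<epsilon> - 1 / (real n * \<epsilon>)))) = real n * \<bar>s\<bar> * (sqrt \<epsilon> * \<bar>B n \<epsilon> - 1 / (real n * \<epsilon>)\<bar>)"
      using that by (simp add: norm_mult abs_mult del: of_real_mult of_real_diff)
    also have "\<dots> \<le> real n * \<bar>s\<bar> * (1 * 1)"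
      using that n bose_bounds[of "real n * \<epsilon>"] by (intro mult_left_mono mult_mono) (auto simp: B_def)
    finally have b2: "norm (\<i> * complex_of_real (?x * (B n \<epsilon> - 1 / (real n * \<epsilon>)))) \<le> real n * \<bar>s\<bar>" by simp
    have "norm (a n \<epsilon>) \<le> z ^ n / real n * (s\<^sup>2 * real n ^ 2 + real n * \<bar>s\<bar>)"
    proof -
      have "norm (a n \<epsilon>) = z ^ n / real n * norm ((iexp ?x - 1 - \<i> * of_real ?x) * of_real (B n \<epsilon>) +
          \<i> * complex_of_real (?x * (B n \<epsilon> - 1 / (real n * \<epsilon>))))"
        unfolding a_eq[OF n(1) that(1)] using z by (subst norm_mult, subst norm_of_real) simp
      also have "\<dots> \<le> z ^ n / real n * (s\<^sup>2 * real n ^ 2 + real n * \<bar>s\<bar>)"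
        using z by (intro mult_left_mono norm_triangle_le add_mono b1 b2) auto
      finally show ?thesis .
    qed
    also have "\<dots> = M n" using n by (simp add: M_def power2_eq_square field_simps)
    finally show ?thesis .
  qed (auto simp: a_def M_def)
  have sM: "summable M"
  proof -
    have "summable (\<lambda>n. of_nat (Suc n) * z ^ n - z ^ n)"
      using z by (intro summable_diff sums_summable[OF geometric_deriv_sums] summable_geometric) auto
    then have "summable (\<lambda>n. of_nat n * z ^ n)" by (simp add: algebra_simps)
    then have "summable (\<lambda>n. s\<^sup>2 * (of_nat n * z ^ n) + \<bar>s\<bar> * z ^ n)"
      using z by (intro summable_add summable_mult summable_geometric) auto
    then show ?thesis unfolding M_def[abs_def] by (simp add: algebra_simps)
  qed
  have ev: "eventually (\<lambda>(n, \<epsilon>). norm (a n \<epsilon>) \<le> M n) (at_top \<times>\<^sub>F at_right 0)"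
    using bd eventually_at_right_real[of 0 1] unfolding eventually_prod_filter
    by (intro exI[of _ "\<lambda>_. True"] exI[of _ "\<lambda>\<epsilon>. \<epsilon> \<in> {0<..<1}"]) auto
  from tannerys_theorem[OF lim ev sM]
  have "((\<lambda>\<epsilon>. \<Sum>n. a n \<epsilon>) \<longlongrightarrow> (\<Sum>n. complex_of_real (z ^ n * (- s\<^sup>2 / 2)) * of_bool (n > 0))) (at_right 0)" by simp
  also have "(\<Sum>n. complex_of_real (z ^ n * (- s\<^sup>2 / 2)) * of_bool (n > 0)) = of_real (- s\<^sup>2 / 2 * (z / (1 - z)))"
  proof -
    have "(\<lambda>n. complex_of_real (z ^ n * (- s\<^sup>2 / 2)) * of_bool (n > 0)) sums of_real (- s\<^sup>2 / 2 * (z / (1 - z)))"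
    proof -
      have "(\<lambda>n. z ^ n * (z * (- s\<^sup>2 / 2))) sums (1 / (1 - z) * (z * (- s\<^sup>2 / 2)))"
        using z by (intro sums_mult2 geometric_sums) auto
      then have "(\<lambda>n. complex_of_real (z ^ n * (z * (- s\<^sup>2 / 2)))) sums of_real (1 / (1 - z) * (z * (- s\<^sup>2 / 2)))"
        by (rule sums_of_real)
      moreover define F where "F n = complex_of_real (z ^ n * (- s\<^sup>2 / 2)) * of_bool (n > 0)" for n
      ultimately have "(\<lambda>n. F (Suc n)) sums of_real (- s\<^sup>2 / 2 * (z / (1 - z)))" by (simp add: mult_ac)
      from iffD1[OF sums_Suc_iff this] show ?thesis by (simp add: F_def)
    qed
    then show ?thesis by (rule sums_unique[symmetric])
  qed
  finally show ?thesis
  proof (rule Lim_transform_eventually)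
    show "\<forall>\<^sub>F \<epsilon> in at_right 0. (\<Sum>n. a n \<epsilon>) = q_log (exp (- \<epsilon>)) (of_real z * iexp (s * sqrt \<epsilon>)) - of_real (q_log (exp (- \<epsilon>)) z)
      + \<i> * of_real (s * sqrt \<epsilon> * ln (1 - z) / \<epsilon>)"
      using pos
    proof eventually_elim
      case (elim \<epsilon>)
      let ?q = "exp (- \<epsilon>)" and ?w = "of_real z * iexp (s * sqrt \<epsilon>)"
      have q: "0 < ?q" "?q < 1" using elim by auto
      have w: "norm ?w < 1" using z by (simp add: norm_mult)
      have "(\<lambda>n. ?w ^ n / (of_nat n * of_real (1 - ?q ^ n))) sums q_log ?q ?w"
        unfolding q_log_def by (intro summable_sums summable_norm_cancel[OF summable_q_log[OF q w]])
      moreover have "(\<lambda>n. complex_of_real (z ^ n / (of_nat n * of_real (1 - ?q ^ n)))) sums of_real (q_log ?q z)"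
        unfolding q_log_def using z
        by (intro sums_of_real summable_sums summable_norm_cancel[OF summable_q_log[OF q]]) auto
      moreover have "(\<lambda>n. \<i> * of_real (s * sqrt \<epsilon> / \<epsilon>) * of_real (z ^ n / real n)) sums (\<i> * of_real (s * sqrt \<epsilon> / \<epsilon>) * of_real (- ln (1 - z)))"
        by (intro sums_mult sums_of_real geometric_log_sums z)
      ultimately have "(\<lambda>n. ?w ^ n / (of_nat n * of_real (1 - ?q ^ n)) - complex_of_real (z ^ n / (of_nat n * of_real (1 - ?q ^ n)))
          - \<i> * of_real (s * sqrt \<epsilon> / \<epsilon>) * of_real (z ^ n / real n)) sums
         (q_log ?q ?w - of_real (q_log ?q z) - \<i> * of_real (s * sqrt \<epsilon> / \<epsilon>) * of_real (- ln (1 - z)))"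
        by (intro sums_diff)
      also have "(\<lambda>n. ?w ^ n / (of_nat n * of_real (1 - ?q ^ n)) - complex_of_real (z ^ n / (of_nat n * of_real (1 - ?q ^ n)))
          - \<i> * of_real (s * sqrt \<epsilon> / \<epsilon>) * of_real (z ^ n / real n)) = (\<lambda>n. a n \<epsilon>)"
      proof
        fix n
        have e: "iexp (s * sqrt \<epsilon>) ^ n = iexp (real n * (s * sqrt \<epsilon>))"
          by (simp add: exp_of_nat_mult[symmetric] mult_ac)
        have q': "?q ^ n = exp (- (real n * \<epsilon>))" by (simp add: exp_of_nat_mult[symmetric])
        have "x * e / (N * D) - x / (N * D) - t * (x / N) = x / N * ((e - 1) * (1 / D) - t)" for x e N D t :: complex
          by (simp add: algebra_simps divide_inverse)
        from this[of "of_real z ^ n" "iexp (real n * (s * sqrt \<epsilon>))" "of_nat n" "of_real (1 - exp (- (real n * \<epsilon>)))"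
            "\<i> * of_real (s * sqrt \<epsilon> / \<epsilon>)"]
        show "?w ^ n / (of_nat n * of_real (1 - ?q ^ n)) - complex_of_real (z ^ n / (of_nat n * of_real (1 - ?q ^ n)))
          - \<i> * of_real (s * sqrt \<epsilon> / \<epsilon>) * of_real (z ^ n / real n) = a n \<epsilon>"
          unfolding a_def B_def power_mult_distrib e q'
          by (simp del: of_real_diff)
      qed
      finally have "(\<Sum>n. a n \<epsilon>) = q_log ?q ?w - of_real (q_log ?q z) - \<i> * of_real (s * sqrt \<epsilon> / \<epsilon>) * of_real (- ln (1 - z))"
        by (rule sums_unique[symmetric])
      then show ?case by (simp add: field_simps)
    qed
  qed
qed

section \<open>Comparison with the Rogers dilogarithm\<close>

lemma dilog_deriv:
  assumes "0 < x" "x < 1"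
  shows "(dilog has_real_derivative - ln (1 - x) / x) (at x)"
proof -
  obtain K where K: "x < K" "K < 1" using assms dense by blast
  define a where "a n = 1 / real n ^ 2" for n
  have eq: "dilog = (\<lambda>x. \<Sum>n. a n * x ^ n)" by (simp add: dilog_def a_def fun_eq_iff)
  have "summable (\<lambda>n. a n * K ^ n)" using summable_dilog[of K] K assms by (simp add: a_def)
  then have "(dilog has_real_derivative (\<Sum>n. diffs a n * x ^ n)) (at x)"
    unfolding eq by (rule termdiffs_strong) (use K assms in auto)
  moreover have "(\<lambda>n. diffs a n * x ^ n) sums (- ln (1 - x) / x)"
  proof -
    define F where "F n = x ^ n / real n" for n
    have "F sums (- ln (1 - x) + F 0)" using geometric_log_sums[OF assms] by (simp add: F_def[abs_def])
    then have "(\<lambda>n. F (Suc n)) sums (- ln (1 - x))" by (rule iffD2[OF sums_Suc_iff])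
    then have "(\<lambda>n. F (Suc n) / x) sums (- ln (1 - x) / x)" by (rule sums_divide)
    moreover have "F (Suc n) / x = diffs a n * x ^ n" for n
      using assms by (simp add: F_def diffs_def a_def power2_eq_square)
    ultimately show ?thesis by simp
  qed
  ultimately show ?thesis using sums_unique[of "\<lambda>n. diffs a n * x ^ n"] by simp
qed

lemma continuous_on_dilog: "z < 1 \<Longrightarrow> continuous_on {0..z} dilog"
proof (cases "z \<ge> 0")
  case True
  assume "z < 1"
  then obtain K where K: "z < K" "K < 1" using dense by blast
  have "summable (\<lambda>n. 1 / real n ^ 2 * K ^ n)" using summable_dilog[of K] K True by simp
  then have "isCont (\<lambda>x. \<Sum>n. 1 / real n ^ 2 * x ^ n) x" if "x \<in> {0..z}" for x
    by (rule isCont_powser) (use K that in auto)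
  then have "isCont dilog x" if "x \<in> {0..z}" for x
    using that by (simp add: dilog_def[abs_def])
  then show ?thesis by (intro continuous_at_imp_continuous_on) auto
qed simp

text \<open>The function \<open>- 2 dilog x - ln x ln (1 - x)\<close> is an antiderivative of the
  integrand. The integrand is unbounded near 0, so the fundamental theorem is used with
  differentiability only in the interior.\<close>

lemma rogers_L_eq:
  assumes z: "0 < z" "z < 1"
  shows "rogers_L z = dilog z + ln z * ln (1 - z) / 2"
proof -
  define F where "F x = - 2 * dilog x - ln x * ln (1 - x)" for x
  \<comment> \<open>At 0 the product has the value 0, since its second factor is
    \<open>ln 1\<close>, and this agrees with the limit from the right.\<close>
  have cont: "continuous_on {0..z} (\<lambda>x. ln x * ln (1 - x))"
    unfolding continuous_on_def
  proof
    fix x assume x: "x \<in> {0..z}"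
    show "((\<lambda>x. ln x * ln (1 - x)) \<longlongrightarrow> ln x * ln (1 - x)) (at x within {0..z})"
    proof (cases "x = 0")
      case True
      have "((\<lambda>x::real. ln x * ln (1 - x)) \<longlongrightarrow> 0) (at_right 0)" by real_asymp
      then show ?thesis using z True by (simp add: at_within_Icc_at_right)
    next
      case False
      then show ?thesis using x z by (intro tendsto_intros) auto
    qed
  qed
  have "((\<lambda>y. ln (1 - y) / y + ln y / (1 - y)) has_integral (F z - F 0)) {0..z}"
  proof (rule fundamental_theorem_of_calculus_interior)
    show "continuous_on {0..z} F"
      unfolding F_def[abs_def] using z by (intro continuous_intros cont continuous_on_dilog) auto
  next
    fix x assume x: "x \<in> {0<..<z}"
    then have "(F has_real_derivative - 2 * (- ln (1 - x) / x) - (1 / x * ln (1 - x) + ln x * (- 1 / (1 - x)))) (at x)"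
      unfolding F_def[abs_def] using z
      by (auto intro!: derivative_eq_intros dilog_deriv)
    also have "- 2 * (- ln (1 - x) / x) - (1 / x * ln (1 - x) + ln x * (- 1 / (1 - x))) = ln (1 - x) / x + ln x / (1 - x)"
      by (simp add: field_simps)
    finally show "(F has_vector_derivative ln (1 - x) / x + ln x / (1 - x)) (at x)"
      by (simp add: has_real_derivative_iff_has_vector_derivative)
  qed (use z in simp)
  moreover have "F 0 = 0"
  proof -
    have "(\<lambda>n. (0::real) ^ n / real n ^ 2) = (\<lambda>_. 0)"
    proof
      show "(0::real) ^ n / real n ^ 2 = 0" for n by (cases n) auto
    qed
    then show ?thesis by (simp only: F_def dilog_def suminf_zero) simp
  qed
  ultimately have "integral {0..z} (\<lambda>y. ln (1 - y) / y + ln y / (1 - y)) = F z"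
    by (simp add: integral_unique)
  then show ?thesis by (simp add: rogers_L_def F_def field_simps)
qed

section \<open>The Euler distribution\<close>

definition euler_pmf :: "real \<Rightarrow> real \<Rightarrow> nat pmf" where
  "euler_pmf q z = embed_pmf (\<lambda>n. z ^ n / qfact q n * exp (- q_log q z))"

lemma pmf_euler:
  assumes q: "0 < q" "q < 1" and z: "0 < z" "z < 1"
  shows "pmf (euler_pmf q z) n = z ^ n / qfact q n * exp (- q_log q z)"
  unfolding euler_pmf_def
proof (rule pmf_embed_pmf)
  show nn: "0 \<le> z ^ n / qfact q n * exp (- q_log q z)" for n
    using z qfact_pos[OF q, of n] by simp
  have "(\<lambda>n. z ^ n / qfact q n * exp (- q_log q z)) sums (exp (q_log q z) * exp (- q_log q z))"
    by (intro sums_mult2 q_exp_sums_real q z)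
  then have "(\<Sum>n. ennreal (z ^ n / qfact q n * exp (- q_log q z))) = ennreal 1"
    by (intro suminf_ennreal_eq nn) (simp add: exp_minus)
  then show "(\<integral>\<^sup>+n. ennreal (z ^ n / qfact q n * exp (- q_log q z)) \<partial>count_space UNIV) = 1"
    by (simp add: nn_integral_count_space_nat)
qed

lemma sums_expectation_nat_pmf:
  fixes f :: "nat \<Rightarrow> complex"
  assumes "integrable (measure_pmf p) f"
  shows "(\<lambda>n. pmf p n *\<^sub>R f n) sums (\<integral>n. f n \<partial>measure_pmf p)"
proof -
  have "integrable (count_space UNIV) (\<lambda>n. pmf p n *\<^sub>R f n)"
    using assms unfolding measure_pmf_eq_density by (subst (asm) integrable_density) auto
  moreover have "(\<integral>n. f n \<partial>measure_pmf p) = (\<integral>n. pmf p n *\<^sub>R f n \<partial>count_space UNIV)"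
    unfolding measure_pmf_eq_density by (subst integral_density) auto
  ultimately show ?thesis by (simp add: sums_integral_count_space_nat)
qed

text \<open>The generating function of the Euler distribution is a quotient of two
  \<open>q\<close>-exponentials, at \<open>z iexp (s sqrt \<epsilon>)\<close> and at
  \<open>z\<close>; the centring contributes the remaining exponential.\<close>

lemma euler_char:
  assumes \<epsilon>: "\<epsilon> > 0" and z: "0 < z" "z < 1"
  shows "(\<integral>n. iexp (s * (sqrt \<epsilon> * (real n + ln (1 - z) / \<epsilon>))) \<partial>measure_pmf (euler_pmf (exp (- \<epsilon>)) z)) =
    exp (q_log (exp (- \<epsilon>)) (of_real z * iexp (s * sqrt \<epsilon>)) - of_real (q_log (exp (- \<epsilon>)) z)
      + \<i> * of_real (s * sqrt \<epsilon> * ln (1 - z) / \<epsilon>))"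
proof -
  let ?q = "exp (- \<epsilon>)"
  have q: "0 < ?q" "?q < 1" using \<epsilon> by auto
  let ?w = "of_real z * iexp (s * sqrt \<epsilon>)"
  have w: "norm ?w < 1" using z by (simp add: norm_mult)
  have "integrable (measure_pmf (euler_pmf ?q z)) (\<lambda>n. iexp (s * (sqrt \<epsilon> * (real n + ln (1 - z) / \<epsilon>))))"
    by (rule measure_pmf.integrable_const_bound[of _ 1]) (auto simp del: of_real_mult)
  from sums_expectation_nat_pmf[OF this]
  have "(\<lambda>n. pmf (euler_pmf ?q z) n *\<^sub>R iexp (s * (sqrt \<epsilon> * (real n + ln (1 - z) / \<epsilon>)))) sums
     (\<integral>n. iexp (s * (sqrt \<epsilon> * (real n + ln (1 - z) / \<epsilon>))) \<partial>measure_pmf (euler_pmf ?q z))" .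
  moreover have "pmf (euler_pmf ?q z) n *\<^sub>R iexp (s * (sqrt \<epsilon> * (real n + ln (1 - z) / \<epsilon>))) =
      ?w ^ n / of_real (qfact ?q n) * (exp (- of_real (q_log ?q z)) * iexp (s * sqrt \<epsilon> * ln (1 - z) / \<epsilon>))" for n
  proof -
    have "iexp (s * (sqrt \<epsilon> * (real n + ln (1 - z) / \<epsilon>))) = iexp (s * sqrt \<epsilon>) ^ n * iexp (s * sqrt \<epsilon> * ln (1 - z) / \<epsilon>)"
      unfolding exp_of_nat_mult[symmetric] exp_add[symmetric] by (rule arg_cong[where f = exp]) (simp add: algebra_simps)
    then show ?thesis
      unfolding pmf_euler[OF q z] by (simp add: scaleR_conv_of_real power_mult_distrib exp_of_real[symmetric])
  qed
  ultimately have "(\<lambda>n. ?w ^ n / of_real (qfact ?q n) * (exp (- of_real (q_log ?q z)) * iexp (s * sqrt \<epsilon> * ln (1 - z) / \<epsilon>))) sums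
     (\<integral>n. iexp (s * (sqrt \<epsilon> * (real n + ln (1 - z) / \<epsilon>))) \<partial>measure_pmf (euler_pmf ?q z))" by simp
  moreover have "(\<lambda>n. ?w ^ n / of_real (qfact ?q n) * (exp (- of_real (q_log ?q z)) * iexp (s * sqrt \<epsilon> * ln (1 - z) / \<epsilon>))) sums
     (exp (q_log ?q ?w) * (exp (- of_real (q_log ?q z)) * iexp (s * sqrt \<epsilon> * ln (1 - z) / \<epsilon>)))"
    by (intro sums_mult2 q_exp_sums q w)
  ultimately have "(\<integral>n. iexp (s * (sqrt \<epsilon> * (real n + ln (1 - z) / \<epsilon>))) \<partial>measure_pmf (euler_pmf ?q z)) =
      exp (q_log ?q ?w) * (exp (- of_real (q_log ?q z)) * iexp (s * sqrt \<epsilon> * ln (1 - z) / \<epsilon>))"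
    by (rule sums_unique2)
  also have "\<dots> = exp (q_log ?q ?w + (- of_real (q_log ?q z) + \<i> * of_real (s * sqrt \<epsilon> * ln (1 - z) / \<epsilon>)))"
    unfolding exp_add ..
  finally show ?thesis by (simp only: diff_conv_add_uminus add.assoc)
qed

lemma euler_central_limit:
  assumes z: "0 < z" "z < 1"
  shows "((\<lambda>\<epsilon>. \<integral>n. iexp (s * (sqrt \<epsilon> * (real n + ln (1 - z) / \<epsilon>))) \<partial>measure_pmf (euler_pmf (exp (- \<epsilon>)) z))
     \<longlongrightarrow> exp (of_real (- s\<^sup>2 / 2 * (z / (1 - z))))) (at_right 0)"
proof (rule Lim_transform_eventually)
  show "((\<lambda>\<epsilon>. exp (q_log (exp (- \<epsilon>)) (of_real z * iexp (s * sqrt \<epsilon>)) - of_real (q_log (exp (- \<epsilon>)) z)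
      + \<i> * of_real (s * sqrt \<epsilon> * ln (1 - z) / \<epsilon>))) \<longlongrightarrow> exp (complex_of_real (- s\<^sup>2 / 2 * (z / (1 - z))))) (at_right 0)"
    by (intro tendsto_exp q_log_char_asymp z)
  have "\<forall>\<^sub>F \<epsilon>::real in at_right 0. \<epsilon> > 0" by (simp add: eventually_at_right_less)
  then show "\<forall>\<^sub>F \<epsilon> in at_right 0. exp (q_log (exp (- \<epsilon>)) (of_real z * iexp (s * sqrt \<epsilon>)) - of_real (q_log (exp (- \<epsilon>)) z)
      + \<i> * of_real (s * sqrt \<epsilon> * ln (1 - z) / \<epsilon>)) =
    (\<integral>n. iexp (s * (sqrt \<epsilon> * (real n + ln (1 - z) / \<epsilon>))) \<partial>measure_pmf (euler_pmf (exp (- \<epsilon>)) z))"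
    by eventually_elim (rule euler_char[symmetric, OF _ z])
qed

section \<open>Gaussian integrals\<close>

text \<open>Matrices are given by index functions, so that an induction on the dimension can split
  off the last index without converting block matrices.\<close>

definition sym_posdef :: "nat \<Rightarrow> (nat \<Rightarrow> nat \<Rightarrow> real) \<Rightarrow> bool" where
  "sym_posdef m M \<longleftrightarrow> (\<forall>i<m. \<forall>j<m. M i j = M j i) \<and>
     (\<forall>v. (\<exists>i<m. v i \<noteq> 0) \<longrightarrow> (\<Sum>i<m. \<Sum>j<m. M i j * v i * v j) > 0)"

definition schur :: "nat \<Rightarrow> (nat \<Rightarrow> nat \<Rightarrow> real) \<Rightarrow> nat \<Rightarrow> nat \<Rightarrow> real" where
  "schur m M i j = M i j - M i m * M m j / M m m"

lemma sum_Suc_Suc: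
  fixes f :: "nat \<Rightarrow> nat \<Rightarrow> real"
  shows "(\<Sum>i<Suc m. \<Sum>j<Suc m. f i j) = (\<Sum>i<m. \<Sum>j<m. f i j) + (\<Sum>i<m. f i m) + (\<Sum>j<m. f m j) + f m m"
  by (simp add: sum.distrib)

lemma sym_posdef_last_pos:
  assumes "sym_posdef (Suc m) M"
  shows "M m m > 0"
proof -
  let ?v = "\<lambda>i. of_bool (i = m) :: real"
  have "(\<exists>i<Suc m. ?v i \<noteq> 0) \<longrightarrow> (\<Sum>i<Suc m. \<Sum>j<Suc m. M i j * ?v i * ?v j) > 0"
    using assms unfolding sym_posdef_def by (elim conjE allE)
  moreover have "\<exists>i<Suc m. ?v i \<noteq> 0" by (intro exI[of _ m]) simp
  moreover have "(\<Sum>i<Suc m. \<Sum>j<Suc m. M i j * ?v i * ?v j) = M m m"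
    unfolding sum_Suc_Suc by simp
  ultimately show ?thesis by simp
qed

lemma complete_square:
  assumes "sym_posdef (Suc m) M"
  shows "(\<Sum>i<Suc m. \<Sum>j<Suc m. M i j * v i * v j) =
    (\<Sum>i<m. \<Sum>j<m. schur m M i j * v i * v j) + M m m * (v m + (\<Sum>i<m. M i m * v i) / M m m)\<^sup>2"
proof -
  have d: "M m m > 0" using sym_posdef_last_pos assms .
  have sym: "M m j = M j m" if "j < m" for j using assms that by (simp add: sym_posdef_def)
  define S where "S = (\<Sum>i<m. M i m * v i)"
  define A where "A = (\<Sum>i<m. \<Sum>j<m. M i j * v i * v j)"
  define B where "B = (\<Sum>i<m. \<Sum>j<m. schur m M i j * v i * v j)"
  have "B = (\<Sum>i<m. \<Sum>j<m. M i j * v i * v j - (M i m * v i) * (M j m * v j) / M m m)"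
    unfolding B_def
  proof (intro sum.cong refl)
    fix i j assume "j \<in> {..<m}"
    then have "M m j = M j m" using sym by simp
    then show "schur m M i j * v i * v j = M i j * v i * v j - (M i m * v i) * (M j m * v j) / M m m"
      by (simp add: schur_def left_diff_distrib)
  qed
  also have "\<dots> = A - S * S / M m m"
    unfolding A_def S_def sum_product sum_divide_distrib sum_subtractf ..
  finally have B: "B = A - S * S / M m m" .
  have 1: "(\<Sum>i<m. M i m * v i * v m) = S * v m" by (simp add: S_def sum_distrib_right)
  have 2: "(\<Sum>j<m. M m j * v m * v j) = S * v m"
    unfolding S_def sum_distrib_right by (intro sum.cong refl) (simp add: sym)
  have "A + S * v m + S * v m + M m m * v m * v m = B + M m m * (v m + S / M m m)\<^sup>2"
    using d by (simp add: B power2_eq_square field_simps)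
  then show ?thesis
    unfolding sum_Suc_Suc S_def[symmetric] 1 2 A_def[symmetric] B_def[symmetric] .
qed

lemma schur_posdef:
  assumes "sym_posdef (Suc m) M"
  shows "sym_posdef m (schur m M)"
  unfolding sym_posdef_def
proof (intro conjI allI impI)
  fix i j assume "i < m" "j < m"
  then show "schur m M i j = schur m M j i"
    using assms by (simp add: schur_def sym_posdef_def)
next
  fix v :: "nat \<Rightarrow> real" assume "\<exists>i<m. v i \<noteq> 0"
  then obtain i where i: "i < m" "v i \<noteq> 0" by blast
  \<comment> \<open>The last coordinate is chosen to make the square in
    \<open>complete_square\<close> vanish.\<close>
  define w where "w = v(m := - ((\<Sum>i<m. M i m * v i) / M m m))"
  have w: "w i = v i" if "i < m" for i using that by (simp add: w_def)
  have wm: "w m = - ((\<Sum>i<m. M i m * v i) / M m m)" by (simp add: w_def)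
  have "0 < (\<Sum>i<Suc m. \<Sum>j<Suc m. M i j * w i * w j)"
  proof -
    have "\<exists>i<Suc m. w i \<noteq> 0" using i w[OF i(1)] by (intro exI[of _ i]) simp
    then show ?thesis using assms unfolding sym_posdef_def by blast
  qed
  also have "\<dots> = (\<Sum>i<m. \<Sum>j<m. schur m M i j * w i * w j)"
    unfolding complete_square[OF assms] by (simp add: wm w)
  finally show "0 < (\<Sum>i<m. \<Sum>j<m. schur m M i j * v i * v j)" by (simp add: w)
qed

text \<open>Block elimination: \<open>M\<close> is the product of the unipotent upper triangular
  \<open>?U\<close> and the block lower triangular \<open>?V\<close>, whose diagonal blocks are the
  Schur complement and \<open>M m m\<close>.\<close>

lemma det_schur:
  assumes "M m m \<noteq> (0::real)"
  shows "Determinant.det (Matrix.mat (Suc m) (Suc m) (\<lambda>(i, j). M i j)) =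
    M m m * Determinant.det (Matrix.mat m m (\<lambda>(i, j). schur m M i j))"
proof -
  let ?U = "four_block_mat (1\<^sub>m m) (Matrix.mat m 1 (\<lambda>(i, _). M i m / M m m)) (0\<^sub>m 1 m) (1\<^sub>m 1)"
  let ?V = "four_block_mat (Matrix.mat m m (\<lambda>(i, j). schur m M i j)) (0\<^sub>m m 1)
    (Matrix.mat 1 m (\<lambda>(_, j). M m j)) (Matrix.mat 1 1 (\<lambda>_. M m m))"
  have U: "?U \<in> carrier_mat (Suc m) (Suc m)" and V: "?V \<in> carrier_mat (Suc m) (Suc m)"
    by auto
  have "?U * ?V = four_block_mat
      (1\<^sub>m m * Matrix.mat m m (\<lambda>(i, j). schur m M i j) + Matrix.mat m 1 (\<lambda>(i, _). M i m / M m m) * Matrix.mat 1 m (\<lambda>(_, j). M m j))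
      (1\<^sub>m m * 0\<^sub>m m 1 + Matrix.mat m 1 (\<lambda>(i, _). M i m / M m m) * Matrix.mat 1 1 (\<lambda>_. M m m))
      (0\<^sub>m 1 m * Matrix.mat m m (\<lambda>(i, j). schur m M i j) + 1\<^sub>m 1 * Matrix.mat 1 m (\<lambda>(_, j). M m j))
      (0\<^sub>m 1 m * 0\<^sub>m m 1 + 1\<^sub>m 1 * Matrix.mat 1 1 (\<lambda>_. M m m))"
    by (rule mult_four_block_mat[of _ m m _ 1 _ 1]) auto
  also have "\<dots> = Matrix.mat (Suc m) (Suc m) (\<lambda>(i, j). M i j)"
    by (rule eq_matI) (use assms in \<open>auto simp: scalar_prod_def schur_def less_Suc_eq\<close>)
  finally have "Determinant.det (Matrix.mat (Suc m) (Suc m) (\<lambda>(i, j). M i j)) = Determinant.det ?U * Determinant.det ?V"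
    using det_mult[OF U V] by simp
  also have "Determinant.det ?U = Determinant.det (1\<^sub>m m :: real mat) * Determinant.det (1\<^sub>m 1 :: real mat)"
    by (rule det_four_block_mat_lower_left_zero) auto
  also have "Determinant.det ?V = Determinant.det (Matrix.mat m m (\<lambda>(i, j). schur m M i j)) * Determinant.det (Matrix.mat 1 1 (\<lambda>_. M m m))"
    by (rule det_four_block_mat_upper_right_zero) auto
  also have "Determinant.det (Matrix.mat 1 1 (\<lambda>_. M m m)) = M m m"
    by (subst det_single) auto
  finally show ?thesis by simp
qed

lemma sym_posdef_det_pos:
  "sym_posdef m M \<Longrightarrow> Determinant.det (Matrix.mat m m (\<lambda>(i, j). M i j)) > 0"
proof (induction m arbitrary: M)
  case (Suc m)
  then show ?case
    using sym_posdef_last_pos[OF Suc.prems] Suc.IH[OF schur_posdef[OF Suc.prems]]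
    by (subst det_schur) auto
qed simp

lemma cholesky:
  "sym_posdef m M \<Longrightarrow> \<exists>L. \<forall>i<m. \<forall>j<m. M i j = (\<Sum>k<m. L i k * L j k)"
proof (induction m arbitrary: M)
  case (Suc m)
  then obtain L where L: "\<And>i j. i < m \<Longrightarrow> j < m \<Longrightarrow> schur m M i j = (\<Sum>k<m. L i k * L j k)"
    using Suc.IH[OF schur_posdef[OF Suc.prems]] by blast
  have d: "M m m > 0" using sym_posdef_last_pos Suc.prems .
  have sym: "M m j = M j m" if "j < m" for j using Suc.prems that by (simp add: sym_posdef_def)
  \<comment> \<open>The last column accounts for the rank-one part removed by \<open>schur\<close>.
    The rest of the last row is 0, and the remaining block factors the Schur complement.\<close>
  define L' where "L' i k = (if k = m then M i m / sqrt (M m m) else if i = m then 0 else L i k)" for i k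
  have "M i j = (\<Sum>k<Suc m. L' i k * L' j k)" if ij: "i < Suc m" "j < Suc m" for i j
  proof -
    have d': "sqrt (M m m) * sqrt (M m m) = M m m" "sqrt (M m m) > 0" using d by auto
    have L'_m: "L' i m = M i m / sqrt (M m m)" for i by (simp add: L'_def)
    have "(\<Sum>k<m. L' i k * L' j k) = (if i = m \<or> j = m then 0 else schur m M i j)"
    proof (cases "i = m \<or> j = m")
      case True
      then show ?thesis by (auto simp: L'_def intro!: sum.neutral)
    next
      case False
      have "(\<Sum>k<m. L' i k * L' j k) = (\<Sum>k<m. L i k * L j k)"
        using False by (intro sum.cong) (auto simp: L'_def)
      then show ?thesis using False ij L[of i j] by simp
    qed
    moreover have "L' i m * L' j m = M i m * M j m / M m m"
      using d by (simp add: L'_m)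
    moreover have "M i j = (if i = m \<or> j = m then 0 else schur m M i j) + M i m * M j m / M m m"
    proof (cases "i = m \<or> j = m")
      case True
      then show ?thesis
      proof
        assume "i = m"
        then show ?thesis using d ij sym[of j] by (cases "j = m") auto
      next
        assume "j = m"
        then show ?thesis using d by simp
      qed
    next
      case False
      then show ?thesis using sym[of j] ij by (simp add: schur_def)
    qed
    ultimately show ?thesis by simp
  qed
  then show ?case by blast
qed simp

text \<open>The summand \<open>y\<^sup>2\<close> in the exponent cancels the weight of the standard
  normal density, leaving a multiple of a normal density with mean \<open>- b\<close> and variance
  \<open>1 / a\<close>.\<close>

lemma gaussian_1d:
  assumes "a > 0"
  shows "(\<integral>\<^sup>+y. ennreal (exp (- (c + a * (y + b)\<^sup>2 - y\<^sup>2) / 2)) \<partial>std_normal_distribution) =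
    ennreal (sqrt (1 / a)) * ennreal (exp (- c / 2))"
proof -
  have "std_normal_density y * exp (- (c + a * (y + b)\<^sup>2 - y\<^sup>2) / 2) =
      (sqrt (1 / a) * exp (- c / 2)) * normal_density (- b) (1 / sqrt a) y" for y
  proof -
    have "normal_density (- b) (1 / sqrt a) y = sqrt a / sqrt (2 * pi) * exp (- (a * (y + b)\<^sup>2) / 2)"
      using assms by (simp add: normal_density_def real_sqrt_divide real_sqrt_mult power_divide field_simps)
    moreover have "exp (- y\<^sup>2 / 2) * exp (- (c + a * (y + b)\<^sup>2 - y\<^sup>2) / 2) = exp (- c / 2) * exp (- (a * (y + b)\<^sup>2) / 2)"
      unfolding exp_add[symmetric] by (rule arg_cong[where f = exp]) (simp add: field_simps)
    ultimately show ?thesis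
      using assms by (simp add: std_normal_density_def real_sqrt_divide)
  qed
  then have "ennreal (std_normal_density y) * ennreal (exp (- (c + a * (y + b)\<^sup>2 - y\<^sup>2) / 2)) =
      ennreal (sqrt (1 / a) * exp (- c / 2)) * ennreal (normal_density (- b) (1 / sqrt a) y)" for y
    using assms by (subst (1 2) ennreal_mult[symmetric]) (auto simp: normal_density_nonneg)
  then have "(\<integral>\<^sup>+y. ennreal (exp (- (c + a * (y + b)\<^sup>2 - y\<^sup>2) / 2)) \<partial>std_normal_distribution) =
      (\<integral>\<^sup>+y. ennreal (sqrt (1 / a) * exp (- c / 2)) * ennreal (normal_density (- b) (1 / sqrt a) y) \<partial>lborel)"
    by (subst nn_integral_density) auto
  also have "\<dots> = ennreal (sqrt (1 / a) * exp (- c / 2)) * (\<integral>\<^sup>+y. ennreal (normal_density (- b) (1 / sqrt a) y) \<partial>lborel)"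
    by (intro nn_integral_cmult) simp
  also have "(\<integral>\<^sup>+y. ennreal (normal_density (- b) (1 / sqrt a) y) \<partial>lborel) = 1"
    using integral_normal_density[of "1 / sqrt a" "- b"] integrable_normal_density[of "1 / sqrt a" "- b"] assms
    by (subst nn_integral_eq_integral) auto
  finally show ?thesis using assms by (simp add: ennreal_mult'')
qed

section \<open>Gaussian integrals in several variables\<close>

abbreviation "gauss m \<equiv> PiM {..<m} (\<lambda>_::nat. std_normal_distribution)"

lemma measurable_gauss_component:
  "i < m \<Longrightarrow> (\<lambda>x. x i) \<in> borel_measurable (gauss m)"
  using measurable_component_singleton[of i "{..<m}" "\<lambda>_. std_normal_distribution"] by simp

lemma measurable_quadratic_form [measurable]:
  "(\<lambda>x. \<Sum>i<m. \<Sum>j<m. M i j * x i * x j) \<in> borel_measurable (gauss m)"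
  by (intro borel_measurable_sum borel_measurable_times borel_measurable_const measurable_gauss_component) auto

lemma measurable_square_norm [measurable]:
  "(\<lambda>x. \<Sum>i<m. (x i)\<^sup>2) \<in> borel_measurable (gauss m)"
  by (intro borel_measurable_sum borel_measurable_power measurable_gauss_component) auto

text \<open>Stated relative to the standard normal product measure, hence the subtracted sum of
  squares. The last coordinate is integrated out by completing the square, and the Schur complement
  passes to dimension \<open>m\<close>.\<close>

lemma gaussian_nd:
  "sym_posdef m M \<Longrightarrow>
    (\<integral>\<^sup>+x. ennreal (exp (- ((\<Sum>i<m. \<Sum>j<m. M i j * x i * x j) - (\<Sum>i<m. (x i)\<^sup>2)) / 2)) \<partial>gauss m) =
    ennreal (sqrt (1 / Determinant.det (Matrix.mat m m (\<lambda>(i, j). M i j))))"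
proof (induction m arbitrary: M)
  case 0
  then show ?case by (simp add: PiM_empty nn_integral_count_space_finite)
next
  case (Suc m)
  interpret product_sigma_finite "\<lambda>_::nat. std_normal_distribution"
    unfolding product_sigma_finite_def by (intro allI prob_space_imp_sigma_finite prob_space_normal_density) simp
  have d: "M m m > 0" using sym_posdef_last_pos Suc.prems .
  have dp: "Determinant.det (Matrix.mat m m (\<lambda>(i, j). schur m M i j)) > 0"
    using sym_posdef_det_pos schur_posdef Suc.prems by blast
  let ?q = "\<lambda>x. (\<Sum>i<Suc m. \<Sum>j<Suc m. M i j * x i * x j) - (\<Sum>i<Suc m. (x i)\<^sup>2)"
  let ?s = "\<lambda>x. (\<Sum>i<m. \<Sum>j<m. schur m M i j * x i * x j) - (\<Sum>i<m. (x i)\<^sup>2)"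
  have "(\<integral>\<^sup>+x. ennreal (exp (- ?q x / 2)) \<partial>PiM (insert m {..<m}) (\<lambda>_. std_normal_distribution)) =
     (\<integral>\<^sup>+x. \<integral>\<^sup>+y. ennreal (exp (- ?q (x(m := y)) / 2)) \<partial>std_normal_distribution \<partial>gauss m)"
  proof (rule product_nn_integral_insert)
    show "(\<lambda>x. ennreal (exp (- ?q x / 2))) \<in> borel_measurable (PiM (insert m {..<m}) (\<lambda>_. std_normal_distribution))"
      unfolding lessThan_Suc[symmetric] by measurable
  qed auto
  also have "\<dots> = (\<integral>\<^sup>+x. ennreal (sqrt (1 / M m m)) * ennreal (exp (- ?s x / 2)) \<partial>gauss m)"
  proof (intro nn_integral_cong)
    fix x :: "nat \<Rightarrow> real"
    have "?q (x(m := y)) = ?s x + M m m * (y + (\<Sum>i<m. M i m * x i) / M m m)\<^sup>2 - y\<^sup>2" for y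
      unfolding complete_square[OF Suc.prems] by simp
    then show "(\<integral>\<^sup>+y. ennreal (exp (- ?q (x(m := y)) / 2)) \<partial>std_normal_distribution) =
      ennreal (sqrt (1 / M m m)) * ennreal (exp (- ?s x / 2))"
      by (simp only: gaussian_1d[OF d])
  qed
  also have "\<dots> = ennreal (sqrt (1 / M m m)) * (\<integral>\<^sup>+x. ennreal (exp (- ?s x / 2)) \<partial>gauss m)"
    by (intro nn_integral_cmult) measurable
  also have "\<dots> = ennreal (sqrt (1 / Determinant.det (Matrix.mat (Suc m) (Suc m) (\<lambda>(i, j). M i j))))"
    unfolding Suc.IH[OF schur_posdef[OF Suc.prems]] using d dp
    by (subst det_schur) (simp_all add: ennreal_mult'[symmetric] real_sqrt_mult real_sqrt_divide)
  finally show ?case by (simp only: lessThan_Suc)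
qed

section \<open>Nahm sums\<close>

lemma expectation_complex_prod_Pi_pmf:
  fixes f :: "'a \<Rightarrow> 'b \<Rightarrow> complex"
  assumes I: "finite I" and f: "\<And>i. i \<in> I \<Longrightarrow> integrable (measure_pmf (p i)) (f i)"
  shows "(\<integral>u. (\<Prod>i\<in>I. f i (u i)) \<partial>measure_pmf (Pi_pmf I d p)) = (\<Prod>i\<in>I. \<integral>x. f i x \<partial>measure_pmf (p i))"
proof -
  have comp: "measure_pmf (p i) = measure_pmf (map_pmf (\<lambda>u. u i) (Pi_pmf I d p))" if "i \<in> I" for i
    using Pi_pmf_component[OF I, of i d p] that by simp
  have "(\<integral>u. (\<Prod>i\<in>I. f i (u i)) \<partial>measure_pmf (Pi_pmf I d p)) = (\<Prod>i\<in>I. \<integral>u. f i (u i) \<partial>measure_pmf (Pi_pmf I d p))"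
  proof (rule prob_space.indep_vars_lebesgue_integral[OF measure_pmf.prob_space_axioms I])
    show "prob_space.indep_vars (measure_pmf (Pi_pmf I d p)) (\<lambda>_. borel) (\<lambda>i u. f i (u i)) I"
      by (rule prob_space.indep_vars_compose2[OF measure_pmf.prob_space_axioms indep_vars_Pi_pmf[OF I]]) simp
    show "integrable (measure_pmf (Pi_pmf I d p)) (\<lambda>u. f i (u i))" if "i \<in> I" for i
      using f[OF that] by (simp add: comp[OF that] del: measure_map_pmf)
  qed
  also have "\<dots> = (\<Prod>i\<in>I. \<integral>x. f i x \<partial>measure_pmf (p i))"
    by (intro prod.cong refl) (simp add: comp)
  finally show ?thesis .
qed

lemma gauss_char:
  "(\<integral>g. iexp (\<Sum>k<m. a k * g k) \<partial>gauss m) = exp (- complex_of_real (\<Sum>k<m. (a k)\<^sup>2) / 2)"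
proof -
  interpret product_sigma_finite "\<lambda>_::nat. std_normal_distribution"
    unfolding product_sigma_finite_def by (intro allI prob_space_imp_sigma_finite prob_space_normal_density) simp
  interpret N: prob_space std_normal_distribution by (rule prob_space_normal_density) simp
  have int: "integrable std_normal_distribution (\<lambda>x. iexp (a k * x))" for k
    by (rule N.integrable_const_bound[of _ 1]) (auto simp del: of_real_mult)
  have "(\<integral>g. iexp (\<Sum>k<m. a k * g k) \<partial>gauss m) = (\<integral>g. (\<Prod>k<m. iexp (a k * g k)) \<partial>gauss m)"
    by (simp add: sum_distrib_left exp_sum)
  also have "\<dots> = (\<Prod>k<m. \<integral>x. iexp (a k * x) \<partial>std_normal_distribution)"
    by (rule product_integral_prod) (use int in auto)
  also have "\<dots> = (\<Prod>k<m. exp (- complex_of_real ((a k)\<^sup>2) / 2))"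
    using char_std_normal_distribution unfolding char_def fun_eq_iff by (intro prod.cong refl) (simp flip: exp_of_real)
  also have "\<dots> = exp (- complex_of_real (\<Sum>k<m. (a k)\<^sup>2) / 2)"
    by (simp add: exp_sum[symmetric] sum_negf sum_divide_distrib)
  finally show ?thesis .
qed

lemma sqrt_prod: "sqrt (\<Prod>t\<in>A. f t) = (\<Prod>t\<in>A. sqrt (f t))"
  by (induction A rule: infinite_finite_induct) (simp_all add: real_sqrt_mult)

text \<open>The assumption \<open>nahm_eq\<close> is Nahm's equation, the logarithmic form of
  \<open>z i\<close> being the product of the powers \<open>(1 - z j)\<close> to
  \<open>Q i j\<close>.\<close>

locale nahm_data =
  fixes m :: nat and Q :: "nat \<Rightarrow> nat \<Rightarrow> real" and z :: "nat \<Rightarrow> real"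
  assumes posdef: "sym_posdef m Q"
    and z_pos: "\<And>i. i < m \<Longrightarrow> 0 < z i" and z_less: "\<And>i. i < m \<Longrightarrow> z i < 1"
    and nahm_eq: "\<And>i. i < m \<Longrightarrow> ln (z i) = (\<Sum>j<m. Q i j * ln (1 - z j))"
begin

text \<open>The limiting variance of the fluctuation \<open>G\<close>.\<close>

definition D :: "nat \<Rightarrow> real" where "D j = z j / (1 - z j)"

lemma D_pos: "j < m \<Longrightarrow> D j > 0"
  using z_pos[of j] z_less[of j] by (simp add: D_def)

definition nahm_term :: "real \<Rightarrow> (nat \<Rightarrow> nat) \<Rightarrow> real" where
  "nahm_term \<epsilon> u = exp (- \<epsilon> * (\<Sum>i<m. \<Sum>j<m. Q i j * real (u i) * real (u j)) / 2) /
     (\<Prod>t<m. qfact (exp (- \<epsilon>)) (u t))"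

text \<open>The default value 0 outside the index set matches the functions in
  \<open>PiE_dflt\<close>, over which the Nahm sum is taken.\<close>

definition euler_prod :: "real \<Rightarrow> (nat \<Rightarrow> nat) pmf" where
  "euler_prod \<epsilon> = Pi_pmf {..<m} 0 (\<lambda>j. euler_pmf (exp (- \<epsilon>)) (z j))"

text \<open>The rescaled fluctuation of an Euler distributed variable around its mean.\<close>

definition G :: "real \<Rightarrow> nat \<Rightarrow> nat \<Rightarrow> real" where
  "G \<epsilon> j x = sqrt \<epsilon> * (real x + ln (1 - z j) / \<epsilon>)"

definition gauss_weight :: "real \<Rightarrow> (nat \<Rightarrow> nat) \<Rightarrow> real" where
  "gauss_weight \<epsilon> u = exp (- (\<Sum>i<m. \<Sum>j<m. Q i j * G \<epsilon> i (u i) * G \<epsilon> j (u j)) / 2)"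

text \<open>The normalisation of the Euler distributions together with the compensation for the
  constant term of the quadratic form in \<open>G\<close>.\<close>

definition norm_const :: "real \<Rightarrow> real" where
  "norm_const \<epsilon> = exp ((\<Sum>j<m. q_log (exp (- \<epsilon>)) (z j)) + (\<Sum>i<m. ln (z i) * ln (1 - z i)) / (2 * \<epsilon>))"

text \<open>Expanding the quadratic form in \<open>G\<close>, the two mixed sums agree by symmetry
  of \<open>Q\<close>, and by Nahm's equation each of them is the sum of the
  \<open>u i ln (z i)\<close>. This cancels the powers of \<open>z\<close> in the probability mass,
  so only the quadratic exponent in \<open>u\<close> remains.\<close>

lemma nahm_term_eq:
  assumes \<epsilon>: "\<epsilon> > 0" and u: "u \<in> PiE_dflt {..<m} 0 (\<lambda>_. UNIV)"
  shows "nahm_term \<epsilon> u = norm_const \<epsilon> * (pmf (euler_prod \<epsilon>) u * gauss_weight \<epsilon> u)"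
proof -
  let ?q = "exp (- \<epsilon>)"
  define l where "l j = ln (1 - z j)" for j
  have q: "0 < ?q" "?q < 1" using \<epsilon> by auto
  have sym: "Q i j = Q j i" if "i < m" "j < m" for i j using posdef that by (simp add: sym_posdef_def)
  have ln_z: "ln (z i) = (\<Sum>j<m. Q i j * l j)" if "i < m" for i using nahm_eq that by (simp add: l_def)
  have "pmf (euler_prod \<epsilon>) u = (\<Prod>j<m. pmf (euler_pmf ?q (z j)) (u j))"
    unfolding euler_prod_def using u by (subst pmf_Pi) (auto simp: PiE_dflt_def)
  also have "\<dots> = (\<Prod>j<m. exp (real (u j) * ln (z j) - q_log ?q (z j)) / qfact ?q (u j))"
    using z_pos z_less q by (intro prod.cong refl) (simp add: pmf_euler exp_diff exp_minus exp_of_nat_mult divide_inverse mult_ac)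
  also have "\<dots> = exp ((\<Sum>j<m. real (u j) * ln (z j)) - (\<Sum>j<m. q_log ?q (z j))) / (\<Prod>j<m. qfact ?q (u j))"
    by (simp add: prod_dividef exp_sum[symmetric] sum_subtractf)
  finally have pmf: "pmf (euler_prod \<epsilon>) u =
    exp ((\<Sum>j<m. real (u j) * ln (z j)) - (\<Sum>j<m. q_log ?q (z j))) / (\<Prod>j<m. qfact ?q (u j))" .
  have GG: "G \<epsilon> i (u i) * G \<epsilon> j (u j) = \<epsilon> * (real (u i) * real (u j)) + (real (u i) * l j + l i * real (u j)) + l i * l j / \<epsilon>" for i j
  proof -
    have "G \<epsilon> i (u i) * G \<epsilon> j (u j) = (sqrt \<epsilon> * sqrt \<epsilon>) * ((real (u i) + l i / \<epsilon>) * (real (u j) + l j / \<epsilon>))"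
      by (simp add: G_def l_def mult_ac)
    also have "sqrt \<epsilon> * sqrt \<epsilon> = \<epsilon>" using \<epsilon> by simp
    also have "\<epsilon> * ((real (u i) + l i / \<epsilon>) * (real (u j) + l j / \<epsilon>)) =
        \<epsilon> * (real (u i) * real (u j)) + (real (u i) * l j + l i * real (u j)) + l i * l j / \<epsilon>"
      using \<epsilon> by (simp add: field_simps)
    finally show ?thesis .
  qed
  have s1: "(\<Sum>i<m. \<Sum>j<m. Q i j * (real (u i) * l j)) = (\<Sum>i<m. real (u i) * ln (z i))"
    by (intro sum.cong refl) (simp add: ln_z sum_distrib_left mult_ac)
  have s2: "(\<Sum>i<m. \<Sum>j<m. Q i j * (l i * real (u j))) = (\<Sum>i<m. real (u i) * ln (z i))"
    by (subst sum.swap, subst s1[symmetric]) (intro sum.cong refl, simp add: sym mult_ac)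
  have s3: "(\<Sum>i<m. \<Sum>j<m. Q i j * (l i * l j / \<epsilon>)) = (\<Sum>i<m. ln (z i) * l i) / \<epsilon>"
    unfolding sum_divide_distrib by (intro sum.cong refl) (simp add: ln_z sum_distrib_left sum_distrib_right sum_divide_distrib mult_ac)
  have "(\<Sum>i<m. \<Sum>j<m. Q i j * G \<epsilon> i (u i) * G \<epsilon> j (u j)) =
      (\<Sum>i<m. \<Sum>j<m. Q i j * (\<epsilon> * (real (u i) * real (u j)))) + ((\<Sum>i<m. \<Sum>j<m. Q i j * (real (u i) * l j)) +
      (\<Sum>i<m. \<Sum>j<m. Q i j * (l i * real (u j)))) + (\<Sum>i<m. \<Sum>j<m. Q i j * (l i * l j / \<epsilon>))"
    unfolding sum.distrib[symmetric] by (intro sum.cong refl) (simp only: mult.assoc GG distrib_left)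
  also have "(\<Sum>i<m. \<Sum>j<m. Q i j * (\<epsilon> * (real (u i) * real (u j)))) = \<epsilon> * (\<Sum>i<m. \<Sum>j<m. Q i j * real (u i) * real (u j))"
    unfolding sum_distrib_left by (intro sum.cong refl) simp
  finally have "gauss_weight \<epsilon> u = exp (- (\<epsilon> * (\<Sum>i<m. \<Sum>j<m. Q i j * real (u i) * real (u j)) +
       2 * (\<Sum>i<m. real (u i) * ln (z i)) + (\<Sum>i<m. ln (z i) * l i) / \<epsilon>) / 2)"
    unfolding gauss_weight_def s1 s2 s3 by simp
  then have "norm_const \<epsilon> * (pmf (euler_prod \<epsilon>) u * gauss_weight \<epsilon> u) =
     exp ((\<Sum>j<m. q_log ?q (z j)) + (\<Sum>i<m. ln (z i) * l i) / (2 * \<epsilon>) +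
       ((\<Sum>j<m. real (u j) * ln (z j)) - (\<Sum>j<m. q_log ?q (z j))) +
       - (\<epsilon> * (\<Sum>i<m. \<Sum>j<m. Q i j * real (u i) * real (u j)) +
       2 * (\<Sum>i<m. real (u i) * ln (z i)) + (\<Sum>i<m. ln (z i) * l i) / \<epsilon>) / 2) / (\<Prod>j<m. qfact ?q (u j))"
    unfolding pmf norm_const_def l_def[symmetric] by (simp only: exp_add times_divide_eq_left times_divide_eq_right mult.assoc)
  also have "(\<Sum>j<m. q_log ?q (z j)) + (\<Sum>i<m. ln (z i) * l i) / (2 * \<epsilon>) +
       ((\<Sum>j<m. real (u j) * ln (z j)) - (\<Sum>j<m. q_log ?q (z j))) +
       - (\<epsilon> * (\<Sum>i<m. \<Sum>j<m. Q i j * real (u i) * real (u j)) +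
       2 * (\<Sum>i<m. real (u i) * ln (z i)) + (\<Sum>i<m. ln (z i) * l i) / \<epsilon>) / 2 =
      - \<epsilon> * (\<Sum>i<m. \<Sum>j<m. Q i j * real (u i) * real (u j)) / 2"
    using \<epsilon> by (simp add: field_simps)
  finally show ?thesis by (simp add: nahm_term_def)
qed

lemma gauss_weight_le_1: "gauss_weight \<epsilon> u \<le> 1"
proof -
  have "(\<Sum>i<m. \<Sum>j<m. Q i j * v i * v j) \<ge> 0" for v :: "nat \<Rightarrow> real"
  proof (cases "\<exists>i<m. v i \<noteq> 0")
    case True
    then show ?thesis using posdef by (auto simp: sym_posdef_def less_imp_le)
  qed simp
  from this[of "\<lambda>i. G \<epsilon> i (u i)"] show ?thesis by (simp add: gauss_weight_def)
qed

text \<open>The Nahm sum is a constant times an expectation. Its weight is positive and at most 1,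
  hence integrable, which also yields summability.\<close>

lemma
  assumes \<epsilon>: "\<epsilon> > 0"
  shows nahm_summable: "nahm_term \<epsilon> summable_on PiE_dflt {..<m} 0 (\<lambda>_. UNIV)"
    and nahm_infsum: "infsum (nahm_term \<epsilon>) (PiE_dflt {..<m} 0 (\<lambda>_. UNIV)) =
      norm_const \<epsilon> * (\<integral>u. gauss_weight \<epsilon> u \<partial>measure_pmf (euler_prod \<epsilon>))"
proof -
  let ?A = "PiE_dflt {..<m} 0 (\<lambda>_. UNIV) :: (nat \<Rightarrow> nat) set"
  let ?f = "\<lambda>u. pmf (euler_prod \<epsilon>) u * gauss_weight \<epsilon> u"
  \<comment> \<open>The probability mass vanishes off \<open>?A\<close>, so sums over
    \<open>?A\<close> and over all functions coincide.\<close>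
  have zero: "?f u = 0" if "u \<notin> ?A" for u
    using that unfolding euler_prod_def by (subst pmf_Pi) (auto simp: PiE_dflt_def)
  have "integrable (measure_pmf (euler_prod \<epsilon>)) (gauss_weight \<epsilon>)"
    by (rule measure_pmf.integrable_const_bound[of _ 1]) (use gauss_weight_le_1 in \<open>auto simp: gauss_weight_def\<close>)
  then have "integrable (count_space UNIV) ?f"
    unfolding measure_pmf_eq_density by (subst (asm) integrable_density) auto
  then have abs: "Infinite_Set_Sum.abs_summable_on ?f UNIV" by (simp add: Infinite_Set_Sum.abs_summable_on_def)
  then have sum: "?f summable_on UNIV" using abs_summable_equivalent abs_summable_summable by blast
  have eq: "infsum ?f UNIV = (\<integral>u. gauss_weight \<epsilon> u \<partial>measure_pmf (euler_prod \<epsilon>))"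
    by (simp add: pmf_expectation_eq_infsetsum infsetsum_infsum[OF abs])
  have sumA: "?f summable_on ?A" using sum zero by (subst summable_on_cong_neutral[where T = UNIV and g = ?f]) auto
  have eqA: "infsum ?f ?A = infsum ?f UNIV" using zero by (intro infsum_cong_neutral) auto
  show "nahm_term \<epsilon> summable_on ?A"
    using summable_on_cmult_right[OF sumA, of "norm_const \<epsilon>"] nahm_term_eq[OF \<epsilon>] by (subst summable_on_cong) auto
  show "infsum (nahm_term \<epsilon>) ?A = norm_const \<epsilon> * (\<integral>u. gauss_weight \<epsilon> u \<partial>measure_pmf (euler_prod \<epsilon>))"
    using nahm_term_eq[OF \<epsilon>] eq eqA infsum_cmult_right[OF sumA, of "norm_const \<epsilon>"] by (subst infsum_cong) auto
qed

text \<open>By \<open>rogers_L_eq\<close> the logarithmic products in \<open>norm_const\<close>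
  cancel against those in the Rogers dilogarithms, and each coordinate is left with the difference
  treated in \<open>q_log_asymp\<close>.\<close>

lemma norm_const_asymp:
  "((\<lambda>\<epsilon>. norm_const \<epsilon> * exp (- ((\<Sum>t<m. rogers_L (z t)) / \<epsilon>))) \<longlongrightarrow> 1 / sqrt (\<Prod>t<m. 1 - z t)) (at_right 0)"
proof (rule Lim_transform_eventually)
  have "((\<lambda>\<epsilon>. exp (\<Sum>t<m. q_log (exp (- \<epsilon>)) (z t) - dilog (z t) / \<epsilon>)) \<longlongrightarrow> exp (\<Sum>t<m. - ln (1 - z t) / 2)) (at_right 0)"
    by (intro tendsto_exp tendsto_sum q_log_asymp) (use z_pos z_less in auto)
  also have "exp (\<Sum>t<m. - ln (1 - z t) / 2) = 1 / sqrt (\<Prod>t<m. 1 - z t)"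
  proof -
    have "exp (- ln (1 - z t) / 2) = 1 / sqrt (1 - z t)" if "t < m" for t
    proof -
      have "- ln (1 - z t) / 2 = - ln (sqrt (1 - z t))" using z_less[OF that] by (simp add: ln_sqrt)
      then have "exp (- ln (1 - z t) / 2) = exp (- ln (sqrt (1 - z t)))" by (rule arg_cong)
      also have "\<dots> = 1 / sqrt (1 - z t)" using z_less[OF that] by (simp only: exp_minus) (simp add: divide_inverse)
      finally show ?thesis .
    qed
    then have "(\<Prod>t<m. exp (- ln (1 - z t) / 2)) = (\<Prod>t<m. 1 / sqrt (1 - z t))" by (intro prod.cong) auto
    also have "\<dots> = 1 / sqrt (\<Prod>t<m. 1 - z t)" unfolding prod_dividef sqrt_prod by simp
    finally show ?thesis by (simp only: exp_sum[OF finite_lessThan])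
  qed
  finally show "((\<lambda>\<epsilon>. exp (\<Sum>t<m. q_log (exp (- \<epsilon>)) (z t) - dilog (z t) / \<epsilon>)) \<longlongrightarrow> 1 / sqrt (\<Prod>t<m. 1 - z t)) (at_right 0)" .
  have "\<forall>\<^sub>F \<epsilon>::real in at_right 0. \<epsilon> > 0" by (simp add: eventually_at_right_less)
  then show "\<forall>\<^sub>F \<epsilon> in at_right 0. exp (\<Sum>t<m. q_log (exp (- \<epsilon>)) (z t) - dilog (z t) / \<epsilon>) =
      norm_const \<epsilon> * exp (- ((\<Sum>t<m. rogers_L (z t)) / \<epsilon>))"
  proof eventually_elim
    case (elim \<epsilon>)
    have "(\<Sum>t<m. rogers_L (z t)) = (\<Sum>t<m. dilog (z t)) + (\<Sum>t<m. ln (z t) * ln (1 - z t)) / 2"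
      unfolding sum_divide_distrib sum.distrib[symmetric]
      by (intro sum.cong refl) (simp add: rogers_L_eq z_pos z_less)
    then show ?case using elim
      by (simp add: norm_const_def exp_add[symmetric] sum_subtractf sum_divide_distrib[symmetric] add_divide_distrib)
  qed
qed

text \<open>With \<open>Q\<close> factored as \<open>L\<close> times its transpose, the vector
  \<open>h g\<close> has covariance \<open>Q\<close> for standard normal \<open>g\<close>, and the
  Gaussian weight is the characteristic function of \<open>h g\<close> at \<open>G\<close>. After
  Fubini, for fixed \<open>g\<close> the coordinates separate and the central limit theorem applies
  to each one.\<close>

lemma gauss_weight_limit:
  "((\<lambda>\<epsilon>. \<integral>u. gauss_weight \<epsilon> u \<partial>measure_pmf (euler_prod \<epsilon>)) \<longlongrightarrow>
     1 / sqrt (Determinant.det (Matrix.mat m m (\<lambda>(i, j). of_bool (i = j) + Q i j * D j)))) (at_right 0)"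
proof -
  obtain L where L: "\<And>i j. i < m \<Longrightarrow> j < m \<Longrightarrow> Q i j = (\<Sum>k<m. L i k * L j k)"
    using cholesky[OF posdef] by blast
  define h where "h g j = (\<Sum>k<m. L j k * g k)" for g :: "nat \<Rightarrow> real" and j
  define w where "w \<epsilon> g u = iexp (\<Sum>j<m. h g j * G \<epsilon> j (u j))" for \<epsilon> g and u :: "nat \<Rightarrow> nat"
  define f where "f g = exp (- complex_of_real (\<Sum>j<m. D j * (h g j)\<^sup>2) / 2)" for g
  \<comment> \<open>The matrix \<open>1 + L\<^sup>T D L\<close>. It is symmetric positive definite,
    which makes \<open>gaussian_nd\<close> applicable.\<close>
  define M where "M k l = of_bool (k = l) + (\<Sum>j<m. D j * (L j k * L j l))" for k l
  have h_meas: "(\<lambda>g. h g j) \<in> borel_measurable (gauss m)" for j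
    unfolding h_def by (intro borel_measurable_sum borel_measurable_times borel_measurable_const measurable_gauss_component) auto
  have f_meas: "f \<in> borel_measurable (gauss m)"
    unfolding f_def[abs_def] using h_meas by measurable
  interpret PS: product_prob_space "\<lambda>_::nat. std_normal_distribution"
    by (intro product_prob_spaceI prob_space_normal_density) simp
  interpret GP: prob_space "gauss m" by (rule prob_space_PiM) (intro prob_space_normal_density, simp)
  have weight: "complex_of_real (gauss_weight \<epsilon> u) = (\<integral>g. w \<epsilon> g u \<partial>gauss m)" for \<epsilon> u
  proof -
    define a where "a k = (\<Sum>j<m. L j k * G \<epsilon> j (u j))" for k
    have "(\<Sum>k<m. (a k)\<^sup>2) = (\<Sum>k<m. \<Sum>i<m. \<Sum>j<m. (L i k * G \<epsilon> i (u i)) * (L j k * G \<epsilon> j (u j)))"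
      by (simp add: a_def power2_eq_square sum_product)
    also have "\<dots> = (\<Sum>i<m. \<Sum>k<m. \<Sum>j<m. (L i k * G \<epsilon> i (u i)) * (L j k * G \<epsilon> j (u j)))" by (rule sum.swap)
    also have "\<dots> = (\<Sum>i<m. \<Sum>j<m. \<Sum>k<m. (L i k * G \<epsilon> i (u i)) * (L j k * G \<epsilon> j (u j)))"
      by (intro sum.cong refl sum.swap)
    also have "\<dots> = (\<Sum>i<m. \<Sum>j<m. Q i j * G \<epsilon> i (u i) * G \<epsilon> j (u j))"
      by (intro sum.cong refl) (simp add: L sum_distrib_left sum_distrib_right mult_ac)
    finally have sq: "(\<Sum>k<m. (a k)\<^sup>2) = (\<Sum>i<m. \<Sum>j<m. Q i j * G \<epsilon> i (u i) * G \<epsilon> j (u j))" .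
    have "(\<Sum>k<m. a k * g k) = (\<Sum>j<m. h g j * G \<epsilon> j (u j))" for g
      unfolding a_def h_def sum_distrib_right by (subst sum.swap) (simp add: mult_ac)
    then have "(\<integral>g. w \<epsilon> g u \<partial>gauss m) = (\<integral>g. iexp (\<Sum>k<m. a k * g k) \<partial>gauss m)"
      by (simp only: w_def)
    also have "\<dots> = exp (- complex_of_real (\<Sum>k<m. (a k)\<^sup>2) / 2)" by (rule gauss_char)
    also have "\<dots> = complex_of_real (gauss_weight \<epsilon> u)"
      unfolding sq gauss_weight_def exp_of_real[symmetric] by simp
    finally show ?thesis ..
  qed
  have w_meas: "case_prod (w \<epsilon>) \<in> borel_measurable (gauss m \<Otimes>\<^sub>M measure_pmf (euler_prod \<epsilon>))" for \<epsilon>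
  proof -
    have "(\<lambda>x. h (fst x) j) \<in> borel_measurable (gauss m \<Otimes>\<^sub>M measure_pmf (euler_prod \<epsilon>))" for j
      by (rule measurable_compose[OF measurable_fst h_meas])
    moreover have "(\<lambda>x. G \<epsilon> j (snd x j)) \<in> borel_measurable (gauss m \<Otimes>\<^sub>M measure_pmf (euler_prod \<epsilon>))" for j
      by (rule measurable_compose[OF measurable_snd]) simp
    ultimately show ?thesis
      unfolding w_def case_prod_beta by measurable
  qed
  have norm_w: "norm (w \<epsilon> g u) = 1" for \<epsilon> g u
    by (simp add: w_def del: of_real_sum)
  \<comment> \<open>Fubini applies because \<open>w\<close> has modulus 1 and both measures are
    probability measures.\<close>
  have swap: "(\<integral>u. complex_of_real (gauss_weight \<epsilon> u) \<partial>measure_pmf (euler_prod \<epsilon>)) =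
      (\<integral>g. (\<integral>u. w \<epsilon> g u \<partial>measure_pmf (euler_prod \<epsilon>)) \<partial>gauss m)" for \<epsilon>
  proof -
    interpret P: pair_prob_space "gauss m" "measure_pmf (euler_prod \<epsilon>)" ..
    have "integrable (gauss m \<Otimes>\<^sub>M measure_pmf (euler_prod \<epsilon>)) (case_prod (w \<epsilon>))"
      by (rule P.P.integrable_const_bound[of _ 1]) (use w_meas norm_w in auto)
    from P.Fubini_integral[OF this] show ?thesis by (simp add: weight)
  qed
  have factor: "(\<integral>u. w \<epsilon> g u \<partial>measure_pmf (euler_prod \<epsilon>)) =
      (\<Prod>j<m. \<integral>n. iexp (h g j * (sqrt \<epsilon> * (real n + ln (1 - z j) / \<epsilon>))) \<partial>measure_pmf (euler_pmf (exp (- \<epsilon>)) (z j)))" for \<epsilon> g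
  proof -
    have "w \<epsilon> g = (\<lambda>u. \<Prod>j<m. iexp (h g j * G \<epsilon> j (u j)))"
      by (simp add: w_def fun_eq_iff sum_distrib_left exp_sum)
    then have "(\<integral>u. w \<epsilon> g u \<partial>measure_pmf (euler_prod \<epsilon>)) =
       (\<integral>u. (\<Prod>j<m. iexp (h g j * G \<epsilon> j (u j))) \<partial>measure_pmf (euler_prod \<epsilon>))" by simp
    also have "\<dots> = (\<Prod>j<m. \<integral>n. iexp (h g j * G \<epsilon> j n) \<partial>measure_pmf (euler_pmf (exp (- \<epsilon>)) (z j)))"
      unfolding euler_prod_def
      by (rule expectation_complex_prod_Pi_pmf)
         (auto intro!: measure_pmf.integrable_const_bound[of _ 1] simp del: of_real_mult)
    finally show ?thesis by (simp only: G_def)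
  qed
  have lim: "((\<lambda>\<epsilon>. \<integral>u. w \<epsilon> g u \<partial>measure_pmf (euler_prod \<epsilon>)) \<longlongrightarrow> f g) (at_right 0)" for g
  proof -
    have "((\<lambda>\<epsilon>. \<integral>u. w \<epsilon> g u \<partial>measure_pmf (euler_prod \<epsilon>)) \<longlongrightarrow>
       (\<Prod>j<m. exp (of_real (- (h g j)\<^sup>2 / 2 * (z j / (1 - z j)))))) (at_right 0)"
      unfolding factor by (intro tendsto_prod euler_central_limit) (use z_pos z_less in auto)
    also have "(\<Prod>j<m. exp (complex_of_real (- (h g j)\<^sup>2 / 2 * (z j / (1 - z j))))) = f g"
      unfolding f_def exp_sum[OF finite_lessThan, symmetric]
      by (rule arg_cong[where f = exp]) (simp add: D_def sum_negf[symmetric] sum_divide_distrib mult_ac)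
    finally show ?thesis .
  qed
  \<comment> \<open>Dominated convergence is available along \<open>at_top\<close>, hence the
    substitution of \<open>inverse x\<close> for \<open>\<epsilon>\<close>; the constant 1
    dominates.\<close>
  have "((\<lambda>x. \<integral>g. (\<integral>u. w (inverse x) g u \<partial>measure_pmf (euler_prod (inverse x))) \<partial>gauss m) \<longlongrightarrow> (\<integral>g. f g \<partial>gauss m)) at_top"
  proof (rule integral_dominated_convergence_at_top[where w = "\<lambda>_. 1"])
    show "(\<lambda>g. \<integral>u. w (inverse x) g u \<partial>measure_pmf (euler_prod (inverse x))) \<in> borel_measurable (gauss m)" for x
      by (rule sigma_finite_measure.borel_measurable_lebesgue_integral[OF _ w_meas])
         (intro prob_space_imp_sigma_finite measure_pmf.prob_space_axioms)
    show "AE g in gauss m. ((\<lambda>x. \<integral>u. w (inverse x) g u \<partial>measure_pmf (euler_prod (inverse x))) \<longlongrightarrow> f g) at_top"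
      using lim by (intro AE_I2) (simp add: filterlim_at_right_to_top)
    have "norm (\<integral>u. w (inverse x) g u \<partial>measure_pmf (euler_prod (inverse x))) \<le> 1" for x g
      using integral_norm_bound[of "measure_pmf (euler_prod (inverse x))" "w (inverse x) g"] by (simp add: norm_w)
    then show "\<forall>\<^sub>F x in at_top. AE g in gauss m. norm (\<integral>u. w (inverse x) g u \<partial>measure_pmf (euler_prod (inverse x))) \<le> 1"
      by simp
  qed (use f_meas in auto)
  then have "((\<lambda>\<epsilon>. \<integral>u. complex_of_real (gauss_weight \<epsilon> u) \<partial>measure_pmf (euler_prod \<epsilon>)) \<longlongrightarrow> (\<integral>g. f g \<partial>gauss m)) (at_right 0)"
    unfolding swap filterlim_at_right_to_top .
  then have "((\<lambda>\<epsilon>. Re (complex_of_real (\<integral>u. gauss_weight \<epsilon> u \<partial>measure_pmf (euler_prod \<epsilon>)))) \<longlongrightarrow> Re (\<integral>g. f g \<partial>gauss m)) (at_right 0)"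
    unfolding integral_complex_of_real by (rule tendsto_Re)
  then have main: "((\<lambda>\<epsilon>. \<integral>u. gauss_weight \<epsilon> u \<partial>measure_pmf (euler_prod \<epsilon>)) \<longlongrightarrow> Re (\<integral>g. f g \<partial>gauss m)) (at_right 0)"
    by simp
  have quad: "(\<Sum>k<m. \<Sum>l<m. M k l * v k * v l) = (\<Sum>k<m. (v k)\<^sup>2) + (\<Sum>j<m. D j * (h v j)\<^sup>2)" for v
  proof -
    have "(\<Sum>j<m. D j * (h v j)\<^sup>2) = (\<Sum>j<m. \<Sum>k<m. \<Sum>l<m. D j * (L j k * L j l) * v k * v l)"
      by (simp add: h_def power2_eq_square sum_product sum_distrib_left mult_ac)
    also have "\<dots> = (\<Sum>k<m. \<Sum>j<m. \<Sum>l<m. D j * (L j k * L j l) * v k * v l)" by (rule sum.swap)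
    also have "\<dots> = (\<Sum>k<m. \<Sum>l<m. \<Sum>j<m. D j * (L j k * L j l) * v k * v l)" by (intro sum.cong refl sum.swap)
    finally have "(\<Sum>j<m. D j * (h v j)\<^sup>2) = (\<Sum>k<m. \<Sum>l<m. (\<Sum>j<m. D j * (L j k * L j l)) * v k * v l)"
      by (simp add: sum_distrib_right)
    moreover have "(\<Sum>k<m. (v k)\<^sup>2) = (\<Sum>k<m. \<Sum>l<m. of_bool (k = l) * v k * v l)"
    proof (intro sum.cong refl)
      fix k assume "k \<in> {..<m}"
      moreover have "(\<Sum>l<m. of_bool (k = l) * v k * v l) = (\<Sum>l<m. if k = l then v k * v k else 0)"
        by (intro sum.cong) auto
      ultimately show "(v k)\<^sup>2 = (\<Sum>l<m. of_bool (k = l) * v k * v l)" by (simp add: power2_eq_square)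
    qed
    ultimately show ?thesis unfolding M_def by (simp add: sum.distrib distrib_right)
  qed
  have M: "sym_posdef m M"
    unfolding sym_posdef_def
  proof (intro conjI allI impI)
    show "M i j = M j i" for i j by (simp add: M_def mult_ac eq_commute)
    fix v :: "nat \<Rightarrow> real" assume "\<exists>i<m. v i \<noteq> 0"
    then obtain i where i: "i < m" "v i \<noteq> 0" by blast
    have "0 < (v i)\<^sup>2" using i by simp
    also have "\<dots> \<le> (\<Sum>k<m. (v k)\<^sup>2)" using i by (intro member_le_sum) auto
    also have "\<dots> \<le> (\<Sum>k<m. (v k)\<^sup>2) + (\<Sum>j<m. D j * (h v j)\<^sup>2)"
      using D_pos by (intro add_increasing2 sum_nonneg mult_nonneg_nonneg) (auto simp: less_imp_le)
    finally show "(\<Sum>k<m. \<Sum>l<m. M k l * v k * v l) > 0" by (simp only: quad)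
  qed
  have "(\<integral>\<^sup>+g. ennreal (exp (- (\<Sum>j<m. D j * (h g j)\<^sup>2) / 2)) \<partial>gauss m) =
     ennreal (sqrt (1 / Determinant.det (Matrix.mat m m (\<lambda>(i, j). M i j))))"
    using gaussian_nd[OF M] by (simp add: quad)
  moreover have "(\<integral>g. f g \<partial>gauss m) = complex_of_real (\<integral>g. exp (- (\<Sum>j<m. D j * (h g j)\<^sup>2) / 2) \<partial>gauss m)"
    unfolding integral_complex_of_real[symmetric] f_def exp_of_real[symmetric] by simp
  moreover have "(\<lambda>g. exp (- (\<Sum>j<m. D j * (h g j)\<^sup>2) / 2)) \<in> borel_measurable (gauss m)"
    using h_meas by measurable
  ultimately have Re_f: "Re (\<integral>g. f g \<partial>gauss m) = 1 / sqrt (Determinant.det (Matrix.mat m m (\<lambda>(i, j). M i j)))"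
    using sym_posdef_det_pos[OF M] by (simp add: integral_eq_nn_integral real_sqrt_divide)
  let ?L = "Matrix.mat m m (\<lambda>(i, j). L i j)" and ?M = "Matrix.mat m m (\<lambda>(i, j). M i j)"
    and ?Q = "Matrix.mat m m (\<lambda>(i, j). Q i j)" and ?R = "Matrix.mat m m (\<lambda>(i, j). of_bool (i = j) + Q i j * D j)"
  have cL: "?L \<in> carrier_mat m m" and cM: "?M \<in> carrier_mat m m" and cR: "?R \<in> carrier_mat m m" by auto
  have "?Q = ?L * transpose_mat ?L"
    by (rule eq_matI) (auto simp: scalar_prod_def L lessThan_atLeast0)
  \<comment> \<open>Positivity of \<open>det Q\<close> shows that the factor \<open>L\<close> has
    nonzero determinant.\<close>
  then have "Determinant.det ?Q = Determinant.det ?L * Determinant.det ?L"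
    using Determinant.det_mult[OF cL, of "transpose_mat ?L"] Determinant.det_transpose[OF cL] by simp
  then have L0: "Determinant.det ?L \<noteq> 0" using sym_posdef_det_pos[OF posdef] by auto
  \<comment> \<open>From \<open>L (1 + L\<^sup>T D L) = (1 + Q D) L\<close> the determinants of
    \<open>?M\<close> and \<open>?R\<close> agree after cancelling that of
    \<open>?L\<close>.\<close>
  have "?L * ?M = ?R * ?L"
  proof (rule eq_matI)
    fix i l assume "i < dim_row (?R * ?L)" "l < dim_col (?R * ?L)"
    then have il: "i < m" "l < m" by auto
    have "(\<Sum>k<m. L i k * M k l) = (\<Sum>k<m. if k = l then L i k else 0) + (\<Sum>k<m. \<Sum>j<m. L i k * (D j * (L j k * L j l)))"
      unfolding sum.distrib[symmetric] by (intro sum.cong refl) (simp add: M_def distrib_left sum_distrib_left)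
    also have "(\<Sum>k<m. \<Sum>j<m. L i k * (D j * (L j k * L j l))) = (\<Sum>j<m. Q i j * D j * L j l)"
      using il by (subst sum.swap) (simp add: L sum_distrib_right sum_distrib_left mult_ac)
    also have "(\<Sum>k<m. if k = l then L i k else 0) = (\<Sum>j<m. if i = j then L j l else 0)"
      using il by simp
    also have "(\<Sum>j<m. if i = j then L j l else 0) + (\<Sum>j<m. Q i j * D j * L j l) = (\<Sum>j<m. (of_bool (i = j) + Q i j * D j) * L j l)"
      unfolding sum.distrib[symmetric] by (intro sum.cong refl) (simp add: distrib_right)
    finally show "(?L * ?M) $$ (i, l) = (?R * ?L) $$ (i, l)"
      using il by (simp add: scalar_prod_def lessThan_atLeast0)
  qed auto
  then have "Determinant.det ?M = Determinant.det ?R"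
    using Determinant.det_mult[OF cL cM] Determinant.det_mult[OF cR cL] L0 by (simp add: mult.commute)
  then show ?thesis using main Re_f by simp
qed

theorem nahm_sum_asymptotics:
  "((\<lambda>\<epsilon>. infsum (nahm_term \<epsilon>) (PiE_dflt {..<m} 0 (\<lambda>_. UNIV)) * exp (- ((\<Sum>t<m. rogers_L (z t)) / \<epsilon>))) \<longlongrightarrow>
    1 / sqrt ((\<Prod>t<m. 1 - z t) * Determinant.det (Matrix.mat m m (\<lambda>(i, j). of_bool (i = j) + Q i j * D j)))) (at_right 0)"
proof (rule Lim_transform_eventually)
  show "((\<lambda>\<epsilon>. (norm_const \<epsilon> * exp (- ((\<Sum>t<m. rogers_L (z t)) / \<epsilon>))) * (\<integral>u. gauss_weight \<epsilon> u \<partial>measure_pmf (euler_prod \<epsilon>))) \<longlongrightarrow>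
    1 / sqrt ((\<Prod>t<m. 1 - z t) * Determinant.det (Matrix.mat m m (\<lambda>(i, j). of_bool (i = j) + Q i j * D j)))) (at_right 0)"
    using tendsto_mult[OF norm_const_asymp gauss_weight_limit] by (simp add: real_sqrt_mult)
  have "\<forall>\<^sub>F \<epsilon>::real in at_right 0. \<epsilon> > 0" by (simp add: eventually_at_right_less)
  then show "\<forall>\<^sub>F \<epsilon> in at_right 0. (norm_const \<epsilon> * exp (- ((\<Sum>t<m. rogers_L (z t)) / \<epsilon>))) * (\<integral>u. gauss_weight \<epsilon> u \<partial>measure_pmf (euler_prod \<epsilon>)) =
    infsum (nahm_term \<epsilon>) (PiE_dflt {..<m} 0 (\<lambda>_. UNIV)) * exp (- ((\<Sum>t<m. rogers_L (z t)) / \<epsilon>))"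
    by eventually_elim (simp add: nahm_infsum)
qed

end

section \<open>The partition series as a Nahm sum\<close>

locale nondeg_mloop = fixed_mloop +
  assumes nondeg: "nondegenerate \<gamma>" and posdef: "positive_definite \<gamma>"
begin

section \<open>The quadratic form of the Nahm sum and the ratio of determinants\<close>

definition Ainv :: "real mat" where "Ainv = the (mat_inverse (A_plus_mat \<gamma>))"

definition QQ :: "real mat" where "QQ = Ainv * A_minus_mat \<gamma>"

lemma card_E: "card (E_classes \<gamma>) = T"
  using nondeg by (simp add: nondegenerate_def)

lemma E_eq: "E_classes \<gamma> = end_class \<gamma> ` {..<T}"
  using end_class_image[OF card_E] by simp

lemma A_carrier [simp]: "A_plus_mat \<gamma> \<in> carrier_mat T T" "A_minus_mat \<gamma> \<in> carrier_mat T T"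
  by (simp_all add: A_plus_mat_def A_minus_mat_def)

text \<open>Nondegeneracy provides some two-sided inverse, and the two identities force its
  dimensions. So \<open>A_plus_mat\<close> is a unit of the matrix ring and
  \<open>mat_inverse\<close> does return a value.\<close>

lemma Ainv: "Ainv \<in> carrier_mat T T" "A_plus_mat \<gamma> * Ainv = 1\<^sub>m T" "Ainv * A_plus_mat \<gamma> = 1\<^sub>m T"
proof -
  obtain B where B: "A_plus_mat \<gamma> * B = 1\<^sub>m T" "B * A_plus_mat \<gamma> = 1\<^sub>m (dim_row B)"
    using nondeg carrier_matD(1)[OF A_carrier(1)]
    unfolding nondegenerate_def invertible_mat_def inverts_mat_def by auto
  have "dim_row B = T"
    using arg_cong[OF B(2), of dim_col] carrier_matD(2)[OF A_carrier(1)] by simp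
  moreover have "dim_col B = T"
    using arg_cong[OF B(1), of dim_col] by simp
  ultimately have cB: "B \<in> carrier_mat T T" by (intro carrier_matI)
  have "A_plus_mat \<gamma> \<in> Units (ring_mat TYPE(real) T ())"
    using B cB \<open>dim_row B = T\<close> A_carrier(1) unfolding Units_def ring_mat_def by auto
  then obtain C where C: "mat_inverse (A_plus_mat \<gamma>) = Some C"
    using mat_inverse(1)[OF A_carrier(1), where b = "()"] by (cases "mat_inverse (A_plus_mat \<gamma>)") auto
  from mat_inverse(2)[OF A_carrier(1) C]
  show "Ainv \<in> carrier_mat T T" "A_plus_mat \<gamma> * Ainv = 1\<^sub>m T" "Ainv * A_plus_mat \<gamma> = 1\<^sub>m T"
    by (simp_all add: Ainv_def C)
qed

lemma det_A_plus: "Determinant.det (A_plus_mat \<gamma>) \<noteq> 0"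
proof
  assume "Determinant.det (A_plus_mat \<gamma>) = 0"
  then show False using Determinant.det_mult[OF A_carrier(1) Ainv(1)] by (simp add: Ainv)
qed

lemma QQ_carrier [simp]: "QQ \<in> carrier_mat T T"
  using Ainv by (simp add: QQ_def)

lemma A_plus_QQ: "A_plus_mat \<gamma> * QQ = A_minus_mat \<gamma>"
  using assoc_mult_mat[OF A_carrier(1) Ainv(1) A_carrier(2)] left_mult_one_mat[OF A_carrier(2)] Ainv by (simp add: QQ_def)

lemma A_plus_A_minus_sym:
  "A_plus_mat \<gamma> * transpose_mat (A_minus_mat \<gamma>) = A_minus_mat \<gamma> * transpose_mat (A_plus_mat \<gamma>)"
proof (rule eq_matI)
  fix i j assume "i < dim_row (A_minus_mat \<gamma> * transpose_mat (A_plus_mat \<gamma>))" "j < dim_col (A_minus_mat \<gamma> * transpose_mat (A_plus_mat \<gamma>))"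
  then have ij: "i < T" "j < T" by (auto simp: A_minus_mat_def A_plus_mat_def)
  have "(\<Sum>t<T. real_of_int (A_plus \<gamma> (end_class \<gamma> i) t) * real_of_int (A_minus \<gamma> (end_class \<gamma> j) t)) =
      (\<Sum>t<T. real_of_int (A_minus \<gamma> (end_class \<gamma> i) t) * real_of_int (A_plus \<gamma> (end_class \<gamma> j) t))"
    unfolding of_int_mult[symmetric] of_int_sum[symmetric]
    using A_symplectic[OF end_class_in[OF ij(1)] end_class_in[OF ij(2)]] by simp
  then show "(A_plus_mat \<gamma> * transpose_mat (A_minus_mat \<gamma>)) $$ (i, j) = (A_minus_mat \<gamma> * transpose_mat (A_plus_mat \<gamma>)) $$ (i, j)"
    using ij by (simp add: A_minus_mat_def A_plus_mat_def scalar_prod_def lessThan_atLeast0)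
qed (auto simp: A_minus_mat_def A_plus_mat_def)

text \<open>Writing \<open>P\<close> and \<open>M\<close> for the two matrices,
  \<open>M\<^sup>T\<close> times the inverse of \<open>P\<^sup>T\<close> is symmetrised by inserting
  \<open>Ainv * P\<close> in front and replacing \<open>P M\<^sup>T\<close> by
  \<open>M P\<^sup>T\<close>.\<close>

lemma QQ_sym: "transpose_mat QQ = QQ"
proof -
  let ?P = "A_plus_mat \<gamma>" and ?M = "A_minus_mat \<gamma>" and ?Pt = "transpose_mat (A_plus_mat \<gamma>)" and ?It = "transpose_mat Ainv"
  have c: "?Pt \<in> carrier_mat T T" "?It \<in> carrier_mat T T" "transpose_mat ?M \<in> carrier_mat T T" using Ainv by simp_all
  have PtIt: "?Pt * ?It = 1\<^sub>m T"
    using transpose_mult[OF Ainv(1) A_carrier(1)] by (simp add: Ainv)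
  have "transpose_mat QQ = transpose_mat ?M * ?It"
    unfolding QQ_def using transpose_mult[OF Ainv(1) A_carrier(2)] by simp
  also have "\<dots> = (Ainv * ?P) * (transpose_mat ?M * ?It)"
    using left_mult_one_mat[OF mult_carrier_mat[OF c(3,2)]] by (simp add: Ainv)
  also have "\<dots> = Ainv * ((?P * transpose_mat ?M) * ?It)"
    using assoc_mult_mat[OF Ainv(1) A_carrier(1) mult_carrier_mat[OF c(3,2)]] assoc_mult_mat[OF A_carrier(1) c(3,2)] by simp
  also have "\<dots> = Ainv * (?M * (?Pt * ?It))"
    unfolding A_plus_A_minus_sym using assoc_mult_mat[OF A_carrier(2) c(1,2)] by simp
  also have "\<dots> = QQ" using right_mult_one_mat[OF A_carrier(2)] by (simp add: PtIt QQ_def)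
  finally show ?thesis .
qed

lemma sum_mat_form:
  fixes M :: "real mat"
  assumes "M \<in> carrier_mat T T"
  shows "vec T v \<bullet> (M *\<^sub>v vec T w) = (\<Sum>i<T. \<Sum>j<T. M $$ (i, j) * v i * w j)"
  using assms by (simp add: scalar_prod_def lessThan_atLeast0 sum_distrib_left mult_ac)

lemma QQ_posdef: "sym_posdef T (\<lambda>i j. QQ $$ (i, j))"
  unfolding sym_posdef_def
proof (intro conjI allI impI)
  fix i j assume ij: "i < T" "j < T"
  have "transpose_mat QQ $$ (i, j) = QQ $$ (j, i)" using ij carrier_matD[OF QQ_carrier] by (intro index_transpose_mat) simp_all
  then show "QQ $$ (i, j) = QQ $$ (j, i)" by (simp only: QQ_sym)
next
  fix v :: "nat \<Rightarrow> real" assume "\<exists>i<T. v i \<noteq> 0"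
  then obtain i where i: "i < T" "v i \<noteq> 0" by blast
  have "Matrix.vec T v \<noteq> 0\<^sub>v T"
  proof
    assume "Matrix.vec T v = 0\<^sub>v T"
    then have "Matrix.vec T v $ i = 0\<^sub>v T $ i" by simp
    then show False using i by simp
  qed
  moreover have "\<forall>x \<in> carrier_vec T. x \<noteq> 0\<^sub>v T \<longrightarrow> x \<bullet> (QQ *\<^sub>v x) > 0"
    using posdef by (simp add: positive_definite_def QQ_def Ainv_def)
  ultimately have "Matrix.vec T v \<bullet> (QQ *\<^sub>v Matrix.vec T v) > 0" by simp
  then show "(\<Sum>i<T. \<Sum>j<T. QQ $$ (i, j) * v i * v j) > 0"
    by (simp only: sum_mat_form[OF QQ_carrier])
qed

text \<open>The identity \<open>nahm\<close> for the indicators of all end classes is a linear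
  system with matrix \<open>A_plus_mat\<close>, which is solved by multiplying with
  \<open>Ainv\<close>.\<close>

lemma nahm_matrix:
  assumes "i < T"
  shows "ln (zp i) = (\<Sum>j<T. QQ $$ (i, j) * ln (zm j))"
proof -
  let ?x = "Matrix.vec T (\<lambda>t. ln (zp t))" and ?y = "Matrix.vec T (\<lambda>t. ln (zm t))"
  have "A_plus_mat \<gamma> *\<^sub>v ?x = A_minus_mat \<gamma> *\<^sub>v ?y"
  proof (rule eq_vecI)
    fix s assume "s < dim_vec (A_minus_mat \<gamma> *\<^sub>v ?y)"
    then have s: "s < T" by (simp add: A_minus_mat_def)
    show "(A_plus_mat \<gamma> *\<^sub>v ?x) $ s = (A_minus_mat \<gamma> *\<^sub>v ?y) $ s"
      using s nahm[OF class_fun_class[OF end_class_in[OF s]]]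
      by (simp add: A_plus_mat_def A_minus_mat_def scalar_prod_def lessThan_atLeast0 A_plus_eq A_minus_eq)
  qed (simp_all add: A_plus_mat_def A_minus_mat_def)
  then have "Ainv *\<^sub>v (A_plus_mat \<gamma> *\<^sub>v ?x) = Ainv *\<^sub>v (A_minus_mat \<gamma> *\<^sub>v ?y)" by simp
  then have "(Ainv * A_plus_mat \<gamma>) *\<^sub>v ?x = QQ *\<^sub>v ?y"
    unfolding QQ_def using Ainv(1) by (simp add: assoc_mult_mat_vec[of _ T T _ T])
  then have "?x = QQ *\<^sub>v ?y" by (simp add: Ainv)
  then have "?x $ i = (QQ *\<^sub>v ?y) $ i" by simp
  then show ?thesis using assms QQ_carrier by (simp add: scalar_prod_def lessThan_atLeast0 carrier_matD)
qed

sublocale nahm: nahm_data T "\<lambda>i j. QQ $$ (i, j)" "\<lambda>t. zp t"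
  by unfold_locales (use QQ_posdef zp_pos zp_less_1 nahm_matrix in auto)

text \<open>Since \<open>A_minus_mat\<close> is \<open>A_plus_mat * QQ\<close>, the factor
  \<open>A_plus_mat\<close> can be pulled out of \<open>A_+ Z_- + A_- Z_+\<close>.\<close>

lemma WW_decomp:
  "WW = A_plus_mat \<gamma> * (Matrix.mat T T (\<lambda>(i, j). of_bool (i = j) * zm j + QQ $$ (i, j) * zp j))"
proof (rule eq_matI)
  let ?B = "Matrix.mat T T (\<lambda>(i, j). of_bool (i = j) * zm j + QQ $$ (i, j) * zp j)"
  fix s t assume "s < dim_row (A_plus_mat \<gamma> * ?B)" "t < dim_col (A_plus_mat \<gamma> * ?B)"
  then have st: "s < T" "t < T" by (auto simp: A_plus_mat_def)
  have "A_minus_mat \<gamma> $$ (s, t) = (\<Sum>l<T. A_plus_mat \<gamma> $$ (s, l) * QQ $$ (l, t))"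
    using st carrier_matD[OF A_carrier(1)] carrier_matD[OF QQ_carrier]
    by (subst A_plus_QQ[symmetric]) (simp add: scalar_prod_def lessThan_atLeast0)
  then have m: "(\<Sum>l<T. A_plus_mat \<gamma> $$ (s, l) * (QQ $$ (l, t) * zp t)) = A_minus_mat \<gamma> $$ (s, t) * zp t"
    by (simp add: sum_distrib_left sum_distrib_right mult_ac)
  have "(A_plus_mat \<gamma> * ?B) $$ (s, t) = (\<Sum>l<T. A_plus_mat \<gamma> $$ (s, l) * (of_bool (l = t) * zm t + QQ $$ (l, t) * zp t))"
    using st carrier_matD[OF A_carrier(1)] by (simp add: scalar_prod_def lessThan_atLeast0)
  also have "\<dots> = (\<Sum>l<T. if l = t then A_plus_mat \<gamma> $$ (s, l) * zm t else 0) + (\<Sum>l<T. A_plus_mat \<gamma> $$ (s, l) * (QQ $$ (l, t) * zp t))"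
    unfolding sum.distrib[symmetric] by (intro sum.cong refl) (simp add: distrib_left)
  also have "\<dots> = A_plus_mat \<gamma> $$ (s, t) * zm t + A_minus_mat \<gamma> $$ (s, t) * zp t"
    unfolding m using st by simp
  finally show "WW $$ (s, t) = (A_plus_mat \<gamma> * ?B) $$ (s, t)"
    using st by (simp add: WW_def A_plus_mat_def A_minus_mat_def)
qed (auto simp: WW_def A_plus_mat_def)

text \<open>From \<open>D zm = zp\<close> one gets \<open>Z_- + Q Z_+ = (1 + Q D) Z_-\<close>, so
  \<open>det (1 - J)\<close> is \<open>det A_+\<close> times the denominator on the right, and
  \<open>det A_+\<close> cancels.\<close>

lemma det_ratio:
  "Determinant.det (A_plus_mat \<gamma>) / Determinant.det (1\<^sub>m n - jacobian \<gamma> \<eta>) =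
    1 / ((\<Prod>t<T. 1 - zp t) * Determinant.det (Matrix.mat T T (\<lambda>(i, j). of_bool (i = j) + QQ $$ (i, j) * nahm.D j)))"
proof -
  let ?B = "Matrix.mat T T (\<lambda>(i, j). of_bool (i = j) * zm j + QQ $$ (i, j) * zp j)"
  let ?R = "Matrix.mat T T (\<lambda>(i, j). of_bool (i = j) + QQ $$ (i, j) * nahm.D j)"
  let ?Z = "Matrix.mat T T (\<lambda>(i, j). if i = j then zm j else 0)"
  have "?B = ?R * ?Z"
  proof (rule eq_matI)
    fix i j assume "i < dim_row (?R * ?Z)" "j < dim_col (?R * ?Z)"
    then have ij: "i < T" "j < T" by auto
    have "(?R * ?Z) $$ (i, j) = (\<Sum>l<T. (of_bool (i = l) + QQ $$ (i, l) * nahm.D l) * (if l = j then zm j else 0))"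
      by (simp only: mat_mult_entry[OF ij] prod.case)
    also have "\<dots> = (\<Sum>l<T. if l = j then (of_bool (i = l) + QQ $$ (i, l) * nahm.D l) * zm j else 0)"
      by (intro sum.cong refl) simp
    also have "\<dots> = of_bool (i = j) * zm j + QQ $$ (i, j) * (nahm.D j * zm j)"
      using ij by (simp add: distrib_right)
    also have "nahm.D j * zm j = zp j" using zp_less_1[OF ij(2)] by (simp add: nahm.D_def)
    finally show "?B $$ (i, j) = (?R * ?Z) $$ (i, j)" using ij by simp
  qed auto
  moreover have "Determinant.det ?Z = (\<Prod>t<T. zm t)"
    by (subst det_upper_triangular[of _ T]) (auto simp: prod_list_diag_prod lessThan_atLeast0)
  ultimately have "Determinant.det ?B = Determinant.det ?R * (\<Prod>t<T. zm t)"
    using Determinant.det_mult[of ?R T ?Z] by simp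
  then have "Determinant.det (1\<^sub>m n - jacobian \<gamma> \<eta>) = Determinant.det (A_plus_mat \<gamma>) * (Determinant.det ?R * (\<Prod>t<T. zm t))"
    unfolding det_jacobian[OF card_E] WW_decomp
    using Determinant.det_mult[OF A_carrier(1), of ?B] by simp
  then show ?thesis using det_A_plus by (simp add: mult_ac)
qed

text \<open>This is the symmetry of \<open>A_+\<close> times the transpose of \<open>A_-\<close>,
  applied to the integer combination \<open>w\<close> of classes.\<close>

lemma B_group_subset: "B_group \<gamma> \<subseteq> Z_group \<gamma>"
proof -
  have "(\<Sum>t<T. rat_of_int (A_minus \<gamma> e t) * rat_of_int (\<Sum>e'\<in>E_classes \<gamma>. A_plus \<gamma> e' t * w e')) =
     (\<Sum>t<T. rat_of_int (A_plus \<gamma> e t) * rat_of_int (\<Sum>e'\<in>E_classes \<gamma>. A_minus \<gamma> e' t * w e'))"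
    if e: "e \<in> E_classes \<gamma>" for e w
  proof -
    have "(\<Sum>t<T. A_minus \<gamma> e t * (\<Sum>e'\<in>E_classes \<gamma>. A_plus \<gamma> e' t * w e')) =
        (\<Sum>e'\<in>E_classes \<gamma>. (\<Sum>t<T. A_minus \<gamma> e t * A_plus \<gamma> e' t) * w e')"
      unfolding sum_distrib_left sum_distrib_right by (subst sum.swap) (simp add: mult_ac)
    also have "\<dots> = (\<Sum>e'\<in>E_classes \<gamma>. (\<Sum>t<T. A_plus \<gamma> e t * A_minus \<gamma> e' t) * w e')"
      by (intro sum.cong refl) (simp add: A_symplectic[OF e])
    also have "\<dots> = (\<Sum>t<T. A_plus \<gamma> e t * (\<Sum>e'\<in>E_classes \<gamma>. A_minus \<gamma> e' t * w e'))"
      unfolding sum_distrib_left sum_distrib_right by (subst sum.swap) (simp add: mult_ac)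
    finally show ?thesis unfolding of_int_mult[symmetric] of_int_sum[symmetric] by simp
  qed
  then show ?thesis by (auto simp: B_group_def Z_group_def)
qed

section \<open>Cosets of \<open>B_group\<close> in \<open>Z_group\<close>\<close>

lemma Z_group_add:
  assumes "(u, v) \<in> Z_group \<gamma>" "(b', c') \<in> Z_group \<gamma>"
  shows "(u + b', v + c') \<in> Z_group \<gamma>"
  using assms by (auto simp: Z_group_def distrib_left sum.distrib carrier_vecD)

lemma B_group_zero: "(0\<^sub>v T, 0\<^sub>v T) \<in> B_group \<gamma>"
  unfolding B_group_def by (rule image_eqI[of _ _ "\<lambda>_. 0"]) (auto intro!: eq_vecI)

lemma B_group_diff:
  assumes "(u, v) \<in> B_group \<gamma>" "(b', c') \<in> B_group \<gamma>"
  shows "(u - b', v - c') \<in> B_group \<gamma>"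
proof -
  obtain w w' where w: "u = Matrix.vec T (\<lambda>t. \<Sum>e\<in>E_classes \<gamma>. A_plus \<gamma> e t * w e)"
      "v = Matrix.vec T (\<lambda>t. rat_of_int (\<Sum>e\<in>E_classes \<gamma>. A_minus \<gamma> e t * w e))"
      "b' = Matrix.vec T (\<lambda>t. \<Sum>e\<in>E_classes \<gamma>. A_plus \<gamma> e t * w' e)"
      "c' = Matrix.vec T (\<lambda>t. rat_of_int (\<Sum>e\<in>E_classes \<gamma>. A_minus \<gamma> e t * w' e))"
    using assms by (auto simp: B_group_def)
  show ?thesis
    unfolding B_group_def w
    by (rule image_eqI[of _ _ "\<lambda>e. w e - w' e"]) (auto intro!: eq_vecI simp: right_diff_distrib sum_subtractf)
qed

lemma B_group_carrier: "(b', c') \<in> B_group \<gamma> \<Longrightarrow> b' \<in> carrier_vec T \<and> c' \<in> carrier_vec T"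
  by (auto simp: B_group_def)

lemma Z_group_carrier: "(u, v) \<in> Z_group \<gamma> \<Longrightarrow> u \<in> carrier_vec T \<and> v \<in> carrier_vec T"
  by (auto simp: Z_group_def)

definition coset :: "int vec \<times> rat vec \<Rightarrow> (int vec \<times> rat vec) set" where
  "coset x = (\<lambda>(b', c'). (fst x + b', snd x + c')) ` B_group \<gamma>"

lemma H_group_eq: "H_group \<gamma> = coset ` Z_group \<gamma>"
  unfolding H_group_def coset_def by (intro image_cong refl) auto

lemma coset_self: "x \<in> Z_group \<gamma> \<Longrightarrow> x \<in> coset x"
  unfolding coset_def using Z_group_carrier[of "fst x" "snd x"]
  by (intro image_eqI[OF _ B_group_zero]) (auto simp: prod_eq_iff)

lemma coset_subset: "x \<in> Z_group \<gamma> \<Longrightarrow> coset x \<subseteq> Z_group \<gamma>"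
  unfolding coset_def using Z_group_add[of "fst x" "snd x"] B_group_subset by (auto split: prod.splits)

lemma coset_iff:
  assumes x: "x \<in> Z_group \<gamma>" and y: "y \<in> Z_group \<gamma>"
  shows "y \<in> coset x \<longleftrightarrow> (fst y - fst x, snd y - snd x) \<in> B_group \<gamma>"
proof
  assume "y \<in> coset x"
  then obtain b' c' where bc: "(b', c') \<in> B_group \<gamma>" "y = (fst x + b', snd x + c')" by (auto simp: coset_def)
  have "fst x + b' - fst x = b'" "snd x + c' - snd x = c'"
    using B_group_carrier[OF bc(1)] Z_group_carrier[of "fst x" "snd x"] x by (auto intro!: eq_vecI)
  then show "(fst y - fst x, snd y - snd x) \<in> B_group \<gamma>" using bc by simp
next
  assume *: "(fst y - fst x, snd y - snd x) \<in> B_group \<gamma>"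
  have "fst x + (fst y - fst x) = fst y" "snd x + (snd y - snd x) = snd y"
    using Z_group_carrier[of "fst x" "snd x"] Z_group_carrier[of "fst y" "snd y"] x y by (auto intro!: eq_vecI)
  then show "y \<in> coset x" unfolding coset_def by (intro image_eqI[OF _ *]) (simp add: prod_eq_iff)
qed

lemma coset_eq:
  assumes x: "x \<in> Z_group \<gamma>" and y: "y \<in> coset x"
  shows "coset y = coset x"
proof -
  have yZ: "y \<in> Z_group \<gamma>" using coset_subset x y by blast
  have B0: "(fst y - fst x, snd y - snd x) \<in> B_group \<gamma>" using coset_iff[OF x yZ] y by simp
  have "w \<in> coset y \<longleftrightarrow> w \<in> coset x" if w: "w \<in> Z_group \<gamma>" for w
  proof -
    note cs = Z_group_carrier[of "fst x" "snd x"] Z_group_carrier[of "fst y" "snd y"] Z_group_carrier[of "fst w" "snd w"]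
    have e1: "(fst w - fst x) - (fst y - fst x) = fst w - fst y" "(snd w - snd x) - (snd y - snd x) = snd w - snd y"
      using cs x yZ w by (auto intro!: eq_vecI)
    \<comment> \<open>The negative of the difference \<open>y - x\<close>, written as a difference
      from zero so that closure under subtraction suffices.\<close>
    have N0: "(0\<^sub>v T - (fst y - fst x), 0\<^sub>v T - (snd y - snd x)) \<in> B_group \<gamma>" by (rule B_group_diff[OF B_group_zero B0])
    have e2: "(fst w - fst y) - (0\<^sub>v T - (fst y - fst x)) = fst w - fst x"
      "(snd w - snd y) - (0\<^sub>v T - (snd y - snd x)) = snd w - snd x"
      using cs x yZ w by (auto intro!: eq_vecI)
    show ?thesis
      unfolding coset_iff[OF x w] coset_iff[OF yZ w]
    proof
      assume "(fst w - fst y, snd w - snd y) \<in> B_group \<gamma>"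
      from B_group_diff[OF this N0] show "(fst w - fst x, snd w - snd x) \<in> B_group \<gamma>" by (simp only: e2)
    next
      assume "(fst w - fst x, snd w - snd x) \<in> B_group \<gamma>"
      from B_group_diff[OF this B0] show "(fst w - fst y, snd w - snd y) \<in> B_group \<gamma>" by (simp only: e1)
    qed
  qed
  then show ?thesis using coset_subset[OF x] coset_subset[OF yZ] by blast
qed

lemma H_group_coset:
  assumes "\<sigma> \<in> H_group \<gamma>" "x \<in> \<sigma>"
  shows "\<sigma> = coset x"
proof -
  obtain y where "y \<in> Z_group \<gamma>" "\<sigma> = coset y" using assms(1) unfolding H_group_eq by blast
  with coset_eq[of y x] assms(2) show ?thesis by simp
qed

lemma Z_group_rat_iff:
  "(u, v) \<in> Z_group \<gamma> \<longleftrightarrow> u \<in> carrier_vec T \<and> v \<in> carrier_vec T \<and>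
     (\<forall>s<T. (\<Sum>t<T. rat_of_int (A_minus \<gamma> (end_class \<gamma> s) t) * rat_of_int (u $ t)) =
            (\<Sum>t<T. rat_of_int (A_plus \<gamma> (end_class \<gamma> s) t) * v $ t))"
  unfolding Z_group_def E_eq by (simp, simp add: Ball_def)

text \<open>Over the reals the defining system is solved by \<open>Ainv\<close>. Thus
  \<open>v\<close> is determined by \<open>u\<close>, and \<open>u \<bullet> v\<close> becomes the
  quadratic form of \<open>QQ\<close>.\<close>

lemma Z_group_real:
  assumes "(u, v) \<in> Z_group \<gamma>"
  shows "\<And>i. i < T \<Longrightarrow> real_of_rat (v $ i) = (\<Sum>j<T. QQ $$ (i, j) * real_of_int (u $ j))"
proof -
  fix i assume i: "i < T"
  let ?u = "Matrix.vec T (\<lambda>t. real_of_int (u $ t))" and ?v = "Matrix.vec T (\<lambda>t. real_of_rat (v $ t))"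
  have "A_plus_mat \<gamma> *\<^sub>v ?v = A_minus_mat \<gamma> *\<^sub>v ?u"
  proof (rule eq_vecI)
    fix s assume "s < dim_vec (A_minus_mat \<gamma> *\<^sub>v ?u)"
    then have s: "s < T" by (simp add: A_minus_mat_def)
    have "real_of_rat (\<Sum>t<T. rat_of_int (A_minus \<gamma> (end_class \<gamma> s) t) * rat_of_int (u $ t)) =
       real_of_rat (\<Sum>t<T. rat_of_int (A_plus \<gamma> (end_class \<gamma> s) t) * v $ t)"
      using assms s unfolding Z_group_rat_iff by simp
    then show "(A_plus_mat \<gamma> *\<^sub>v ?v) $ s = (A_minus_mat \<gamma> *\<^sub>v ?u) $ s"
      using s by (simp add: A_plus_mat_def A_minus_mat_def scalar_prod_def lessThan_atLeast0 of_rat_sum of_rat_mult)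
  qed (simp_all add: A_plus_mat_def A_minus_mat_def)
  then have "Ainv *\<^sub>v (A_plus_mat \<gamma> *\<^sub>v ?v) = Ainv *\<^sub>v (A_minus_mat \<gamma> *\<^sub>v ?u)" by simp
  then have "(Ainv * A_plus_mat \<gamma>) *\<^sub>v ?v = QQ *\<^sub>v ?u"
    unfolding QQ_def using Ainv(1) by (simp add: assoc_mult_mat_vec[of _ T T _ T])
  then have "?v = QQ *\<^sub>v ?u" by (simp add: Ainv)
  then have "?v $ i = (QQ *\<^sub>v ?u) $ i" by simp
  then show "real_of_rat (v $ i) = (\<Sum>j<T. QQ $$ (i, j) * real_of_int (u $ j))"
    using i carrier_matD[OF QQ_carrier] by (simp add: scalar_prod_def lessThan_atLeast0)
qed

text \<open>The system has integer coefficients, so the nonvanishing of its determinant transfers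
  from the reals to the integers and then to the rationals, where it yields a rational solution
  \<open>v\<close>.\<close>

lemma Z_group_ex:
  assumes u: "u \<in> carrier_vec T"
  shows "\<exists>v. (u, v) \<in> Z_group \<gamma>"
proof -
  define A where "A = Matrix.mat T T (\<lambda>(s, t). A_plus \<gamma> (end_class \<gamma> s) t)"
  have A: "A \<in> carrier_mat T T" by (simp add: A_def)
  have "A_plus_mat \<gamma> = map_mat real_of_int A" by (rule eq_matI) (auto simp: A_plus_mat_def A_def)
  then have "Determinant.det A \<noteq> 0" using det_A_plus by (auto simp: of_int_hom.hom_det)
  then have "Determinant.det (map_mat rat_of_int A) \<noteq> 0" by (simp add: of_int_hom.hom_det)
  then have "map_mat rat_of_int A \<in> Units (ring_mat TYPE(rat) T ())"
    using A by (intro det_non_zero_imp_unit) auto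
  then obtain B where B: "B \<in> carrier_mat T T" "map_mat rat_of_int A * B = 1\<^sub>m T"
    by (auto simp: Units_def ring_mat_def)
  define w where "w = Matrix.vec T (\<lambda>s. \<Sum>t<T. rat_of_int (A_minus \<gamma> (end_class \<gamma> s) t) * rat_of_int (u $ t))"
  define x where "x = B *\<^sub>v w"
  have x: "x \<in> carrier_vec T" using B(1) by (simp add: x_def w_def)
  have "map_mat rat_of_int A *\<^sub>v x = w"
    using assoc_mult_mat_vec[of "map_mat rat_of_int A" T T B T w] A B by (simp add: w_def x_def)
  moreover have "(map_mat rat_of_int A *\<^sub>v x) $ s = (\<Sum>t<T. rat_of_int (A_plus \<gamma> (end_class \<gamma> s) t) * x $ t)"
    if "s < T" for s
    using that carrier_vecD[OF x] by (simp add: A_def scalar_prod_def lessThan_atLeast0)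
  ultimately have "(\<Sum>t<T. rat_of_int (A_plus \<gamma> (end_class \<gamma> s) t) * x $ t) = w $ s" if "s < T" for s
    using that by metis
  then have "(u, x) \<in> Z_group \<gamma>"
    using u x by (simp add: Z_group_rat_iff w_def)
  then show ?thesis ..
qed

section \<open>Summation over all cosets as summation over nonnegative integer vectors\<close>

definition Z_nonneg :: "(int vec \<times> rat vec) set" where
  "Z_nonneg = {(u, v) \<in> Z_group \<gamma>. \<forall>t<T. u $ t \<ge> 0}"

definition u_fun :: "int vec \<times> rat vec \<Rightarrow> nat \<Rightarrow> nat" where
  "u_fun x t = (if t < T then nat (fst x $ t) else 0)"

text \<open>Injective because \<open>v\<close> is determined by \<open>u\<close>
  (\<open>Z_group_real\<close>), surjective because every \<open>u\<close> extends
  (\<open>Z_group_ex\<close>).\<close>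

lemma bij_u_fun: "bij_betw u_fun Z_nonneg (PiE_dflt {..<T} 0 (\<lambda>_. UNIV))"
  unfolding bij_betw_def
proof
  show "inj_on u_fun Z_nonneg"
  proof (rule inj_onI, clarify)
    fix u v u' v' assume *: "(u, v) \<in> Z_nonneg" "(u', v') \<in> Z_nonneg" "u_fun (u, v) = u_fun (u', v')"
    then have Z: "(u, v) \<in> Z_group \<gamma>" "(u', v') \<in> Z_group \<gamma>"
      and nn: "\<And>t. t < T \<Longrightarrow> u $ t \<ge> 0" "\<And>t. t < T \<Longrightarrow> u' $ t \<ge> 0" by (auto simp: Z_nonneg_def)
    have "u $ t = u' $ t" if "t < T" for t
      using fun_cong[OF *(3), of t] nn[OF that] that by (simp add: u_fun_def)
    then have uu: "u = u'" using Z_group_carrier[OF Z(1)] Z_group_carrier[OF Z(2)] by (auto intro!: eq_vecI)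
    have "real_of_rat (v $ t) = real_of_rat (v' $ t)" if "t < T" for t
      using Z_group_real[OF Z(1) that] Z_group_real[OF Z(2) that] uu by simp
    then have "v = v'" using Z_group_carrier[OF Z(1)] Z_group_carrier[OF Z(2)] by (auto intro!: eq_vecI)
    with uu show "u = u' \<and> v = v'" by simp
  qed
  show "u_fun ` Z_nonneg = PiE_dflt {..<T} 0 (\<lambda>_. UNIV)"
  proof (intro equalityI subsetI)
    fix f assume "f \<in> u_fun ` Z_nonneg"
    then show "f \<in> PiE_dflt {..<T} 0 (\<lambda>_. UNIV)" by (auto simp: PiE_dflt_def u_fun_def)
  next
    fix f :: "nat \<Rightarrow> nat" assume f: "f \<in> PiE_dflt {..<T} 0 (\<lambda>_. UNIV)"
    obtain v where v: "(Matrix.vec T (\<lambda>t. int (f t)), v) \<in> Z_group \<gamma>" using Z_group_ex[of "Matrix.vec T (\<lambda>t. int (f t))"] by auto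
    then have "(Matrix.vec T (\<lambda>t. int (f t)), v) \<in> Z_nonneg" by (simp add: Z_nonneg_def)
    moreover have "u_fun (Matrix.vec T (\<lambda>t. int (f t)), v) = f"
      using f by (auto simp: u_fun_def PiE_dflt_def fun_eq_iff)
    ultimately show "f \<in> u_fun ` Z_nonneg" by (metis imageI)
  qed
qed

definition Z_term :: "real \<Rightarrow> int vec \<times> rat vec \<Rightarrow> real" where
  "Z_term x = (\<lambda>(u, v). x powr of_rat (1/2 * (map_vec rat_of_int u \<bullet> v)) / (\<Prod>t<nsteps \<gamma>. qfact x (nat (u $ t))))"

lemma Z_term_eq:
  assumes "x \<in> Z_nonneg"
  shows "Z_term (exp (- \<epsilon>)) x = nahm.nahm_term \<epsilon> (u_fun x)"
proof -
  obtain u v where x: "x = (u, v)" by (cases x)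
  have Z: "(u, v) \<in> Z_group \<gamma>" and nn: "\<And>t. t < T \<Longrightarrow> u $ t \<ge> 0" using assms by (auto simp: Z_nonneg_def x)
  have uf: "real (u_fun x t) = real_of_int (u $ t)" if "t < T" for t using nn[OF that] that by (simp add: u_fun_def x)
  have "map_vec rat_of_int u \<bullet> v = (\<Sum>t<T. rat_of_int (u $ t) * v $ t)"
    using Z_group_carrier[OF Z] by (auto simp: scalar_prod_def lessThan_atLeast0 intro!: sum.cong)
  then have "real_of_rat (map_vec rat_of_int u \<bullet> v) = (\<Sum>i<T. real_of_int (u $ i) * (\<Sum>j<T. QQ $$ (i, j) * real_of_int (u $ j)))"
    using Z_group_real[OF Z] by (simp add: of_rat_sum of_rat_mult)
  also have "\<dots> = (\<Sum>i<T. \<Sum>j<T. QQ $$ (i, j) * real (u_fun x i) * real (u_fun x j))"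
    unfolding sum_distrib_left by (intro sum.cong refl) (simp add: uf mult_ac)
  finally have "real_of_rat (1/2 * (map_vec rat_of_int u \<bullet> v)) = (\<Sum>i<T. \<Sum>j<T. QQ $$ (i, j) * real (u_fun x i) * real (u_fun x j)) / 2"
    by (simp add: of_rat_mult of_rat_divide)
  moreover have "(\<Prod>t<T. qfact (exp (- \<epsilon>)) (nat (u $ t))) = (\<Prod>t<T. qfact (exp (- \<epsilon>)) (u_fun x t))"
    by (intro prod.cong refl) (simp add: u_fun_def x)
  ultimately show ?thesis by (simp add: Z_term_def x nahm.nahm_term_def powr_def)
qed

lemma nonneg_part_H:
  assumes "\<sigma> \<in> H_group \<gamma>"
  shows "nonneg_part \<sigma> = \<sigma> \<inter> Z_nonneg"
proof -
  have "\<sigma> \<subseteq> Z_group \<gamma>" using assms coset_subset by (auto simp: H_group_eq)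
  then have "(u, v) \<in> Z_group \<gamma> \<and> dim_vec u = T" if "(u, v) \<in> \<sigma>" for u v
    using that Z_group_carrier[of u v] by auto
  then show ?thesis unfolding nonneg_part_def Z_nonneg_def by auto
qed

text \<open>The cosets partition \<open>Z_group\<close>, so their nonnegative parts partition
  \<open>Z_nonneg\<close>. Summability of the Nahm sum allows the iterated sum to be merged into one
  sum over \<open>Z_nonneg\<close>, which \<open>u_fun\<close> carries to the Nahm sum.\<close>

lemma total_partition_series_eq:
  assumes \<epsilon>: "\<epsilon> > 0"
  shows "total_partition_series \<gamma> (exp (- \<epsilon>)) = infsum (nahm.nahm_term \<epsilon>) (PiE_dflt {..<T} 0 (\<lambda>_. UNIV))"
proof -
  let ?f = "Z_term (exp (- \<epsilon>))"
  \<comment> \<open>A coset in \<open>H_group\<close> is recovered from any of its elements, so no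
    summand is counted twice.\<close>
  have inj: "inj_on snd (Sigma (H_group \<gamma>) nonneg_part)"
  proof (rule inj_onI)
    fix x y assume x: "x \<in> Sigma (H_group \<gamma>) nonneg_part" and y: "y \<in> Sigma (H_group \<gamma>) nonneg_part"
      and xy: "snd x = snd y"
    have "fst p = coset (snd p)" if "p \<in> Sigma (H_group \<gamma>) nonneg_part" for p
      using that by (intro H_group_coset) (auto simp: nonneg_part_def)
    from this[OF x] this[OF y] xy show "x = y" by (simp add: prod_eq_iff)
  qed
  have img: "snd ` Sigma (H_group \<gamma>) nonneg_part = Z_nonneg"
  proof (intro equalityI subsetI)
    fix x assume "x \<in> snd ` Sigma (H_group \<gamma>) nonneg_part"
    then show "x \<in> Z_nonneg" using nonneg_part_H by auto
  next
    fix x assume x: "x \<in> Z_nonneg"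
    then have Z: "x \<in> Z_group \<gamma>" by (auto simp: Z_nonneg_def)
    then have "coset x \<in> H_group \<gamma>" by (auto simp: H_group_eq)
    moreover from this have "x \<in> nonneg_part (coset x)" using coset_self[OF Z] x by (simp add: nonneg_part_H)
    ultimately show "x \<in> snd ` Sigma (H_group \<gamma>) nonneg_part"
      by (intro image_eqI[of _ _ "(coset x, x)"]) auto
  qed
  have "(\<lambda>x. nahm.nahm_term \<epsilon> (u_fun x)) summable_on Z_nonneg"
    using summable_on_reindex_bij_betw[OF bij_u_fun, of "nahm.nahm_term \<epsilon>"] nahm.nahm_summable[OF \<epsilon>] by simp
  then have summ: "?f summable_on Z_nonneg" by (subst summable_on_cong[OF Z_term_eq]) auto
  then have summ': "(\<lambda>p. ?f (snd p)) summable_on Sigma (H_group \<gamma>) nonneg_part"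
    using summable_on_reindex[OF inj, of ?f] by (simp add: img o_def)
  have "total_partition_series \<gamma> (exp (- \<epsilon>)) = infsum (\<lambda>\<sigma>. infsum ?f (nonneg_part \<sigma>)) (H_group \<gamma>)"
    by (simp add: total_partition_series_def partition_series_def Z_term_def)
  also have "\<dots> = infsum (\<lambda>p. ?f (snd p)) (Sigma (H_group \<gamma>) nonneg_part)"
    using infsum_Sigma'_banach[of "\<lambda>_. ?f" "H_group \<gamma>" nonneg_part] summ'
    by (simp only: case_prod_unfold)
  also have "\<dots> = infsum ?f Z_nonneg"
    using infsum_reindex[OF inj, of ?f] by (simp add: img o_def)
  also have "\<dots> = infsum (\<lambda>x. nahm.nahm_term \<epsilon> (u_fun x)) Z_nonneg"
    by (intro infsum_cong Z_term_eq)
  also have "\<dots> = infsum (nahm.nahm_term \<epsilon>) (PiE_dflt {..<T} 0 (\<lambda>_. UNIV))"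
    by (rule infsum_reindex_bij_betw[OF bij_u_fun])
  finally show ?thesis .
qed

end

theorem theorem5p11:
  fixes \<gamma> :: loop_data and \<eta> :: "nat \<Rightarrow> real" and a :: real
  assumes "mutation_loop \<gamma>"
    and "nondegenerate \<gamma>"
    and "positive_definite \<gamma>"
    and "positive_fixed_point \<gamma> \<eta>"
    and "a = (\<Sum>t<nsteps \<gamma>. rogers_L (z_plus \<gamma> \<eta> t))"
  shows "((\<lambda>\<epsilon>. total_partition_series \<gamma> (exp (- \<epsilon>)) * exp (- (a / \<epsilon>))) \<longlongrightarrow>
           sqrt (Determinant.det (A_plus_mat \<gamma>) /
                 Determinant.det (1\<^sub>m (nverts \<gamma>) - jacobian \<gamma> \<eta>)))
         (at_right 0)"
proof -
  interpret nondeg_mloop \<gamma> \<eta>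
    by unfold_locales (use assms in auto)
  have "((\<lambda>\<epsilon>. infsum (nahm.nahm_term \<epsilon>) (PiE_dflt {..<T} 0 (\<lambda>_. UNIV)) * exp (- (a / \<epsilon>))) \<longlongrightarrow>
      sqrt (Determinant.det (A_plus_mat \<gamma>) / Determinant.det (1\<^sub>m n - jacobian \<gamma> \<eta>))) (at_right 0)"
    using nahm.nahm_sum_asymptotics unfolding det_ratio assms(5) by (simp add: real_sqrt_divide)
  then show ?thesis
  proof (rule Lim_transform_eventually)
    have "\<forall>\<^sub>F \<epsilon>::real in at_right 0. \<epsilon> > 0" by (simp add: eventually_at_right_less)
    then show "\<forall>\<^sub>F \<epsilon> in at_right 0. infsum (nahm.nahm_term \<epsilon>) (PiE_dflt {..<T} 0 (\<lambda>_. UNIV)) * exp (- (a / \<epsilon>)) =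
        total_partition_series \<gamma> (exp (- \<epsilon>)) * exp (- (a / \<epsilon>))"
      by eventually_elim (simp add: total_partition_series_eq)
  qed
qed

end
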